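(* Let $(\mathbb{F},\mathbb{F}^+)$ be a field with positive elements. There exists a hypergraph functor, the black box functor, \[ \blacksquare\colon \mathrm{Circ} \to \mathrm{LagRel}, \] mapping a finite set $X$ to the symplectic vector space $\mathbb{F}^X\oplus(\mathbb{F}^X)^*$ it generates, and mapping an open circuit $(N,E,s,t,r,i,o)$ from $X$ to $Y$ to the Lagrangian relation \[ \bigcup_{v\in\mathrm{Graph}(dQ)} S^ti(v)\times So(v)\ \subseteq\ \overline{\mathbb{F}^X\oplus(\mathbb{F}^X)^*}\oplus\mathbb{F}^Y\oplus(\mathbb{F}^Y)^*, \] where $Q$ is the circuit's power functional.
   Context: A field with positive elements $(\mathbb{F},\mathbb{F}^+)$ is a field $\mathbb{F}$ with a subset $\mathbb{F}^+$ that contains $c^2$ for every nonzero $c\in\mathbb{F}$ and is closed under addition, multiplication and division. Open circuits: an open circuit $(N,E,s,t,r,i,o)$ from a finite set $X$ to a finite set $Y$ consists of finite sets $N$ (nodes) and $E$ (edges), functions $s,t\colon E\to N$ (source and target), a function $r\colon E\to\mathbb{F}^+$ (the resistance or impedance of each edge), and functions $i\colon X\to N$, $o\colon Y\to N$ (inputs and outputs). Its set of terminals is $\partial N=i(X)\cup o(Y)$. The circuit without $i,o$, that is $(N,E,s,t,r)$, is called a passive linear circuit with node set $N$. Power functional: the extended power functional is $P(\phi)=\frac12\sum_{e\in E}\frac{1}{r(e)}(\phi(t(e))-\phi(s(e)))^2$ for $\phi\in\mathbb{F}^N$. For $\psi\in\mathbb{F}^{\partial N}$, an extension $\phi\in\mathbb{F}^N$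 of $\psi$ (i.e. $\phi|_{\partial N}=\psi$) obeys the principle of minimum power if the formal partial derivative of $P$ with respect to the coordinate at $n$ vanishes at $\phi$ for all $n\in N\setminus\partial N$. Such $\phi$ exists and $P(\phi)$ does not depend on its choice; the power functional is $Q(\psi)=P(\phi)$, a quadratic form on $\mathbb{F}^{\partial N}$. Its formal differential at $\psi$ is $dQ_\psi\in(\mathbb{F}^{\partial N})^*$, and $\mathrm{Graph}(dQ)=\{(\psi,dQ_\psi)\mid\psi\in\mathbb{F}^{\partial N}\}\subseteq\mathbb{F}^{\partial N}\oplus(\mathbb{F}^{\partial N})^*$. Symplectification: identify elements of $(\mathbb{F}^S)^*$ with functions $S\to\mathbb{F}$ by means of the basis dual to the standard one. For a function $f\colon A\to B$ of finite sets and $(\psi,\iota)\in\mathbb{F}^B\oplus(\mathbb{F}^B)^*$, the image $Sf(\psi,\iota)$ is the set of all $(\psi',\iota')\in\mathbb{F}^A\oplus(\mathbb{F}^A)^*$ such that $\psi'(a)=\psi(f(a))$ for all $a\in A$ and, for each $b\in B$, $\sum_{a\in f^{-1}(b)}\iota'(a)=\iota(b)$. The twisted symplectification $S^tf$ is defined in the same way except that the sign of the currents $\iota'$ is flipped: $S^tf(\psi,\iota)=\{(\psi',-\iota')\mid(\psi',\iota')\in Sf(\psi,\iota)\}\subseteq\overline{\mathbb{F}^A\oplus(\mathbb{F}^A)^*}$. In the claim, $i$ and $o$ also denote the input and output functions with codomain restricted to $\partial N$, i.e. $i\colon X\to\partial N$ and $o\colon Y\to\partial N$. Hypergraph categories: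 a hypergraph category is a symmetric monoidal category in which each object $X$ is equipped with a special commutative Frobenius structure $\mu_X\colon X\otimes X\to X$, $\eta_X\colon I\to X$, $\delta_X\colon X\to X\otimes X$, $\epsilon_X\colon X\to I$ (commutative monoid, cocommutative comonoid, Frobenius law $(1\otimes\mu)(\delta\otimes1)=\delta\mu=(\mu\otimes1)(1\otimes\delta)$, special law $\mu\delta=1$), such that the structure on $X\otimes Y$ is the tensor product of those on $X$ and $Y$ (using the symmetry to exchange the middle factors) and the structure on $I$ is given by unitors and identities. A hypergraph functor is a strong symmetric monoidal functor $(F,\varphi)$ such that the Frobenius structure on $FX$ has multiplication $F\mu_X\circ\varphi_{X,X}$, unit $F\eta_X\circ\varphi_I$, comultiplication $\varphi_{X,X}^{-1}\circ F\delta_X$ and counit $\varphi_I^{-1}\circ F\epsilon_X$. The category $\mathrm{Circ}$: objects are finite sets; morphisms $X\to Y$ are equivalence classes of open circuits from $X$ to $Y$, regarded as cospans $X\xrightarrow{i}N\xleftarrow{o}Y$ whose apex $N$ is decorated by a passive linear circuit with node set $N$; two are equivalent when an isomorphism of cospans (a bijection of the apices commuting with the legs) carries one decoration to the other. The composite of open circuits on $X\to N\leftarrow Y$ and $Y\to M\leftarrow W$ has the pushout cospan $X\to N+_YM\leftarrow W$ and the disjoint union of the edge sets, with source and target maps composed with the canonical map $N+M\to N+_YM$ and the same labels. The tensor product is disjoint union of sets and of circuits. The Frobenius structure on $X$ is given by the cospans $X+X\xrightarrow{[1,1]}X\xleftarrow{1}X$, $\varnothing\to X\xleftarrow{1}X$,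 $X\xrightarrow{1}X\xleftarrow{[1,1]}X+X$, $X\xrightarrow{1}X\leftarrow\varnothing$ with no edges; the symmetry and other structure maps are likewise cospans with no edges. The category $\mathrm{LagRel}$: for a finite set $X$ the vector space $\mathbb{F}^X\oplus(\mathbb{F}^X)^*$ has symplectic form $\omega((\phi,i),(\phi',i'))=i'(\phi)-i(\phi')$; $\overline{V}$ denotes $V$ with the form $-\omega$. A subspace of a symplectic vector space is Lagrangian if it is a maximal isotropic subspace. Objects of $\mathrm{LagRel}$ are finite sets, the finite set $X$ standing for the symplectic vector space $\mathbb{F}^X\oplus(\mathbb{F}^X)^*$; morphisms $X\to Y$ are Lagrangian relations, i.e. Lagrangian subspaces of $\overline{\mathbb{F}^X\oplus(\mathbb{F}^X)^*}\oplus\mathbb{F}^Y\oplus(\mathbb{F}^Y)^*$, composed as relations. The tensor product is disjoint union on objects and direct sum on morphisms. The hypergraph structure has $\mu_X=\{(\phi,\phi,i_1,i_2,\phi,i_1+i_2)\}$ (potentials $\phi,\phi$ and currents $i_1,i_2$ on $X+X$; potential $\phi$ and current $i_1+i_2$ on $X$), $\eta_X=\{(\phi,0)\}$, and $\delta_X,\epsilon_X$ the converse relations of $\mu_X,\eta_X$, with $\phi\in\mathbb{F}^X$ and $i_1,i_2\in(\mathbb{F}^X)^*$ arbitrary.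
   Formalization: The displayed union is not Lagrangian for the identity circuit; it is replaced by the union over (ψ,ι) in Graph(dQ) and ι=ι₁+ι₂ of Sᵗi(ψ,ι₁)×So(ψ,ι₂). Edge sets of circuits are taken up to bijection, so that composition is associative and unital. *)

theory Defs
  imports
    "HOL-Computational_Algebra.Polynomial"
    "HOL-Library.FSet"
    "HOL-Library.FuncSet"
    "HOL-Library.Function_Algebras"
    "HOL-Library.Product_Plus"
begin

section \<open>Hypergraph categories and hypergraph functors\<close>

text \<open>
  Composition is written in applicative order, \<open>g \<cdot> f\<close> being \<open>g\<close> after \<open>f\<close>, and associates to the
  left.  Composites and tensors of arrows are only constrained where they are well-typed.
\<close>

record ('o, 'm) cat_data =
  Obj :: "'o set"
  Hom :: "'o \<Rightarrow> 'o \<Rightarrow> 'm set"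
  Id :: "'o \<Rightarrow> 'm"
  Comp :: "'m \<Rightarrow> 'm \<Rightarrow> 'm"  (infixl "\<cdot>\<index>" 65)

record ('o, 'm) smc_data = "('o, 'm) cat_data" +
  TensO :: "'o \<Rightarrow> 'o \<Rightarrow> 'o"  (infixr "\<odot>\<index>" 75)
  TensM :: "'m \<Rightarrow> 'm \<Rightarrow> 'm"  (infixr "\<otimes>\<index>" 75)
  UnitO :: "'o"
  Assoc :: "'o \<Rightarrow> 'o \<Rightarrow> 'o \<Rightarrow> 'm"   \<comment> \<open>\<open>(X \<odot> Y) \<odot> Z \<rightarrow> X \<odot> (Y \<odot> Z)\<close>\<close>
  LUnit :: "'o \<Rightarrow> 'm"                 \<comment> \<open>\<open>I \<odot> X \<rightarrow> X\<close>\<close>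
  RUnit :: "'o \<Rightarrow> 'm"                 \<comment> \<open>\<open>X \<odot> I \<rightarrow> X\<close>\<close>
  Symm :: "'o \<Rightarrow> 'o \<Rightarrow> 'm"           \<comment> \<open>\<open>X \<odot> Y \<rightarrow> Y \<odot> X\<close>\<close>

record ('o, 'm) hyper_data = "('o, 'm) smc_data" +
  Mu :: "'o \<Rightarrow> 'm"
  Eta :: "'o \<Rightarrow> 'm"
  Delta :: "'o \<Rightarrow> 'm"
  Eps :: "'o \<Rightarrow> 'm"

definition inverse_arrows ::
  "('o, 'm, 'x) cat_data_scheme \<Rightarrow> 'o \<Rightarrow> 'o \<Rightarrow> 'm \<Rightarrow> 'm \<Rightarrow> bool" where
  "inverse_arrows C X Y f g \<longleftrightarrow>
     f \<in> Hom C X Y \<and> g \<in> Hom C Y X \<and> g \<cdot>\<^bsub>C\<^esub> f = Id C X \<and> f \<cdot>\<^bsub>C\<^esub> g = Id C Y"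

definition iso_arrow :: "('o, 'm, 'x) cat_data_scheme \<Rightarrow> 'o \<Rightarrow> 'o \<Rightarrow> 'm \<Rightarrow> bool" where
  "iso_arrow C X Y f \<longleftrightarrow> (\<exists>g. inverse_arrows C X Y f g)"

definition inv_arrow :: "('o, 'm, 'x) cat_data_scheme \<Rightarrow> 'o \<Rightarrow> 'o \<Rightarrow> 'm \<Rightarrow> 'm" where
  "inv_arrow C X Y f = (THE g. inverse_arrows C X Y f g)"

locale cat =
  fixes C :: "('o, 'm, 'x) cat_data_scheme" (structure)
  assumes id_hom: "X \<in> Obj C \<Longrightarrow> Id C X \<in> Hom C X X"
    and comp_hom: "\<lbrakk>X \<in> Obj C; Y \<in> Obj C; Z \<in> Obj C; f \<in> Hom C X Y; g \<in> Hom C Y Z\<rbrakk>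
      \<Longrightarrow> g \<cdot> f \<in> Hom C X Z"
    and comp_id: "\<lbrakk>X \<in> Obj C; Y \<in> Obj C; f \<in> Hom C X Y\<rbrakk> \<Longrightarrow> f \<cdot> Id C X = f"
    and id_comp: "\<lbrakk>X \<in> Obj C; Y \<in> Obj C; f \<in> Hom C X Y\<rbrakk> \<Longrightarrow> Id C Y \<cdot> f = f"
    and comp_assoc: "\<lbrakk>W \<in> Obj C; X \<in> Obj C; Y \<in> Obj C; Z \<in> Obj C;
        f \<in> Hom C W X; g \<in> Hom C X Y; h \<in> Hom C Y Z\<rbrakk> \<Longrightarrow> h \<cdot> g \<cdot> f = h \<cdot> (g \<cdot> f)"

locale symmetric_monoidal_cat = cat C
  for C :: "('o, 'm, 'x) smc_data_scheme" (structure) +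
  assumes unit_obj: "UnitO C \<in> Obj C"
    and tens_obj: "\<lbrakk>X \<in> Obj C; Y \<in> Obj C\<rbrakk> \<Longrightarrow> X \<odot> Y \<in> Obj C"
    and tens_hom: "\<lbrakk>X \<in> Obj C; Y \<in> Obj C; X' \<in> Obj C; Y' \<in> Obj C; f \<in> Hom C X Y; f' \<in> Hom C X' Y'\<rbrakk>
      \<Longrightarrow> f \<otimes> f' \<in> Hom C (X \<odot> X') (Y \<odot> Y')"
    and tens_id: "\<lbrakk>X \<in> Obj C; Y \<in> Obj C\<rbrakk> \<Longrightarrow> Id C X \<otimes> Id C Y = Id C (X \<odot> Y)"
    and tens_comp: "\<lbrakk>X \<in> Obj C; Y \<in> Obj C; Z \<in> Obj C; X' \<in> Obj C; Y' \<in> Obj C; Z' \<in> Obj C;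
        f \<in> Hom C X Y; g \<in> Hom C Y Z; f' \<in> Hom C X' Y'; g' \<in> Hom C Y' Z'\<rbrakk>
      \<Longrightarrow> (g \<cdot> f) \<otimes> (g' \<cdot> f') = (g \<otimes> g') \<cdot> (f \<otimes> f')"
    and assoc_iso: "\<lbrakk>X \<in> Obj C; Y \<in> Obj C; Z \<in> Obj C\<rbrakk>
      \<Longrightarrow> iso_arrow C ((X \<odot> Y) \<odot> Z) (X \<odot> (Y \<odot> Z)) (Assoc C X Y Z)"
    and lunit_iso: "X \<in> Obj C \<Longrightarrow> iso_arrow C (UnitO C \<odot> X) X (LUnit C X)"
    and runit_iso: "X \<in> Obj C \<Longrightarrow> iso_arrow C (X \<odot> UnitO C) X (RUnit C X)"
    and symm_hom: "\<lbrakk>X \<in> Obj C; Y \<in> Obj C\<rbrakk> \<Longrightarrow> Symm C X Y \<in> Hom C (X \<odot> Y) (Y \<odot> X)"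
    and assoc_nat: "\<lbrakk>X \<in> Obj C; Y \<in> Obj C; Z \<in> Obj C; X' \<in> Obj C; Y' \<in> Obj C; Z' \<in> Obj C;
        f \<in> Hom C X X'; g \<in> Hom C Y Y'; h \<in> Hom C Z Z'\<rbrakk>
      \<Longrightarrow> Assoc C X' Y' Z' \<cdot> ((f \<otimes> g) \<otimes> h) = (f \<otimes> (g \<otimes> h)) \<cdot> Assoc C X Y Z"
    and lunit_nat: "\<lbrakk>X \<in> Obj C; Y \<in> Obj C; f \<in> Hom C X Y\<rbrakk>
      \<Longrightarrow> LUnit C Y \<cdot> (Id C (UnitO C) \<otimes> f) = f \<cdot> LUnit C X"
    and runit_nat: "\<lbrakk>X \<in> Obj C; Y \<in> Obj C; f \<in> Hom C X Y\<rbrakk>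
      \<Longrightarrow> RUnit C Y \<cdot> (f \<otimes> Id C (UnitO C)) = f \<cdot> RUnit C X"
    and symm_nat: "\<lbrakk>X \<in> Obj C; Y \<in> Obj C; X' \<in> Obj C; Y' \<in> Obj C; f \<in> Hom C X X'; g \<in> Hom C Y Y'\<rbrakk>
      \<Longrightarrow> Symm C X' Y' \<cdot> (f \<otimes> g) = (g \<otimes> f) \<cdot> Symm C X Y"
    and pentagon: "\<lbrakk>W \<in> Obj C; X \<in> Obj C; Y \<in> Obj C; Z \<in> Obj C\<rbrakk>
      \<Longrightarrow> (Id C W \<otimes> Assoc C X Y Z) \<cdot> Assoc C W (X \<odot> Y) Z \<cdot> (Assoc C W X Y \<otimes> Id C Z)
          = Assoc C W X (Y \<odot> Z) \<cdot> Assoc C (W \<odot> X) Y Z"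
    and triangle: "\<lbrakk>X \<in> Obj C; Y \<in> Obj C\<rbrakk>
      \<Longrightarrow> (Id C X \<otimes> LUnit C Y) \<cdot> Assoc C X (UnitO C) Y = RUnit C X \<otimes> Id C Y"
    and hexagon: "\<lbrakk>X \<in> Obj C; Y \<in> Obj C; Z \<in> Obj C\<rbrakk>
      \<Longrightarrow> Assoc C Y Z X \<cdot> Symm C X (Y \<odot> Z) \<cdot> Assoc C X Y Z
          = (Id C Y \<otimes> Symm C X Z) \<cdot> Assoc C Y X Z \<cdot> (Symm C X Y \<otimes> Id C Z)"
    and symm_symm: "\<lbrakk>X \<in> Obj C; Y \<in> Obj C\<rbrakk> \<Longrightarrow> Symm C Y X \<cdot> Symm C X Y = Id C (X \<odot> Y)"

text \<open>The exchange of the middle factors \<open>(X \<odot> Y) \<odot> (Z \<odot> W) \<rightarrow> (X \<odot> Z) \<odot> (Y \<odot> W)\<close>.\<close>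

definition middle_swap :: "('o, 'm, 'x) smc_data_scheme \<Rightarrow> 'o \<Rightarrow> 'o \<Rightarrow> 'o \<Rightarrow> 'o \<Rightarrow> 'm" where
  "middle_swap C X Y Z W =
     inv_arrow C ((X \<odot>\<^bsub>C\<^esub> Z) \<odot>\<^bsub>C\<^esub> (Y \<odot>\<^bsub>C\<^esub> W)) (X \<odot>\<^bsub>C\<^esub> (Z \<odot>\<^bsub>C\<^esub> (Y \<odot>\<^bsub>C\<^esub> W)))
       (Assoc C X Z (Y \<odot>\<^bsub>C\<^esub> W))
     \<cdot>\<^bsub>C\<^esub> (Id C X \<otimes>\<^bsub>C\<^esub>
         (Assoc C Z Y W
          \<cdot>\<^bsub>C\<^esub> (Symm C Y Z \<otimes>\<^bsub>C\<^esub> Id C W)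
          \<cdot>\<^bsub>C\<^esub> inv_arrow C ((Y \<odot>\<^bsub>C\<^esub> Z) \<odot>\<^bsub>C\<^esub> W) (Y \<odot>\<^bsub>C\<^esub> (Z \<odot>\<^bsub>C\<^esub> W)) (Assoc C Y Z W)))
     \<cdot>\<^bsub>C\<^esub> Assoc C X Y (Z \<odot>\<^bsub>C\<^esub> W)"

locale hypergraph_cat = symmetric_monoidal_cat C
  for C :: "('o, 'm, 'x) hyper_data_scheme" (structure) +
  assumes mu_hom: "X \<in> Obj C \<Longrightarrow> Mu C X \<in> Hom C (X \<odot> X) X"
    and eta_hom: "X \<in> Obj C \<Longrightarrow> Eta C X \<in> Hom C (UnitO C) X"
    and delta_hom: "X \<in> Obj C \<Longrightarrow> Delta C X \<in> Hom C X (X \<odot> X)"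
    and eps_hom: "X \<in> Obj C \<Longrightarrow> Eps C X \<in> Hom C X (UnitO C)"
    and mu_assoc: "X \<in> Obj C
      \<Longrightarrow> Mu C X \<cdot> (Mu C X \<otimes> Id C X) = Mu C X \<cdot> (Id C X \<otimes> Mu C X) \<cdot> Assoc C X X X"
    and mu_lunit: "X \<in> Obj C \<Longrightarrow> Mu C X \<cdot> (Eta C X \<otimes> Id C X) = LUnit C X"
    and mu_runit: "X \<in> Obj C \<Longrightarrow> Mu C X \<cdot> (Id C X \<otimes> Eta C X) = RUnit C X"
    and mu_comm: "X \<in> Obj C \<Longrightarrow> Mu C X \<cdot> Symm C X X = Mu C X"
    and delta_coassoc: "X \<in> Obj C
      \<Longrightarrow> Assoc C X X X \<cdot> (Delta C X \<otimes> Id C X) \<cdot> Delta C X = (Id C X \<otimes> Delta C X) \<cdot> Delta C X"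
    and delta_lcounit: "X \<in> Obj C \<Longrightarrow> LUnit C X \<cdot> (Eps C X \<otimes> Id C X) \<cdot> Delta C X = Id C X"
    and delta_rcounit: "X \<in> Obj C \<Longrightarrow> RUnit C X \<cdot> (Id C X \<otimes> Eps C X) \<cdot> Delta C X = Id C X"
    and delta_cocomm: "X \<in> Obj C \<Longrightarrow> Symm C X X \<cdot> Delta C X = Delta C X"
    and frobenius_left: "X \<in> Obj C
      \<Longrightarrow> (Id C X \<otimes> Mu C X) \<cdot> Assoc C X X X \<cdot> (Delta C X \<otimes> Id C X) = Delta C X \<cdot> Mu C X"
    and frobenius_right: "X \<in> Obj C
      \<Longrightarrow> (Mu C X \<otimes> Id C X) \<cdot> inv_arrow C ((X \<odot> X) \<odot> X) (X \<odot> (X \<odot> X)) (Assoc C X X X)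
            \<cdot> (Id C X \<otimes> Delta C X) = Delta C X \<cdot> Mu C X"
    and special: "X \<in> Obj C \<Longrightarrow> Mu C X \<cdot> Delta C X = Id C X"
    and mu_tens: "\<lbrakk>X \<in> Obj C; Y \<in> Obj C\<rbrakk>
      \<Longrightarrow> Mu C (X \<odot> Y) = (Mu C X \<otimes> Mu C Y) \<cdot> middle_swap C X Y X Y"
    and eta_tens: "\<lbrakk>X \<in> Obj C; Y \<in> Obj C\<rbrakk>
      \<Longrightarrow> Eta C (X \<odot> Y) = (Eta C X \<otimes> Eta C Y)
            \<cdot> inv_arrow C (UnitO C \<odot> UnitO C) (UnitO C) (LUnit C (UnitO C))"
    and delta_tens: "\<lbrakk>X \<in> Obj C; Y \<in> Obj C\<rbrakk>
      \<Longrightarrow> Delta C (X \<odot> Y) = middle_swap C X X Y Y \<cdot> (Delta C X \<otimes> Delta C Y)"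
    and eps_tens: "\<lbrakk>X \<in> Obj C; Y \<in> Obj C\<rbrakk>
      \<Longrightarrow> Eps C (X \<odot> Y) = LUnit C (UnitO C) \<cdot> (Eps C X \<otimes> Eps C Y)"
    and mu_unit: "Mu C (UnitO C) = LUnit C (UnitO C)"
    and eta_unit: "Eta C (UnitO C) = Id C (UnitO C)"
    and delta_unit: "Delta C (UnitO C)
      = inv_arrow C (UnitO C \<odot> UnitO C) (UnitO C) (LUnit C (UnitO C))"
    and eps_unit: "Eps C (UnitO C) = Id C (UnitO C)"

locale hypergraph_functor = C: hypergraph_cat C + D: hypergraph_cat D
  for C :: "('o, 'm, 'x) hyper_data_scheme"
    and D :: "('p, 'n, 'y) hyper_data_scheme" +
  fixes Fo :: "'o \<Rightarrow> 'p"
    and Fm :: "'m \<Rightarrow> 'n"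
    and \<phi> :: "'o \<Rightarrow> 'o \<Rightarrow> 'n"
    and \<phi>\<^sub>I :: "'n"
  assumes F_obj: "X \<in> Obj C \<Longrightarrow> Fo X \<in> Obj D"
    and F_hom: "\<lbrakk>X \<in> Obj C; Y \<in> Obj C; f \<in> Hom C X Y\<rbrakk> \<Longrightarrow> Fm f \<in> Hom D (Fo X) (Fo Y)"
    and F_id: "X \<in> Obj C \<Longrightarrow> Fm (Id C X) = Id D (Fo X)"
    and F_comp: "\<lbrakk>X \<in> Obj C; Y \<in> Obj C; Z \<in> Obj C; f \<in> Hom C X Y; g \<in> Hom C Y Z\<rbrakk>
      \<Longrightarrow> Fm (g \<cdot>\<^bsub>C\<^esub> f) = Fm g \<cdot>\<^bsub>D\<^esub> Fm f"
    and phi_iso: "\<lbrakk>X \<in> Obj C; Y \<in> Obj C\<rbrakk>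
      \<Longrightarrow> iso_arrow D (Fo X \<odot>\<^bsub>D\<^esub> Fo Y) (Fo (X \<odot>\<^bsub>C\<^esub> Y)) (\<phi> X Y)"
    and phiI_iso: "iso_arrow D (UnitO D) (Fo (UnitO C)) \<phi>\<^sub>I"
    and phi_nat: "\<lbrakk>X \<in> Obj C; Y \<in> Obj C; X' \<in> Obj C; Y' \<in> Obj C; f \<in> Hom C X X'; g \<in> Hom C Y Y'\<rbrakk>
      \<Longrightarrow> \<phi> X' Y' \<cdot>\<^bsub>D\<^esub> (Fm f \<otimes>\<^bsub>D\<^esub> Fm g) = Fm (f \<otimes>\<^bsub>C\<^esub> g) \<cdot>\<^bsub>D\<^esub> \<phi> X Y"
    and phi_assoc: "\<lbrakk>X \<in> Obj C; Y \<in> Obj C; Z \<in> Obj C\<rbrakk>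
      \<Longrightarrow> Fm (Assoc C X Y Z) \<cdot>\<^bsub>D\<^esub> \<phi> (X \<odot>\<^bsub>C\<^esub> Y) Z \<cdot>\<^bsub>D\<^esub> (\<phi> X Y \<otimes>\<^bsub>D\<^esub> Id D (Fo Z))
          = \<phi> X (Y \<odot>\<^bsub>C\<^esub> Z) \<cdot>\<^bsub>D\<^esub> (Id D (Fo X) \<otimes>\<^bsub>D\<^esub> \<phi> Y Z) \<cdot>\<^bsub>D\<^esub> Assoc D (Fo X) (Fo Y) (Fo Z)"
    and phi_lunit: "X \<in> Obj C
      \<Longrightarrow> Fm (LUnit C X) \<cdot>\<^bsub>D\<^esub> \<phi> (UnitO C) X \<cdot>\<^bsub>D\<^esub> (\<phi>\<^sub>I \<otimes>\<^bsub>D\<^esub> Id D (Fo X)) = LUnit D (Fo X)"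
    and phi_runit: "X \<in> Obj C
      \<Longrightarrow> Fm (RUnit C X) \<cdot>\<^bsub>D\<^esub> \<phi> X (UnitO C) \<cdot>\<^bsub>D\<^esub> (Id D (Fo X) \<otimes>\<^bsub>D\<^esub> \<phi>\<^sub>I) = RUnit D (Fo X)"
    and phi_symm: "\<lbrakk>X \<in> Obj C; Y \<in> Obj C\<rbrakk>
      \<Longrightarrow> Fm (Symm C X Y) \<cdot>\<^bsub>D\<^esub> \<phi> X Y = \<phi> Y X \<cdot>\<^bsub>D\<^esub> Symm D (Fo X) (Fo Y)"
    and F_mu: "X \<in> Obj C \<Longrightarrow> Mu D (Fo X) = Fm (Mu C X) \<cdot>\<^bsub>D\<^esub> \<phi> X X"
    and F_eta: "X \<in> Obj C \<Longrightarrow> Eta D (Fo X) = Fm (Eta C X) \<cdot>\<^bsub>D\<^esub> \<phi>\<^sub>I"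
    and F_delta: "X \<in> Obj C \<Longrightarrow> Delta D (Fo X)
      = inv_arrow D (Fo X \<odot>\<^bsub>D\<^esub> Fo X) (Fo (X \<odot>\<^bsub>C\<^esub> X)) (\<phi> X X) \<cdot>\<^bsub>D\<^esub> Fm (Delta C X)"
    and F_eps: "X \<in> Obj C \<Longrightarrow> Eps D (Fo X)
      = inv_arrow D (UnitO D) (Fo (UnitO C)) \<phi>\<^sub>I \<cdot>\<^bsub>D\<^esub> Fm (Eps C X)"


section \<open>Finite sets\<close>

text \<open>
  The finite sets that serve as objects, node sets and edge sets are the finite subsets of
  a universe that contains the elements of an arbitrary type and is closed under
  pairing with the two tags of a disjoint union and under forming finite sets of elements; so
  disjoint unions and quotients of finite sets are again finite sets of the same kind, and sets
  of every finite cardinality occur whatever the type of atoms.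
\<close>

datatype 'a elt = Atom 'a | InL "'a elt" | InR "'a elt" | Coll "'a elt fset"

definition dsum :: "'a elt set \<Rightarrow> 'a elt set \<Rightarrow> 'a elt set"  (infixr "\<uplus>" 65) where
  "X \<uplus> Y = InL ` X \<union> InR ` Y"

definition copair :: "('a elt \<Rightarrow> 'b) \<Rightarrow> ('a elt \<Rightarrow> 'b) \<Rightarrow> 'a elt \<Rightarrow> 'b" where
  "copair f g z = (case z of InL x \<Rightarrow> f x | InR y \<Rightarrow> g y | _ \<Rightarrow> undefined)"

text \<open>\<open>fold_map\<close> is the codiagonal \<open>[1,1]\<close>; on \<open>{} \<uplus> X\<close> and \<open>X \<uplus> {}\<close> it is the canonical
  bijection to \<open>X\<close>.\<close>

definition fold_map :: "'a elt \<Rightarrow> 'a elt" where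
  "fold_map = copair id id"

definition swap_map :: "'a elt \<Rightarrow> 'a elt" where
  "swap_map = copair InR InL"

definition assoc_map :: "'a elt \<Rightarrow> 'a elt" where
  "assoc_map = copair (copair InL (InR \<circ> InL)) (InR \<circ> InR)"

text \<open>The canonical map from \<open>N \<uplus> M\<close> to the pushout of \<open>N \<leftarrow> Y \<rightarrow> M\<close> along \<open>f\<close> and \<open>g\<close>, which
  is the set of classes of the equivalence relation generated by \<open>InL (f y) \<sim> InR (g y)\<close>.\<close>

definition pushout_map ::
  "'a elt set \<Rightarrow> ('a elt \<Rightarrow> 'a elt) \<Rightarrow> ('a elt \<Rightarrow> 'a elt) \<Rightarrow> 'a elt \<Rightarrow> 'a elt" where
  "pushout_map Y f g z =
     (let R = {(InL (f y), InR (g y)) | y. y \<in> Y} in Coll (Abs_fset ((R \<union> R\<inverse>)\<^sup>* `` {z})))"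


section \<open>Open circuits\<close>

text \<open>Division by an element of \<open>P\<close> must make sense, so \<open>0 \<notin> P\<close> is part of closure under
  division; it has to be said because \<open>x / 0 = 0\<close> in HOL.\<close>

definition positive_elements :: "'f::field set \<Rightarrow> bool" where
  "positive_elements P \<longleftrightarrow>
     (\<forall>c. c \<noteq> 0 \<longrightarrow> c\<^sup>2 \<in> P) \<and> 0 \<notin> P \<and>
     (\<forall>a\<in>P. \<forall>b\<in>P. a + b \<in> P \<and> a * b \<in> P \<and> a / b \<in> P)"

record ('a, 'f) circuit =
  inputs :: "'a elt set"
  outputs :: "'a elt set"
  nodes :: "'a elt set"
  edges :: "'a elt set"
  src :: "'a elt \<Rightarrow> 'a elt"
  tgt :: "'a elt \<Rightarrow> 'a elt"
  res :: "'a elt \<Rightarrow> 'f"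
  inp :: "'a elt \<Rightarrow> 'a elt"
  outp :: "'a elt \<Rightarrow> 'a elt"

definition open_circuit ::
  "'f::field set \<Rightarrow> 'a elt set \<Rightarrow> 'a elt set \<Rightarrow> ('a, 'f) circuit \<Rightarrow> bool" where
  "open_circuit P X Y c \<longleftrightarrow>
     finite X \<and> finite Y \<and> finite (nodes c) \<and> finite (edges c) \<and>
     inputs c = X \<and> outputs c = Y \<and>
     src c \<in> edges c \<rightarrow> nodes c \<and> tgt c \<in> edges c \<rightarrow> nodes c \<and> res c \<in> edges c \<rightarrow> P \<and>
     inp c \<in> X \<rightarrow> nodes c \<and> outp c \<in> Y \<rightarrow> nodes c"

definition terminals :: "('a, 'f) circuit \<Rightarrow> 'a elt set" where
  "terminals c = inp c ` inputs c \<union> outp c ` outputs c"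

text \<open>The bijection \<open>f\<close> of the apices commutes with the legs and carries one decoration to the
  other; as usual, edge sets of decorations are taken up to bijection (\<open>g\<close>), since otherwise
  composition by disjoint union of edge sets would not be associative or unital.\<close>

definition circuit_rel :: "'f::field set \<Rightarrow> ('a, 'f) circuit rel" where
  "circuit_rel P = {(c, d). \<exists>X Y f g. open_circuit P X Y c \<and> open_circuit P X Y d \<and>
     bij_betw f (nodes c) (nodes d) \<and> bij_betw g (edges c) (edges d) \<and>
     (\<forall>e\<in>edges c. src d (g e) = f (src c e) \<and> tgt d (g e) = f (tgt c e) \<and> res d (g e) = res c e) \<and>
     (\<forall>x\<in>X. inp d x = f (inp c x)) \<and> (\<forall>y\<in>Y. outp d y = f (outp c y))}"

abbreviation circuit_class :: "'f::field set \<Rightarrow> ('a, 'f) circuit \<Rightarrow> ('a, 'f) circuit set" where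
  "circuit_class P c \<equiv> circuit_rel P `` {c}"

definition comp_circuit ::
  "('a, 'f) circuit \<Rightarrow> ('a, 'f) circuit \<Rightarrow> ('a, 'f) circuit" where
  "comp_circuit d c =
     (let q = pushout_map (outputs c) (outp c) (inp d) in
      \<lparr>inputs = inputs c, outputs = outputs d,
       nodes = q ` (nodes c \<uplus> nodes d),
       edges = edges c \<uplus> edges d,
       src = copair (q \<circ> InL \<circ> src c) (q \<circ> InR \<circ> src d),
       tgt = copair (q \<circ> InL \<circ> tgt c) (q \<circ> InR \<circ> tgt d),
       res = copair (res c) (res d),
       inp = q \<circ> InL \<circ> inp c,
       outp = q \<circ> InR \<circ> outp d\<rparr>)"

definition tens_circuit ::
  "('a, 'f) circuit \<Rightarrow> ('a, 'f) circuit \<Rightarrow> ('a, 'f) circuit" where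
  "tens_circuit c d =
     \<lparr>inputs = inputs c \<uplus> inputs d, outputs = outputs c \<uplus> outputs d,
      nodes = nodes c \<uplus> nodes d,
      edges = edges c \<uplus> edges d,
      src = copair (InL \<circ> src c) (InR \<circ> src d),
      tgt = copair (InL \<circ> tgt c) (InR \<circ> tgt d),
      res = copair (res c) (res d),
      inp = copair (InL \<circ> inp c) (InR \<circ> inp d),
      outp = copair (InL \<circ> outp c) (InR \<circ> outp d)\<rparr>"

text \<open>The cospan \<open>X \<rightarrow> N \<leftarrow> Y\<close> with legs \<open>f\<close>, \<open>g\<close>, decorated with no edges.\<close>

definition cospan ::
  "'a elt set \<Rightarrow> 'a elt set \<Rightarrow> 'a elt set \<Rightarrow> ('a elt \<Rightarrow> 'a elt) \<Rightarrow> ('a elt \<Rightarrow> 'a elt)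
    \<Rightarrow> ('a, 'f) circuit" where
  "cospan X N Y f g =
     \<lparr>inputs = X, outputs = Y, nodes = N, edges = {},
      src = (\<lambda>_. undefined), tgt = (\<lambda>_. undefined), res = (\<lambda>_. undefined), inp = f, outp = g\<rparr>"

definition Circ :: "'f::field set \<Rightarrow> ('a elt set, ('a, 'f) circuit set) hyper_data" where
  "Circ P =
     \<lparr>Obj = {X. finite X},
      Hom = (\<lambda>X Y. {c. open_circuit P X Y c} // circuit_rel P),
      Id = (\<lambda>X. circuit_class P (cospan X X X id id)),
      Comp = (\<lambda>B A. \<Union>d\<in>B. \<Union>c\<in>A. circuit_class P (comp_circuit d c)),
      TensO = (\<uplus>),
      TensM = (\<lambda>A B. \<Union>c\<in>A. \<Union>d\<in>B. circuit_class P (tens_circuit c d)),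
      UnitO = {},
      Assoc = (\<lambda>X Y Z. circuit_class P
        (cospan ((X \<uplus> Y) \<uplus> Z) (X \<uplus> (Y \<uplus> Z)) (X \<uplus> (Y \<uplus> Z)) assoc_map id)),
      LUnit = (\<lambda>X. circuit_class P (cospan ({} \<uplus> X) X X fold_map id)),
      RUnit = (\<lambda>X. circuit_class P (cospan (X \<uplus> {}) X X fold_map id)),
      Symm = (\<lambda>X Y. circuit_class P (cospan (X \<uplus> Y) (Y \<uplus> X) (Y \<uplus> X) swap_map id)),
      Mu = (\<lambda>X. circuit_class P (cospan (X \<uplus> X) X X fold_map id)),
      Eta = (\<lambda>X. circuit_class P (cospan {} X X id id)),
      Delta = (\<lambda>X. circuit_class P (cospan X X (X \<uplus> X) id fold_map)),
      Eps = (\<lambda>X. circuit_class P (cospan X X {} id id))\<rparr>"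


section \<open>Lagrangian relations\<close>

text \<open>\<open>\<bbbF>\<^sup>X\<close> consists of the functions that vanish off \<open>X\<close>, and its dual is identified with \<open>\<bbbF>\<^sup>X\<close> by
  the dual basis.  A potential-current pair is an element of \<open>\<bbbF>\<^sup>X \<oplus> (\<bbbF>\<^sup>X)\<^sup>*\<close>.\<close>

type_synonym ('a, 'f) vec = "'a elt \<Rightarrow> 'f"
type_synonym ('a, 'f) pc = "('a, 'f) vec \<times> ('a, 'f) vec"

definition vecs :: "'a elt set \<Rightarrow> ('a, 'f::field) vec set" where
  "vecs X = {\<psi>. \<forall>x. x \<notin> X \<longrightarrow> \<psi> x = 0}"

definition pcs :: "'a elt set \<Rightarrow> ('a, 'f::field) pc set" where
  "pcs X = vecs X \<times> vecs X"

definition symp_form :: "'a elt set \<Rightarrow> ('a, 'f::field) pc \<Rightarrow> ('a, 'f) pc \<Rightarrow> 'f" where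
  "symp_form X u v = (\<Sum>x\<in>X. snd v x * fst u x) - (\<Sum>x\<in>X. snd u x * fst v x)"

definition rel_form ::
  "'a elt set \<Rightarrow> 'a elt set \<Rightarrow> ('a, 'f::field) pc \<times> ('a, 'f) pc \<Rightarrow> ('a, 'f) pc \<times> ('a, 'f) pc \<Rightarrow> 'f"
  where
  "rel_form X Y w w' = - symp_form X (fst w) (fst w') + symp_form Y (snd w) (snd w')"

definition pc_scale :: "'f::field \<Rightarrow> ('a, 'f) pc \<times> ('a, 'f) pc \<Rightarrow> ('a, 'f) pc \<times> ('a, 'f) pc" where
  "pc_scale c = (\<lambda>((\<psi>, \<iota>), (\<psi>', \<iota>')).
     ((\<lambda>x. c * \<psi> x, \<lambda>x. c * \<iota> x), (\<lambda>x. c * \<psi>' x, \<lambda>x. c * \<iota>' x)))"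

interpretation pc: vector_space pc_scale
  by unfold_locales (auto simp: pc_scale_def algebra_simps fun_eq_iff)

definition isotropic :: "'a elt set \<Rightarrow> 'a elt set \<Rightarrow> ('a, 'f::field) pc rel \<Rightarrow> bool" where
  "isotropic X Y L \<longleftrightarrow>
     L \<subseteq> pcs X \<times> pcs Y \<and> pc.subspace L \<and> (\<forall>w\<in>L. \<forall>w'\<in>L. rel_form X Y w w' = 0)"

definition lagrangian :: "'a elt set \<Rightarrow> 'a elt set \<Rightarrow> ('a, 'f::field) pc rel \<Rightarrow> bool" where
  "lagrangian X Y L \<longleftrightarrow> isotropic X Y L \<and> (\<forall>L'. isotropic X Y L' \<and> L \<subseteq> L' \<longrightarrow> L' = L)"

definition vsum :: "('a, 'f::field) vec \<Rightarrow> ('a, 'f) vec \<Rightarrow> ('a, 'f) vec" where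
  "vsum \<psi> \<psi>' z = (case z of InL x \<Rightarrow> \<psi> x | InR y \<Rightarrow> \<psi>' y | _ \<Rightarrow> 0)"

definition pcsum :: "('a, 'f::field) pc \<Rightarrow> ('a, 'f) pc \<Rightarrow> ('a, 'f) pc" where
  "pcsum u v = (vsum (fst u) (fst v), vsum (snd u) (snd v))"

definition tens_rel :: "('a, 'f::field) pc rel \<Rightarrow> ('a, 'f) pc rel \<Rightarrow> ('a, 'f) pc rel" where
  "tens_rel R S = {(pcsum u u', pcsum v v') | u v u' v'. (u, v) \<in> R \<and> (u', v') \<in> S}"

text \<open>The symplectic isomorphism from the space on \<open>X\<close> to the space on \<open>Y\<close> induced by a bijection
  \<open>f\<close> from \<open>X\<close> to \<open>Y\<close>, as a relation.\<close>

definition pull :: "'a elt set \<Rightarrow> ('a elt \<Rightarrow> 'a elt) \<Rightarrow> ('a, 'f::field) vec \<Rightarrow> ('a, 'f) vec" where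
  "pull X f \<psi> x = (if x \<in> X then \<psi> (f x) else 0)"

definition bij_rel ::
  "'a elt set \<Rightarrow> 'a elt set \<Rightarrow> ('a elt \<Rightarrow> 'a elt) \<Rightarrow> ('a, 'f::field) pc rel" where
  "bij_rel X Y f = {((pull X f \<psi>, pull X f \<iota>), (\<psi>, \<iota>)) | \<psi> \<iota>. \<psi> \<in> vecs Y \<and> \<iota> \<in> vecs Y}"

definition lag_mu :: "'a elt set \<Rightarrow> ('a, 'f::field) pc rel" where
  "lag_mu X = {((vsum \<psi> \<psi>, vsum \<iota>\<^sub>1 \<iota>\<^sub>2), (\<psi>, \<iota>\<^sub>1 + \<iota>\<^sub>2)) | \<psi> \<iota>\<^sub>1 \<iota>\<^sub>2.
     \<psi> \<in> vecs X \<and> \<iota>\<^sub>1 \<in> vecs X \<and> \<iota>\<^sub>2 \<in> vecs X}"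

definition lag_eta :: "'a elt set \<Rightarrow> ('a, 'f::field) pc rel" where
  "lag_eta X = {((0, 0), (\<psi>, 0)) | \<psi>. \<psi> \<in> vecs X}"

definition LagRel :: "('a elt set, ('a, 'f::field) pc rel) hyper_data" where
  "LagRel =
     \<lparr>Obj = {X. finite X},
      Hom = (\<lambda>X Y. {L. lagrangian X Y L}),
      Id = (\<lambda>X. Id_on (pcs X)),
      Comp = (\<lambda>S R. R O S),
      TensO = (\<uplus>),
      TensM = tens_rel,
      UnitO = {},
      Assoc = (\<lambda>X Y Z. bij_rel ((X \<uplus> Y) \<uplus> Z) (X \<uplus> (Y \<uplus> Z)) assoc_map),
      LUnit = (\<lambda>X. bij_rel ({} \<uplus> X) X fold_map),
      RUnit = (\<lambda>X. bij_rel (X \<uplus> {}) X fold_map),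
      Symm = (\<lambda>X Y. bij_rel (X \<uplus> Y) (Y \<uplus> X) swap_map),
      Mu = lag_mu,
      Eta = lag_eta,
      Delta = (\<lambda>X. (lag_mu X)\<inverse>),
      Eps = (\<lambda>X. (lag_eta X)\<inverse>)\<rparr>"


section \<open>The power functional and the behavior of a circuit\<close>

text \<open>The formal partial derivative of a polynomial function \<open>G\<close> with respect to the coordinate at
  \<open>n\<close>: with the other coordinates of \<open>\<phi>\<close> fixed, \<open>G\<close> is given by a polynomial in the \<open>n\<close>-th one,
  which is unique because a field with positive elements is infinite.\<close>

definition formal_partial :: "(('a, 'f::field) vec \<Rightarrow> 'f) \<Rightarrow> 'a elt \<Rightarrow> ('a, 'f) vec \<Rightarrow> 'f" where
  "formal_partial G n \<phi> = poly (pderiv (THE p. \<forall>t. poly p t = G (\<phi>(n := t)))) (\<phi> n)"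

definition ext_power :: "('a, 'f::field) circuit \<Rightarrow> ('a, 'f) vec \<Rightarrow> 'f" where
  "ext_power c \<phi> = 1 / 2 * (\<Sum>e\<in>edges c. 1 / res c e * (\<phi> (tgt c e) - \<phi> (src c e))\<^sup>2)"

definition min_power_ext ::
  "('a, 'f::field) circuit \<Rightarrow> ('a, 'f) vec \<Rightarrow> ('a, 'f) vec \<Rightarrow> bool" where
  "min_power_ext c \<psi> \<phi> \<longleftrightarrow>
     \<phi> \<in> vecs (nodes c) \<and> (\<forall>n\<in>terminals c. \<phi> n = \<psi> n) \<and>
     (\<forall>n\<in>nodes c - terminals c. formal_partial (ext_power c) n \<phi> = 0)"

definition power_functional :: "('a, 'f::field) circuit \<Rightarrow> ('a, 'f) vec \<Rightarrow> 'f" where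
  "power_functional c \<psi> = (THE q. \<exists>\<phi>. min_power_ext c \<psi> \<phi> \<and> q = ext_power c \<phi>)"

definition graph_d :: "'a elt set \<Rightarrow> (('a, 'f::field) vec \<Rightarrow> 'f) \<Rightarrow> ('a, 'f) pc set" where
  "graph_d S Q = {(\<psi>, \<lambda>n. if n \<in> S then formal_partial Q n \<psi> else 0) | \<psi>. \<psi> \<in> vecs S}"

text \<open>The images \<open>S f v\<close> and \<open>S\<^sup>t f v\<close> of \<open>v\<close> under the (twisted) symplectification of a function
  \<open>f\<close> from \<open>A\<close> to \<open>B\<close>.\<close>

definition symplectify ::
  "'a elt set \<Rightarrow> 'a elt set \<Rightarrow> ('a elt \<Rightarrow> 'a elt) \<Rightarrow> ('a, 'f::field) pc \<Rightarrow> ('a, 'f) pc set" where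
  "symplectify A B f = (\<lambda>(\<psi>, \<iota>). {(\<psi>', \<iota>'). \<psi>' \<in> vecs A \<and> \<iota>' \<in> vecs A \<and>
     (\<forall>a\<in>A. \<psi>' a = \<psi> (f a)) \<and> (\<forall>b\<in>B. (\<Sum>a | a \<in> A \<and> f a = b. \<iota>' a) = \<iota> b)})"

definition twisted_symplectify ::
  "'a elt set \<Rightarrow> 'a elt set \<Rightarrow> ('a elt \<Rightarrow> 'a elt) \<Rightarrow> ('a, 'f::field) pc \<Rightarrow> ('a, 'f) pc set" where
  "twisted_symplectify A B f v = {(\<psi>', - \<iota>') | \<psi>' \<iota>'. (\<psi>', \<iota>') \<in> symplectify A B f v}"

text \<open>
  The union over \<open>v\<close> in the graph of \<open>dQ\<close> of \<open>S\<^sup>t i (v) \<times> S o (v)\<close>.  The inputs and the outputs are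
  attached in parallel to the terminals, so the product is formed by means of the comultiplication
  on \<open>\<partial>N\<close>: both legs see the potential of \<open>v = (\<psi>, \<iota>)\<close>, and the current \<open>\<iota>\<close> is the sum of the
  current \<open>\<iota>\<^sub>1\<close> through the inputs and the current \<open>\<iota>\<^sub>2\<close> through the outputs.  Equivalently, it is
  the image of the graph under the symplectification of \<open>[i, o]\<close>, twisted on the inputs.
  Feeding all of \<open>v\<close> to both legs instead would send the identity circuit to
  \<open>{((\<psi>, 0), (\<psi>, 0))}\<close>, which is neither Lagrangian nor the identity relation.
\<close>

definition blackbox :: "('a, 'f::field) circuit \<Rightarrow> ('a, 'f) pc rel" where
  "blackbox c =
     (\<Union>(\<psi>, \<iota>)\<in>graph_d (terminals c) (power_functional c).
        \<Union>(v\<^sub>1, v\<^sub>2)\<in>{((\<psi>, \<iota>\<^sub>1), (\<psi>, \<iota>\<^sub>2)) | \<iota>\<^sub>1 \<iota>\<^sub>2.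
            \<iota>\<^sub>1 \<in> vecs (terminals c) \<and> \<iota>\<^sub>2 \<in> vecs (terminals c) \<and> \<iota>\<^sub>1 + \<iota>\<^sub>2 = \<iota>}.
          twisted_symplectify (inputs c) (terminals c) (inp c) v\<^sub>1
            \<times> symplectify (outputs c) (terminals c) (outp c) v\<^sub>2)"

end

theory Submission
  imports Defs
begin

text \<open>
  The black box of a circuit is usually read off at its terminals: eliminate the interior potentials
  by minimizing the power, then differentiate the power that remains.  The proof replaces this by a
  description in which nothing is eliminated.  A pair of boundary states belongs to the \<open>behavior\<close> of
  a circuit iff some potential \<open>\<phi>\<close> on \<^emph>\<open>all\<close> nodes restricts to the given potentials and satisfies
  Kirchhoff's current law, stated weakly: for every test potential \<open>\<chi>\<close>, the polarized power
  \<open>energy c \<phi> \<chi>\<close> together with the currents entering and leaving, paired with \<open>\<chi>\<close>, balances out.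
  The two descriptions agree (\<open>blackbox_eq_behavior\<close>): tested at interior nodes the law says that
  \<open>\<phi>\<close> obeys the principle of minimum power, and tested at terminals it computes the differential of the
  power functional, because the power along a line of minimizers is a quadratic polynomial with linear
  coefficient \<open>energy c \<phi> \<eta>\<close>.  This is where positivity enters: the energy form vanishes on \<open>\<phi>\<close>
  only if \<open>\<phi>\<close> is constant along edges, so a Gram-Schmidt induction over the interior nodes produces
  minimizers (\<open>harmonic_extension\<close>).

  With the weak form, functoriality is linear algebra.  Gluing circuits along a pushout of node sets adds
  energies, and potentials on the pushout are pairs of potentials that agree on the shared
  boundary.  What remains is to find the currents through the shared boundary, or, for the
  Lagrangian property, a potential for a given boundary state.  Both are systems of linear
  equations, solvable because they are consistent (\<open>linear_system_solvable\<close>), and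
  consistency is in each case the hypothesis at hand: the balance on the glued circuit, or
  orthogonality to the behavior.  The same argument shows that Lagrangian relations compose.

  The hypergraph axioms are checked once for both categories.  All structure arrows of both categories are images of
  cospans of finite sets, which compose by pushout and tensor by disjoint union.  A category whose
  objects are the finite sets and that contains such a family of arrows, with natural coherence
  arrows, is a hypergraph category (locale \<open>cospan_cat\<close>), since each axiom about structure arrows becomes an
  equation between functions, or a pushout square for the Frobenius and special laws.
  For \<open>Circ\<close> the family consists of the circuits without edges, for \<open>LagRel\<close> of their
  behaviors; so the functor preserves the structure almost by definition, and its coherence arrows
  can be taken to be identities.
\<close>

section \<open>Maps between disjoint unions\<close>

lemma copair_simps [simp]: "copair f g (InL x) = f x" "copair f g (InR y) = g y"
  by (simp_all add: copair_def)

lemma in_dsum [simp]: "InL x \<in> X \<uplus> Y \<longleftrightarrow> x \<in> X" "InR y \<in> X \<uplus> Y \<longleftrightarrow> y \<in> Y"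
  by (auto simp: dsum_def)

lemma dsumE [elim!]:
  assumes "z \<in> X \<uplus> Y"
  obtains x where "x \<in> X" "z = InL x" | y where "y \<in> Y" "z = InR y"
  using assms by (auto simp: dsum_def)

lemma ball_dsum [simp]: "(\<forall>z\<in>X \<uplus> Y. Q z) \<longleftrightarrow> (\<forall>x\<in>X. Q (InL x)) \<and> (\<forall>y\<in>Y. Q (InR y))"
  by (auto simp: dsum_def)

lemma finite_dsum [simp]: "finite X \<Longrightarrow> finite Y \<Longrightarrow> finite (X \<uplus> Y)"
  by (simp add: dsum_def)

lemma image_dsum: "h ` (X \<uplus> Y) = (h \<circ> InL) ` X \<union> (h \<circ> InR) ` Y"
  by (auto simp: dsum_def)

lemma dsum_eq_empty [simp]: "X \<uplus> Y = {} \<longleftrightarrow> X = {} \<and> Y = {}"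
  by (simp add: dsum_def)

lemma sum_dsum:
  assumes "finite X" "finite Y"
  shows "sum h (X \<uplus> Y) = (\<Sum>x\<in>X. h (InL x)) + (\<Sum>y\<in>Y. h (InR y))"
  unfolding dsum_def using assms
  by (subst sum.union_disjoint) (auto simp: sum.reindex inj_on_def)

abbreviation dmap :: "('a elt \<Rightarrow> 'a elt) \<Rightarrow> ('a elt \<Rightarrow> 'a elt) \<Rightarrow> 'a elt \<Rightarrow> 'a elt" where
  "dmap f g \<equiv> copair (InL \<circ> f) (InR \<circ> g)"

lemma bij_betw_dmap:
  assumes "bij_betw f A B" "bij_betw g C D"
  shows "bij_betw (dmap f g) (A \<uplus> C) (B \<uplus> D)"
proof (rule bij_betw_imageI)
  show "inj_on (dmap f g) (A \<uplus> C)"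
    using assms by (simp add: inj_on_def bij_betw_def)
  show "dmap f g ` (A \<uplus> C) = B \<uplus> D"
    using assms[THEN bij_betw_imp_surj_on, symmetric] by (simp add: dsum_def image_Un image_image)
qed

text \<open>The inverse of \<open>assoc_map\<close>.\<close>

definition unassoc_map :: "'a elt \<Rightarrow> 'a elt" where
  "unassoc_map = copair (InL \<circ> InL) (copair (InL \<circ> InR) InR)"

lemma fold_map_simps [simp]: "fold_map (InL x) = x" "fold_map (InR x) = x"
  by (simp_all add: fold_map_def)

lemma fold_map_image: "fold_map ` (X \<uplus> Y) = X \<union> Y"
  by (simp add: image_dsum o_def)

lemma swap_map_simps [simp]: "swap_map (InL x) = InR x" "swap_map (InR x) = InL x"
  by (simp_all add: swap_map_def)

lemma assoc_map_simps [simp]: "assoc_map (InL (InL x)) = InL x"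
  "assoc_map (InL (InR x)) = InR (InL x)" "assoc_map (InR x) = InR (InR x)"
  by (simp_all add: assoc_map_def)

lemma unassoc_map_simps [simp]: "unassoc_map (InL x) = InL (InL x)"
  "unassoc_map (InR (InL x)) = InL (InR x)" "unassoc_map (InR (InR x)) = InR x"
  by (simp_all add: unassoc_map_def)

text \<open>The exchange of the middle summands, which is its own inverse.\<close>

definition mid_map :: "'a elt \<Rightarrow> 'a elt" where
  "mid_map = copair (dmap InL InL) (dmap InR InR)"

lemma mid_map_simps [simp]:
  "mid_map (InL (InL x)) = InL (InL x)" "mid_map (InL (InR x)) = InR (InL x)"
  "mid_map (InR (InL x)) = InL (InR x)" "mid_map (InR (InR x)) = InR (InR x)"
  by (simp_all add: mid_map_def)

section \<open>Pushouts of finite sets\<close>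

text \<open>
  \<open>Q\<close> with \<open>j\<close> and \<open>k\<close> is a pushout of \<open>N \<leftarrow> Y \<rightarrow> M\<close>.  The universal property
  is required only for maps to the two-element set: predicates separate the points of \<open>Q\<close>, and
  uniqueness of induced maps is the joint surjectivity of \<open>j\<close> and \<open>k\<close>.  This keeps the quantifier
  inside one type, and makes pushouts easy to verify, as no equivalence relation has to be generated.
\<close>

definition pushout ::
  "'a elt set \<Rightarrow> ('a elt \<Rightarrow> 'a elt) \<Rightarrow> ('a elt \<Rightarrow> 'a elt) \<Rightarrow> 'a elt set \<Rightarrow> 'a elt set
    \<Rightarrow> ('a elt \<Rightarrow> 'a elt) \<Rightarrow> ('a elt \<Rightarrow> 'a elt) \<Rightarrow> 'a elt set \<Rightarrow> bool" where
  "pushout Y f g N M j k Q \<longleftrightarrow>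
     f \<in> Y \<rightarrow> N \<and> g \<in> Y \<rightarrow> M \<and> Q = j ` N \<union> k ` M \<and> (\<forall>y\<in>Y. j (f y) = k (g y)) \<and>
     (\<forall>p p'. (\<forall>y\<in>Y. p (f y) \<longleftrightarrow> p' (g y)) \<longrightarrow>
        (\<exists>r. (\<forall>n\<in>N. p n \<longleftrightarrow> r (j n)) \<and> (\<forall>m\<in>M. p' m \<longleftrightarrow> r (k m))))"

lemma pushoutI:
  assumes "f \<in> Y \<rightarrow> N" "g \<in> Y \<rightarrow> M" "Q = j ` N \<union> k ` M" "\<And>y. y \<in> Y \<Longrightarrow> j (f y) = k (g y)"
    and "\<And>p p' :: 'a elt \<Rightarrow> bool. \<forall>y\<in>Y. p (f y) \<longleftrightarrow> p' (g y) \<Longrightarrow>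
      \<exists>r. (\<forall>n\<in>N. p n \<longleftrightarrow> r (j n)) \<and> (\<forall>m\<in>M. p' m \<longleftrightarrow> r (k m))"
  shows "pushout Y f g N M j k Q"
  using assms unfolding pushout_def by blast

text \<open>
  Applied to the predicate \<open>\<lambda>n. h n = t\<close>, the property for two-valued maps says that the fibre of the
  given maps over each \<open>t\<close> is a union of fibres of \<open>j\<close> and \<open>k\<close>.
\<close>

lemma pushout_universal:
  fixes h h' :: "'a elt \<Rightarrow> 't"
  assumes po: "pushout Y f g N M j k Q" and eq: "\<And>y. y \<in> Y \<Longrightarrow> h (f y) = h' (g y)"
  obtains r where "\<And>n. n \<in> N \<Longrightarrow> r (j n) = h n" "\<And>m. m \<in> M \<Longrightarrow> r (k m) = h' m"
proof -
  have "\<forall>p p'. (\<forall>y\<in>Y. p (f y) \<longleftrightarrow> p' (g y)) \<longrightarrow>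
      (\<exists>r. (\<forall>n\<in>N. p n \<longleftrightarrow> r (j n)) \<and> (\<forall>m\<in>M. p' m \<longleftrightarrow> r (k m)))"
    using po unfolding pushout_def by (elim conjE)
  note this[THEN spec, THEN spec, THEN mp]
  note test = this[of "\<lambda>n. h n = t" "\<lambda>m. h' m = t" for t]
  have fibre: "\<exists>r. (\<forall>n\<in>N. h n = t \<longleftrightarrow> r (j n)) \<and> (\<forall>m\<in>M. h' m = t \<longleftrightarrow> r (k m))" for t
    by (rule test) (simp add: eq)
  (* on Q, at least one alternative holds, and all alternatives give the same t *)
  define r where "r q = (THE t. (\<exists>n\<in>N. j n = q \<and> h n = t) \<or> (\<exists>m\<in>M. k m = q \<and> h' m = t))" for q
  have "r (j n) = h n" if "n \<in> N" for n
    unfolding r_def using fibre[of "h n"] that by (intro the_equality) metis+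
  moreover have "r (k m) = h' m" if "m \<in> M" for m
    unfolding r_def using fibre[of "h' m"] that by (intro the_equality) metis+
  ultimately show ?thesis by (rule that)
qed

lemma pushout_finite: "pushout Y f g N M j k Q \<Longrightarrow> finite N \<Longrightarrow> finite M \<Longrightarrow> finite Q"
  by (simp add: pushout_def)

lemma pushout_maps: "pushout Y f g N M j k Q \<Longrightarrow> n \<in> N \<Longrightarrow> j n \<in> Q"
  "pushout Y f g N M j k Q \<Longrightarrow> m \<in> M \<Longrightarrow> k m \<in> Q"
  "pushout Y f g N M j k Q \<Longrightarrow> y \<in> Y \<Longrightarrow> j (f y) = k (g y)"
  "pushout Y f g N M j k Q \<Longrightarrow> y \<in> Y \<Longrightarrow> f y \<in> N"
  "pushout Y f g N M j k Q \<Longrightarrow> y \<in> Y \<Longrightarrow> g y \<in> M"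
  by (auto simp: pushout_def Pi_iff)

lemma pushout_unique:
  assumes "pushout Y f g N M j k Q" "pushout Y f g N M j' k' Q'"
  obtains r where "bij_betw r Q Q'" "\<And>n. n \<in> N \<Longrightarrow> r (j n) = j' n"
    "\<And>m. m \<in> M \<Longrightarrow> r (k m) = k' m"
proof -
  obtain r where r: "\<And>n. n \<in> N \<Longrightarrow> r (j n) = j' n" "\<And>m. m \<in> M \<Longrightarrow> r (k m) = k' m"
    using pushout_universal[OF assms(1), of j' k'] pushout_maps(3)[OF assms(2)] by metis
  obtain r' where r': "\<And>n. n \<in> N \<Longrightarrow> r' (j' n) = j n" "\<And>m. m \<in> M \<Longrightarrow> r' (k' m) = k m"
    using pushout_universal[OF assms(2), of j k] pushout_maps(3)[OF assms(1)] by metis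
  have Q: "Q = j ` N \<union> k ` M" "Q' = j' ` N \<union> k' ` M"
    using assms by (auto simp: pushout_def)
  have "bij_betw r Q Q'"
    by (rule bij_betw_byWitness[where f' = r']) (auto simp: Q r r')
  then show ?thesis using r by (rule that)
qed

text \<open>
  A predicate that is compatible with the gluing is constant along the generating relation, hence on
  the classes that make up the concrete pushout.
\<close>

lemma pushout_pushout_map:
  assumes "finite Y" "f \<in> Y \<rightarrow> N" "g \<in> Y \<rightarrow> M"
  defines "q \<equiv> pushout_map Y f g"
  shows "pushout Y f g N M (q \<circ> InL) (q \<circ> InR) (q ` (N \<uplus> M))"
proof -
  define R where "R = {(InL (f y), InR (g y)) | y. y \<in> Y}"
  have fin: "finite (R \<union> R\<inverse>)"
    using assms(1) unfolding R_def by simp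
  have "(R \<union> R\<inverse>)\<^sup>* `` {z} \<subseteq> insert z (Range (R \<union> R\<inverse>))" for z
    by (auto elim: rtranclE)
  then have finc: "finite ((R \<union> R\<inverse>)\<^sup>* `` {z})" for z
    by (rule finite_subset) (use fin in \<open>simp add: finite_Range\<close>)
  have q: "q z = Coll (Abs_fset ((R \<union> R\<inverse>)\<^sup>* `` {z}))" for z
    by (simp add: q_def pushout_map_def R_def Let_def)
  have sym: "sym ((R \<union> R\<inverse>)\<^sup>*)"
    by (simp add: sym_Un_converse sym_rtrancl)
  have q_eq: "q z = q w \<longleftrightarrow> (z, w) \<in> (R \<union> R\<inverse>)\<^sup>*" for z w
  proof
    assume "q z = q w"
    then have "(R \<union> R\<inverse>)\<^sup>* `` {z} = (R \<union> R\<inverse>)\<^sup>* `` {w}"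
      using Abs_fset_inject[of "(R \<union> R\<inverse>)\<^sup>* `` {z}" "(R \<union> R\<inverse>)\<^sup>* `` {w}"] finc by (simp add: q)
    then show "(z, w) \<in> (R \<union> R\<inverse>)\<^sup>*" by blast
  next
    assume "(z, w) \<in> (R \<union> R\<inverse>)\<^sup>*"
    then have "(R \<union> R\<inverse>)\<^sup>* `` {z} = (R \<union> R\<inverse>)\<^sup>* `` {w}"
      using sym by (auto intro: rtrancl_trans dest: symD)
    then show "q z = q w" by (simp add: q)
  qed
  show ?thesis
  proof (rule pushoutI)
    fix y assume "y \<in> Y"
    then have "(InL (f y), InR (g y)) \<in> R" by (auto simp: R_def)
    then show "(q \<circ> InL) (f y) = (q \<circ> InR) (g y)" by (auto simp: q_eq)
  next
    fix p p' :: "'a elt \<Rightarrow> bool" assume pp': "\<forall>y\<in>Y. p (f y) = p' (g y)"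
    have inv: "copair p p' z = copair p p' w" if "(z, w) \<in> (R \<union> R\<inverse>)\<^sup>*" for z w
      using that by induction (use pp' in \<open>auto simp: R_def\<close>)
    have "\<exists>r. \<forall>z. copair p p' z = r (q z)"
      by (rule exI[of _ "\<lambda>u. \<exists>z. q z = u \<and> copair p p' z"]) (use inv q_eq in blast)
    then obtain r where "\<And>z. copair p p' z = r (q z)" by blast
    from this[of "InL _"] this[of "InR _"]
    show "\<exists>r. (\<forall>n\<in>N. p n = r ((q \<circ> InL) n)) \<and> (\<forall>m\<in>M. p' m = r ((q \<circ> InR) m))" by auto
  qed (use assms in \<open>auto simp: image_dsum\<close>)
qed

text \<open>Pushouts depend on \<open>N\<close> and \<open>M\<close> only up to bijection.\<close>

lemma pushout_transport:
  assumes po: "pushout Y f g N M j k Q" and b: "bij_betw b N' N" "bij_betw b' M' M"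
    and f': "f' \<in> Y \<rightarrow> N'" "g' \<in> Y \<rightarrow> M'" "\<forall>y\<in>Y. b (f' y) = f y" "\<forall>y\<in>Y. b' (g' y) = g y"
  shows "pushout Y f' g' N' M' (j \<circ> b) (k \<circ> b') Q"
proof (rule pushoutI)
  show "Q = (j \<circ> b) ` N' \<union> (k \<circ> b') ` M'"
    using po b[THEN bij_betw_imp_surj_on, symmetric] by (simp add: pushout_def image_image)
next
  fix y assume "y \<in> Y"
  then show "(j \<circ> b) (f' y) = (k \<circ> b') (g' y)" using po f' by (simp add: pushout_def)
next
  fix p p' :: "'a elt \<Rightarrow> bool" assume pp': "\<forall>y\<in>Y. p (f' y) = p' (g' y)"
  let ?c = "inv_into N' b" and ?c' = "inv_into M' b'"
  have c: "?c (b n) = n" if "n \<in> N'" for n using b that by (simp add: bij_betw_def)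
  have c': "?c' (b' m) = m" if "m \<in> M'" for m using b that by (simp add: bij_betw_def)
  have "(p \<circ> ?c) (f y) = (p' \<circ> ?c') (g y)" if "y \<in> Y" for y
    using f' pp' that c[of "f' y"] c'[of "g' y"] by (auto simp: Pi_iff)
  then obtain r where r: "\<And>n. n \<in> N \<Longrightarrow> r (j n) = (p \<circ> ?c) n" "\<And>m. m \<in> M \<Longrightarrow> r (k m) = (p' \<circ> ?c') m"
    using pushout_universal[OF po, of "p \<circ> ?c" "p' \<circ> ?c'"] by metis
  have "b n \<in> N" if "n \<in> N'" for n using b that by (auto simp: bij_betw_def)
  moreover have "b' m \<in> M" if "m \<in> M'" for m using b that by (auto simp: bij_betw_def)
  ultimately show "\<exists>r. (\<forall>n\<in>N'. p n = r ((j \<circ> b) n)) \<and> (\<forall>m\<in>M'. p' m = r ((k \<circ> b') m))"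
    by (intro exI[of _ r]) (simp add: r c c')
qed (use f' in auto)

text \<open>
  Associativity of gluing.  The set \<open>R\<close> glues \<open>N\<close>, \<open>M\<close> and \<open>L\<close> starting with the first two; since a
  predicate on it amounts to three compatible predicates, it also glues \<open>N\<close> to the pushout
  of \<open>M\<close> and \<open>L\<close>.
\<close>

lemma pushout_paste:
  assumes po1: "pushout Y f g N M j k Q" and po2: "pushout Z f' g' M L j' k' Q'"
    and po3: "pushout Z f'' g' Q L u v R" and f'': "\<forall>z\<in>Z. f'' z = k (f' z)"
    and h: "\<forall>y\<in>Y. h y = j' (g y)"
  obtains r where "\<forall>m\<in>M. r (j' m) = u (k m)" "\<forall>l\<in>L. r (k' l) = v l"
    "pushout Y f h N Q' (u \<circ> j) r R"
proof -
  have "(u \<circ> k) (f' z) = v (g' z)" if "z \<in> Z" for z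
    using pushout_maps(3)[OF po3 that] f'' that by simp
  then obtain r where r: "\<And>m. m \<in> M \<Longrightarrow> r (j' m) = u (k m)" "\<And>l. l \<in> L \<Longrightarrow> r (k' l) = v l"
    using pushout_universal[OF po2, of "u \<circ> k" v] by (metis comp_apply)
  have "pushout Y f h N Q' (u \<circ> j) r R"
  proof (rule pushoutI)
    show "f \<in> Y \<rightarrow> N" "h \<in> Y \<rightarrow> Q'"
      using pushout_maps(1,4,5)[OF po1] pushout_maps(1)[OF po2] h by auto
    have Q: "Q = j ` N \<union> k ` M" "Q' = j' ` M \<union> k' ` L" "R = u ` Q \<union> v ` L"
      using po1 po2 po3 by (simp_all add: pushout_def)
    have "r ` Q' = u ` k ` M \<union> v ` L"
      unfolding Q image_Un by (auto simp: image_image r)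
    then show "R = (u \<circ> j) ` N \<union> r ` Q'" unfolding Q by (auto simp: image_Un image_comp)
  next
    fix y assume "y \<in> Y"
    then show "(u \<circ> j) (f y) = r (h y)"
      using h r(1) pushout_maps(5)[OF po1] pushout_maps(3)[OF po1] by simp
  next
    fix p p' :: "'a elt \<Rightarrow> bool" assume pp': "\<forall>y\<in>Y. p (f y) = p' (h y)"
    have "p (f y) = (p' \<circ> j') (g y)" if "y \<in> Y" for y using pp' h that by simp
    then obtain s where s: "\<And>n. n \<in> N \<Longrightarrow> s (j n) = p n" "\<And>m. m \<in> M \<Longrightarrow> s (k m) = p' (j' m)"
      using pushout_universal[OF po1, of p "p' \<circ> j'"] by (metis comp_apply)
    have "s (f'' z) = (p' \<circ> k') (g' z)" if "z \<in> Z" for z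
      using that f'' s(2) pushout_maps(3,4)[OF po2 that] by simp
    then obtain t where t: "\<And>q. q \<in> Q \<Longrightarrow> t (u q) = s q" "\<And>l. l \<in> L \<Longrightarrow> t (v l) = p' (k' l)"
      using pushout_universal[OF po3, of s "p' \<circ> k'"] by (metis comp_apply)
    have "Q' = j' ` M \<union> k' ` L" using po2 by (simp add: pushout_def)
    then show "\<exists>r'. (\<forall>n\<in>N. p n = r' ((u \<circ> j) n)) \<and> (\<forall>m\<in>Q'. p' m = r' (r m))"
      using pushout_maps(1,2)[OF po1] by (intro exI[of _ t]) (auto simp: r s t)
  qed
  with r show ?thesis by (intro that) auto
qed

lemma pushout_dsum:
  assumes "pushout Y f g N M j k Q" "pushout Y' f' g' N' M' j' k' Q'"
  shows "pushout (Y \<uplus> Y') (dmap f f') (dmap g g') (N \<uplus> N') (M \<uplus> M') (dmap j j') (dmap k k') (Q \<uplus> Q')"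
proof (rule pushoutI)
  show "Q \<uplus> Q' = dmap j j' ` (N \<uplus> N') \<union> dmap k k' ` (M \<uplus> M')"
    using assms by (auto simp: pushout_def dsum_def image_Un image_image)
next
  fix p p' :: "'a elt \<Rightarrow> bool"
  assume pp': "\<forall>y\<in>Y \<uplus> Y'. p (dmap f f' y) = p' (dmap g g' y)"
  obtain r where r: "\<And>n. n \<in> N \<Longrightarrow> r (j n) = p (InL n)" "\<And>m. m \<in> M \<Longrightarrow> r (k m) = p' (InL m)"
    using pushout_universal[OF assms(1), of "p \<circ> InL" "p' \<circ> InL"] pp' by auto
  obtain r' where r': "\<And>n. n \<in> N' \<Longrightarrow> r' (j' n) = p (InR n)" "\<And>m. m \<in> M' \<Longrightarrow> r' (k' m) = p' (InR m)"
    using pushout_universal[OF assms(2), of "p \<circ> InR" "p' \<circ> InR"] pp' by auto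
  show "\<exists>r. (\<forall>n\<in>N \<uplus> N'. p n = r (dmap j j' n)) \<and> (\<forall>m\<in>M \<uplus> M'. p' m = r (dmap k k' m))"
    by (rule exI[of _ "copair r r'"]) (simp add: r r')
qed (use assms in \<open>auto simp: pushout_def Pi_iff\<close>)

section \<open>Categories generated by cospans\<close>

lemma (in cat) inv_arrow_eq:
  assumes XY: "X \<in> Obj C" "Y \<in> Obj C" and inv: "inverse_arrows C X Y f g"
  shows "inv_arrow C X Y f = g"
  unfolding inv_arrow_def
proof (rule the_equality)
  fix g' assume g': "inverse_arrows C X Y f g'"
  have "g' = g' \<cdot> (f \<cdot> g)" using inv g' XY by (simp add: inverse_arrows_def comp_id)
  also have "\<dots> = g' \<cdot> f \<cdot> g"
    using inv g' XY comp_assoc[of Y X Y X g f g'] by (simp add: inverse_arrows_def)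
  also have "\<dots> = g" using inv g' XY by (simp add: inverse_arrows_def id_comp)
  finally show "g' = g" .
qed (fact inv)

text \<open>
  An identity-on-objects image of the category of cospans of finite sets, \<open>csp X N Y i j\<close> being the
  image of \<open>X \<rightarrow> N \<leftarrow> Y\<close>.  The structure arrows are such images, so the laws that involve only them
  follow from the composition of cospans.  Naturality and the interchange law speak about arbitrary
  arrows and have to be supplied by each instance.
\<close>

locale cospan_cat = cat C
  for C :: "('a elt set, 'm, 'x) hyper_data_scheme" (structure) +
  fixes csp :: "'a elt set \<Rightarrow> 'a elt set \<Rightarrow> 'a elt set \<Rightarrow> ('a elt \<Rightarrow> 'a elt) \<Rightarrow> ('a elt \<Rightarrow> 'a elt) \<Rightarrow> 'm"
  assumes Obj_eq: "Obj C = {X. finite X}"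
    and TensO_eq: "TensO C = (\<uplus>)"
    and UnitO_eq: "UnitO C = {}"
    and csp_hom: "\<lbrakk>finite X; finite N; finite Y; i \<in> X \<rightarrow> N; j \<in> Y \<rightarrow> N\<rbrakk> \<Longrightarrow> csp X N Y i j \<in> Hom C X Y"
    and csp_comp: "\<lbrakk>finite X; finite N; finite Y; finite M; finite Z; i \<in> X \<rightarrow> N; l \<in> Z \<rightarrow> M;
        pushout Y j k N M p q Q\<rbrakk>
      \<Longrightarrow> csp Y M Z k l \<cdot> csp X N Y i j = csp X Q Z (p \<circ> i) (q \<circ> l)"
    and csp_tens: "\<lbrakk>finite X; finite N; finite Y; finite X'; finite N'; finite Y';
        i \<in> X \<rightarrow> N; j \<in> Y \<rightarrow> N; i' \<in> X' \<rightarrow> N'; j' \<in> Y' \<rightarrow> N'\<rbrakk>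
      \<Longrightarrow> csp X N Y i j \<otimes> csp X' N' Y' i' j' = csp (X \<uplus> X') (N \<uplus> N') (Y \<uplus> Y') (dmap i i') (dmap j j')"
    and Id_eq: "finite X \<Longrightarrow> Id C X = csp X X X id id"
    and Assoc_eq: "\<lbrakk>finite X; finite Y; finite Z\<rbrakk> \<Longrightarrow> Assoc C X Y Z =
        csp ((X \<uplus> Y) \<uplus> Z) (X \<uplus> (Y \<uplus> Z)) (X \<uplus> (Y \<uplus> Z)) assoc_map id"
    and LUnit_eq: "finite X \<Longrightarrow> LUnit C X = csp ({} \<uplus> X) X X fold_map id"
    and RUnit_eq: "finite X \<Longrightarrow> RUnit C X = csp (X \<uplus> {}) X X fold_map id"
    and Symm_eq: "\<lbrakk>finite X; finite Y\<rbrakk>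
      \<Longrightarrow> Symm C X Y = csp (X \<uplus> Y) (Y \<uplus> X) (Y \<uplus> X) swap_map id"
    and Mu_eq: "finite X \<Longrightarrow> Mu C X = csp (X \<uplus> X) X X fold_map id"
    and Eta_eq: "finite X \<Longrightarrow> Eta C X = csp {} X X id id"
    and Delta_eq: "finite X \<Longrightarrow> Delta C X = csp X X (X \<uplus> X) id fold_map"
    and Eps_eq: "finite X \<Longrightarrow> Eps C X = csp X X {} id id"
    and tens_hom': "\<lbrakk>finite X; finite Y; finite X'; finite Y'; f \<in> Hom C X Y; f' \<in> Hom C X' Y'\<rbrakk>
      \<Longrightarrow> f \<otimes> f' \<in> Hom C (X \<uplus> X') (Y \<uplus> Y')"
    and tens_comp': "\<lbrakk>finite X; finite Y; finite Z; finite X'; finite Y'; finite Z';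
        f \<in> Hom C X Y; g \<in> Hom C Y Z; f' \<in> Hom C X' Y'; g' \<in> Hom C Y' Z'\<rbrakk>
      \<Longrightarrow> (g \<cdot> f) \<otimes> (g' \<cdot> f') = (g \<otimes> g') \<cdot> (f \<otimes> f')"
    and assoc_nat': "\<lbrakk>finite X; finite Y; finite Z; finite X'; finite Y'; finite Z';
        f \<in> Hom C X X'; g \<in> Hom C Y Y'; h \<in> Hom C Z Z'\<rbrakk>
      \<Longrightarrow> Assoc C X' Y' Z' \<cdot> ((f \<otimes> g) \<otimes> h) = (f \<otimes> (g \<otimes> h)) \<cdot> Assoc C X Y Z"
    and lunit_nat': "\<lbrakk>finite X; finite Y; f \<in> Hom C X Y\<rbrakk>
      \<Longrightarrow> LUnit C Y \<cdot> (Id C {} \<otimes> f) = f \<cdot> LUnit C X"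
    and runit_nat': "\<lbrakk>finite X; finite Y; f \<in> Hom C X Y\<rbrakk>
      \<Longrightarrow> RUnit C Y \<cdot> (f \<otimes> Id C {}) = f \<cdot> RUnit C X"
    and symm_nat': "\<lbrakk>finite X; finite Y; finite X'; finite Y'; f \<in> Hom C X X'; g \<in> Hom C Y Y'\<rbrakk>
      \<Longrightarrow> Symm C X' Y' \<cdot> (f \<otimes> g) = (g \<otimes> f) \<cdot> Symm C X Y"
begin

text \<open>
  The covariant and the contravariant image of a function.  All structure arrows are of one of the two
  forms, and bijections are of both.
\<close>

definition push :: "'a elt set \<Rightarrow> 'a elt set \<Rightarrow> ('a elt \<Rightarrow> 'a elt) \<Rightarrow> 'm" where
  "push X Y f = csp X Y Y f id"

definition pull :: "'a elt set \<Rightarrow> 'a elt set \<Rightarrow> ('a elt \<Rightarrow> 'a elt) \<Rightarrow> 'm" where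
  "pull X Y g = csp X X Y id g"

text \<open>
  Isomorphic cospans have the same image, because composing with an identity may return any pushout:
  the composite with \<open>csp X X X id id\<close> can be formed with apex \<open>N'\<close> as well as \<open>N\<close>.
\<close>

lemma csp_iso:
  assumes fin: "finite X" "finite N" "finite Y" and fg: "f \<in> X \<rightarrow> N" "g \<in> Y \<rightarrow> N"
    and b: "bij_betw b N N'" and f': "\<And>x. x \<in> X \<Longrightarrow> f' x = b (f x)" and g': "\<And>y. y \<in> Y \<Longrightarrow> g' y = b (g y)"
  shows "csp X N Y f g = csp X N' Y f' g'"
proof -
  have b': "inj_on b N" "N' = b ` N" using b by (auto simp: bij_betw_def)
  have e: "\<exists>r. \<forall>n\<in>N. p n = r (b n)" for p :: "'a elt \<Rightarrow> bool"
    using b' by (intro exI[of _ "\<lambda>z. p (inv_into N b z)"]) simp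
  have fin': "finite N'" using fin b' by simp
  have maps: "f' \<in> X \<rightarrow> N'" "g' \<in> Y \<rightarrow> N'" using fg f' g' b' by auto
  have left: "pushout X id f X N f' b N'"
  proof (rule pushoutI)
    fix p p' :: "'a elt \<Rightarrow> bool" assume p: "\<forall>y\<in>X. p (id y) = p' (f y)"
    obtain r where "\<forall>n\<in>N. p' n = r (b n)" using e by blast
    then show "\<exists>r. (\<forall>n\<in>X. p n = r (f' n)) \<and> (\<forall>m\<in>N. p' m = r (b m))"
      using p f' fg by (intro exI[of _ r]) (simp add: Pi_iff)
  qed (use fg f' b' in \<open>auto simp: Pi_iff\<close>)
  have "csp X N Y f g \<cdot> csp X X X id id = csp X N' Y (f' \<circ> id) (b \<circ> g)"
    by (rule csp_comp[OF _ _ _ _ _ _ _ left]) (use fin fg in auto)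
  then have 1: "csp X N Y f g = csp X N' Y f' (b \<circ> g)"
    using comp_id[of X Y "csp X N Y f g"] csp_hom[OF fin fg] fin by (simp add: Obj_eq Id_eq)
  have right: "pushout Y (b \<circ> g) id N' Y id g' N'"
    by (rule pushoutI) (use fg g' b' maps in \<open>auto\<close>)
  have bg: "b \<circ> g \<in> Y \<rightarrow> N'" using fg b' by auto
  have "csp Y Y Y id id \<cdot> csp X N' Y f' (b \<circ> g) = csp X N' Y (id \<circ> f') (g' \<circ> id)"
    by (rule csp_comp[OF _ _ _ _ _ _ _ right]) (use fin fin' maps in auto)
  then have "csp X N' Y f' (b \<circ> g) = csp X N' Y f' g'"
    using id_comp[of X Y "csp X N' Y f' (b \<circ> g)"] csp_hom[of X N' Y f' "b \<circ> g"] fin fin' maps bg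
    by (simp add: Obj_eq Id_eq)
  with 1 show ?thesis by simp
qed

lemma csp_cong:
  assumes "finite X" "finite N" "finite Y" "f \<in> X \<rightarrow> N" "g \<in> Y \<rightarrow> N"
    "\<forall>x\<in>X. f x = f' x" "\<forall>y\<in>Y. g y = g' y"
  shows "csp X N Y f g = csp X N Y f' g'"
  by (rule csp_iso[where b = id]) (use assms in auto)

lemma push_cong:
  "\<lbrakk>finite X; finite Y; f \<in> X \<rightarrow> Y; \<forall>x\<in>X. f x = f' x\<rbrakk> \<Longrightarrow> push X Y f = push X Y f'"
  unfolding push_def by (rule csp_cong) auto

lemma pull_cong:
  "\<lbrakk>finite X; finite Y; g \<in> Y \<rightarrow> X; \<forall>y\<in>Y. g y = g' y\<rbrakk> \<Longrightarrow> pull X Y g = pull X Y g'"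
  unfolding pull_def by (rule csp_cong) auto

lemma push_eq_pull:
  assumes "finite X" "finite Y" "f \<in> X \<rightarrow> Y" "g \<in> Y \<rightarrow> X"
    "\<forall>x\<in>X. g (f x) = x" "\<forall>y\<in>Y. f (g y) = y"
  shows "push X Y f = pull X Y g"
proof -
  have "bij_betw g Y X" by (rule bij_betw_byWitness[where f' = f]) (use assms in auto)
  then show ?thesis unfolding push_def pull_def
    by (intro csp_iso[where b = g]) (use assms in auto)
qed

lemma push_hom: "\<lbrakk>finite X; finite Y; f \<in> X \<rightarrow> Y\<rbrakk> \<Longrightarrow> push X Y f \<in> Hom C X Y"
  unfolding push_def by (rule csp_hom) auto

lemma pull_hom: "\<lbrakk>finite X; finite Y; g \<in> Y \<rightarrow> X\<rbrakk> \<Longrightarrow> pull X Y g \<in> Hom C X Y"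
  unfolding pull_def by (rule csp_hom) auto

lemma push_comp:
  assumes "finite X" "finite Y" "finite Z" "f \<in> X \<rightarrow> Y" "h \<in> Y \<rightarrow> Z"
  shows "push Y Z h \<cdot> push X Y f = push X Z (h \<circ> f)"
proof -
  have "pushout Y id h Y Z h id Z"
    by (rule pushoutI) (use assms in auto)
  from csp_comp[OF _ _ _ _ _ _ _ this, of X Z f id] assms show ?thesis
    unfolding push_def by auto
qed

lemma pull_comp:
  assumes "finite X" "finite Y" "finite Z" "g \<in> Y \<rightarrow> X" "k \<in> Z \<rightarrow> Y"
  shows "pull Y Z k \<cdot> pull X Y g = pull X Z (g \<circ> k)"
proof -
  have "pushout Y g id X Y id g X"
    by (rule pushoutI) (use assms in auto)
  from csp_comp[OF _ _ _ _ _ _ _ this, of X Z id k] assms show ?thesis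
    unfolding pull_def by auto
qed

lemma pull_push:
  assumes "finite X" "finite Y" "finite Z" "f \<in> X \<rightarrow> Y" "g \<in> Z \<rightarrow> Y"
  shows "pull Y Z g \<cdot> push X Y f = csp X Y Z f g"
proof -
  have "pushout Y id id Y Y id id Y"
    by (rule pushoutI) (use assms in auto)
  from csp_comp[OF _ _ _ _ _ _ _ this, of X Z f g] assms show ?thesis
    unfolding pull_def push_def by auto
qed

lemma push_pull:
  assumes "finite X" "finite Y" "finite Z" "pushout Y g h X Z p q Q"
  shows "push Y Z h \<cdot> pull X Y g = csp X Q Z p q"
  unfolding pull_def push_def using csp_comp[OF _ _ _ _ _ _ _ assms(4), of X Z id id] assms by simp

lemma push_tens:
  assumes "finite X" "finite Y" "finite X'" "finite Y'" "f \<in> X \<rightarrow> Y" "f' \<in> X' \<rightarrow> Y'"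
  shows "push X Y f \<otimes> push X' Y' f' = push (X \<uplus> X') (Y \<uplus> Y') (dmap f f')"
  unfolding push_def using assms
  by (simp add: csp_tens, intro csp_cong) (simp_all add: Pi_iff)

lemma pull_tens:
  assumes "finite X" "finite Y" "finite X'" "finite Y'" "g \<in> Y \<rightarrow> X" "g' \<in> Y' \<rightarrow> X'"
  shows "pull X Y g \<otimes> pull X' Y' g' = pull (X \<uplus> X') (Y \<uplus> Y') (dmap g g')"
  unfolding pull_def using assms
  by (simp add: csp_tens, intro csp_cong) (simp_all add: Pi_iff)

lemma as_push:
  "finite X \<Longrightarrow> Id C X = push X X id"
  "\<lbrakk>finite X; finite Y; finite Z\<rbrakk>
    \<Longrightarrow> Assoc C X Y Z = push ((X \<uplus> Y) \<uplus> Z) (X \<uplus> (Y \<uplus> Z)) assoc_map"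
  "finite X \<Longrightarrow> LUnit C X = push ({} \<uplus> X) X fold_map"
  "finite X \<Longrightarrow> RUnit C X = push (X \<uplus> {}) X fold_map"
  "\<lbrakk>finite X; finite Y\<rbrakk> \<Longrightarrow> Symm C X Y = push (X \<uplus> Y) (Y \<uplus> X) swap_map"
  "finite X \<Longrightarrow> Mu C X = push (X \<uplus> X) X fold_map"
  "finite X \<Longrightarrow> Eta C X = push {} X id"
  by (simp_all add: push_def Id_eq Assoc_eq LUnit_eq RUnit_eq Symm_eq Mu_eq Eta_eq)

lemma as_pull:
  "finite X \<Longrightarrow> Id C X = pull X X id"
  "\<lbrakk>finite X; finite Y; finite Z\<rbrakk>
    \<Longrightarrow> Assoc C X Y Z = pull ((X \<uplus> Y) \<uplus> Z) (X \<uplus> (Y \<uplus> Z)) unassoc_map"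
  "finite X \<Longrightarrow> LUnit C X = pull ({} \<uplus> X) X InR"
  "finite X \<Longrightarrow> RUnit C X = pull (X \<uplus> {}) X InL"
  "\<lbrakk>finite X; finite Y\<rbrakk> \<Longrightarrow> Symm C X Y = pull (X \<uplus> Y) (Y \<uplus> X) swap_map"
  "finite X \<Longrightarrow> Delta C X = pull X (X \<uplus> X) fold_map"
  "finite X \<Longrightarrow> Eps C X = pull X {} id"
  by (simp_all add: Id_eq Delta_eq Eps_eq as_push)
    (simp_all add: pull_def[symmetric] push_eq_pull Pi_iff push_def[symmetric])

lemma assoc_inverse:
  assumes "finite X" "finite Y" "finite Z"
  shows "inverse_arrows C ((X \<uplus> Y) \<uplus> Z) (X \<uplus> (Y \<uplus> Z)) (Assoc C X Y Z)
    (push (X \<uplus> (Y \<uplus> Z)) ((X \<uplus> Y) \<uplus> Z) unassoc_map)"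
  using assms unfolding inverse_arrows_def
  by (simp add: as_push push_hom push_comp Pi_iff) (intro conjI push_cong; simp add: Pi_iff)

lemmas push_simps = as_push push_hom push_comp push_tens
lemmas pull_simps = as_pull pull_hom pull_comp pull_tens

text \<open>
  Each coherence law is an equation between images of functions on nested disjoint unions, which is
  checked on elements.
\<close>

lemma symmetric_monoidal: "symmetric_monoidal_cat C"
proof unfold_locales
  fix X Y Z assume "X \<in> Obj C" "Y \<in> Obj C" "Z \<in> Obj C"
  then have fin: "finite X" "finite Y" "finite Z" by (simp_all add: Obj_eq)
  show "iso_arrow C ((X \<odot> Y) \<odot> Z) (X \<odot> (Y \<odot> Z)) (Assoc C X Y Z)"
    using assoc_inverse[OF fin] by (auto simp: iso_arrow_def TensO_eq)
next
  fix X assume "X \<in> Obj C"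
  then have fin: "finite X" by (simp add: Obj_eq)
  then have "inverse_arrows C ({} \<uplus> X) X (LUnit C X) (push X ({} \<uplus> X) InR)"
    "inverse_arrows C (X \<uplus> {}) X (RUnit C X) (push X (X \<uplus> {}) InL)"
    unfolding inverse_arrows_def
    by (simp_all add: push_simps Pi_iff) (intro conjI push_cong; simp add: Pi_iff)+
  then show "iso_arrow C (UnitO C \<odot> X) X (LUnit C X)" "iso_arrow C (X \<odot> UnitO C) X (RUnit C X)"
    by (auto simp: iso_arrow_def TensO_eq UnitO_eq)
next
  fix W X Y Z assume "W \<in> Obj C" "X \<in> Obj C" "Y \<in> Obj C" "Z \<in> Obj C"
  then show "(Id C W \<otimes> Assoc C X Y Z) \<cdot> Assoc C W (X \<odot> Y) Z \<cdot> (Assoc C W X Y \<otimes> Id C Z)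
          = Assoc C W X (Y \<odot> Z) \<cdot> Assoc C (W \<odot> X) Y Z"
    by (simp add: Obj_eq TensO_eq push_simps Pi_iff) (intro push_cong; simp add: Pi_iff)
next
  fix X Y assume "X \<in> Obj C" "Y \<in> Obj C"
  then show "(Id C X \<otimes> LUnit C Y) \<cdot> Assoc C X (UnitO C) Y = RUnit C X \<otimes> Id C Y"
    by (simp add: Obj_eq TensO_eq UnitO_eq push_simps Pi_iff) (intro push_cong; simp add: Pi_iff)
next
  fix X Y Z assume "X \<in> Obj C" "Y \<in> Obj C" "Z \<in> Obj C"
  then show "Assoc C Y Z X \<cdot> Symm C X (Y \<odot> Z) \<cdot> Assoc C X Y Z
          = (Id C Y \<otimes> Symm C X Z) \<cdot> Assoc C Y X Z \<cdot> (Symm C X Y \<otimes> Id C Z)"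
    by (simp add: Obj_eq TensO_eq push_simps Pi_iff) (intro push_cong; simp add: Pi_iff)
next
  fix X Y assume "X \<in> Obj C" "Y \<in> Obj C"
  then show "Symm C Y X \<cdot> Symm C X Y = Id C (X \<odot> Y)"
    by (simp add: Obj_eq TensO_eq push_simps Pi_iff) (intro push_cong; simp add: Pi_iff)
next
  fix X Y assume "X \<in> Obj C" "Y \<in> Obj C"
  then show "Id C X \<otimes> Id C Y = Id C (X \<odot> Y)"
    by (simp add: Obj_eq TensO_eq push_simps Pi_iff) (intro push_cong; simp add: Pi_iff)
next
  fix X Y assume "X \<in> Obj C" "Y \<in> Obj C"
  then show "Symm C X Y \<in> Hom C (X \<odot> Y) (Y \<odot> X)"
    by (simp add: Obj_eq TensO_eq push_simps Pi_iff)
qed (simp_all add: Obj_eq TensO_eq UnitO_eq tens_hom' tens_comp' assoc_nat' lunit_nat' runit_nat' symm_nat')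

lemma inv_assoc:
  assumes "finite X" "finite Y" "finite Z"
  shows "inv_arrow C ((X \<uplus> Y) \<uplus> Z) (X \<uplus> (Y \<uplus> Z)) (push ((X \<uplus> Y) \<uplus> Z) (X \<uplus> (Y \<uplus> Z)) assoc_map)
    = push (X \<uplus> (Y \<uplus> Z)) ((X \<uplus> Y) \<uplus> Z) unassoc_map"
  using assms inv_arrow_eq[OF _ _ assoc_inverse[OF assms]] by (simp add: Obj_eq as_push)

lemma inv_lunit_empty:
  "inv_arrow C ({} \<uplus> {}) {} (LUnit C {}) = push {} ({} \<uplus> {}) id"
  by (intro inv_arrow_eq)
    (simp_all add: Obj_eq inverse_arrows_def push_simps Pi_iff, (intro conjI push_cong; simp add: Pi_iff)?)

lemma middle_swap_eq:
  assumes "finite X" "finite Y" "finite Z" "finite W"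
  shows "middle_swap C X Y Z W = push ((X \<uplus> Y) \<uplus> (Z \<uplus> W)) ((X \<uplus> Z) \<uplus> (Y \<uplus> W)) mid_map"
  unfolding middle_swap_def using assms
  by (simp add: TensO_eq inv_assoc push_simps Pi_iff) (intro push_cong; simp add: Pi_iff)

lemma middle_swap_pull:
  assumes "finite X" "finite Y" "finite Z" "finite W"
  shows "middle_swap C X Y Z W = pull ((X \<uplus> Y) \<uplus> (Z \<uplus> W)) ((X \<uplus> Z) \<uplus> (Y \<uplus> W)) mid_map"
  using assms by (simp add: middle_swap_eq) (intro push_eq_pull; simp add: Pi_iff)

lemma Delta_Mu:
  "finite X \<Longrightarrow> Delta C X \<cdot> Mu C X = csp (X \<uplus> X) X (X \<uplus> X) fold_map fold_map"
  by (simp add: as_push as_pull(6) pull_push Pi_iff)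

text \<open>
  Both composites on the left push forward along a map out of \<open>X \<uplus> X \<uplus> X\<close> after pulling back
  along another.  The two maps have \<open>X\<close> as their pushout, with the codiagonals as legs, so
  the composites are the cospan that represents \<open>\<delta> \<cdot> \<mu>\<close>.
\<close>

lemma frobenius:
  assumes fin: "finite X"
  shows "(Id C X \<otimes> Mu C X) \<cdot> Assoc C X X X \<cdot> (Delta C X \<otimes> Id C X) = Delta C X \<cdot> Mu C X"
    and "(Mu C X \<otimes> Id C X) \<cdot> inv_arrow C ((X \<odot> X) \<odot> X) (X \<odot> (X \<odot> X)) (Assoc C X X X)
            \<cdot> (Id C X \<otimes> Delta C X) = Delta C X \<cdot> Mu C X"
proof -
  let ?l = "dmap id fold_map \<circ> assoc_map" and ?r = "dmap fold_map id \<circ> unassoc_map"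
  have 1: "(Id C X \<otimes> Mu C X) \<cdot> Assoc C X X X = push ((X \<uplus> X) \<uplus> X) (X \<uplus> X) ?l"
    using fin by (simp add: push_simps Pi_iff)
  have 2: "Delta C X \<otimes> Id C X = pull (X \<uplus> X) ((X \<uplus> X) \<uplus> X) (dmap fold_map id)"
    using fin by (simp add: pull_simps Pi_iff)
  have 3: "(Mu C X \<otimes> Id C X) \<cdot> inv_arrow C ((X \<odot> X) \<odot> X) (X \<odot> (X \<odot> X)) (Assoc C X X X)
     = push (X \<uplus> (X \<uplus> X)) (X \<uplus> X) ?r"
    using fin by (simp add: TensO_eq inv_assoc push_simps Pi_iff)
  have 4: "Id C X \<otimes> Delta C X = pull (X \<uplus> X) (X \<uplus> (X \<uplus> X)) (dmap id fold_map)"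
    using fin by (simp add: pull_simps Pi_iff)
  have po1: "pushout ((X \<uplus> X) \<uplus> X) (dmap fold_map id) ?l (X \<uplus> X) (X \<uplus> X) fold_map fold_map X"
  proof (rule pushoutI)
    fix p p' :: "'a elt \<Rightarrow> bool"
    assume "\<forall>y\<in>(X \<uplus> X) \<uplus> X. p ((dmap fold_map id) y) = p' ((?l) y)"
    then show "\<exists>q. (\<forall>n\<in>X \<uplus> X. p n = q (fold_map n)) \<and> (\<forall>m\<in>X \<uplus> X. p' m = q (fold_map m))"
      by (intro exI[of _ "p \<circ> InL"]) auto
  qed (auto simp: Pi_iff fold_map_image)
  have po2: "pushout (X \<uplus> (X \<uplus> X)) (dmap id fold_map) ?r (X \<uplus> X) (X \<uplus> X) fold_map fold_map X"
  proof (rule pushoutI)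
    fix p p' :: "'a elt \<Rightarrow> bool"
    assume "\<forall>y\<in>X \<uplus> (X \<uplus> X). p ((dmap id fold_map) y) = p' ((?r) y)"
    then show "\<exists>q. (\<forall>n\<in>X \<uplus> X. p n = q (fold_map n)) \<and> (\<forall>m\<in>X \<uplus> X. p' m = q (fold_map m))"
      by (intro exI[of _ "p \<circ> InL"]) auto
  qed (auto simp: Pi_iff fold_map_image)
  show "(Id C X \<otimes> Mu C X) \<cdot> Assoc C X X X \<cdot> (Delta C X \<otimes> Id C X) = Delta C X \<cdot> Mu C X"
    unfolding 1 2 Delta_Mu[OF fin] by (rule push_pull) (use fin po1 in auto)
  show "(Mu C X \<otimes> Id C X) \<cdot> inv_arrow C ((X \<odot> X) \<odot> X) (X \<odot> (X \<odot> X)) (Assoc C X X X)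
            \<cdot> (Id C X \<otimes> Delta C X) = Delta C X \<cdot> Mu C X"
    unfolding 3 4 Delta_Mu[OF fin] by (rule push_pull) (use fin po2 in auto)
qed

text \<open>The codiagonal is surjective, so its pushout along itself is \<open>X\<close>.\<close>

lemma special_law:
  assumes "finite X"
  shows "Mu C X \<cdot> Delta C X = Id C X"
proof -
  have "pushout (X \<uplus> X) fold_map fold_map X X id id X"
    unfolding pushout_def by (auto simp: Pi_iff)
  from push_pull[OF _ _ _ this] assms show ?thesis
    by (simp add: as_push(6) as_pull(6) Id_eq)
qed

theorem hypergraph: "hypergraph_cat C"
proof -
  interpret symmetric_monoidal_cat C by (rule symmetric_monoidal)
  show ?thesis
  proof unfold_locales
    fix X assume "X \<in> Obj C"
    then have fin: "finite X" by (simp add: Obj_eq)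
    show "Mu C X \<in> Hom C (X \<odot> X) X" "Eta C X \<in> Hom C (UnitO C) X"
      using fin by (simp_all add: TensO_eq UnitO_eq push_simps Pi_iff)
    show "Delta C X \<in> Hom C X (X \<odot> X)" "Eps C X \<in> Hom C X (UnitO C)"
      using fin by (simp_all add: TensO_eq UnitO_eq pull_simps Pi_iff)
    show "Mu C X \<cdot> (Mu C X \<otimes> Id C X) = Mu C X \<cdot> (Id C X \<otimes> Mu C X) \<cdot> Assoc C X X X"
      "Mu C X \<cdot> (Eta C X \<otimes> Id C X) = LUnit C X" "Mu C X \<cdot> (Id C X \<otimes> Eta C X) = RUnit C X"
      "Mu C X \<cdot> Symm C X X = Mu C X"
      using fin by (simp_all add: push_simps Pi_iff) (intro push_cong; simp add: Pi_iff)+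
    show "Assoc C X X X \<cdot> (Delta C X \<otimes> Id C X) \<cdot> Delta C X = (Id C X \<otimes> Delta C X) \<cdot> Delta C X"
      "LUnit C X \<cdot> (Eps C X \<otimes> Id C X) \<cdot> Delta C X = Id C X"
      "RUnit C X \<cdot> (Id C X \<otimes> Eps C X) \<cdot> Delta C X = Id C X"
      "Symm C X X \<cdot> Delta C X = Delta C X"
      using fin by (simp_all add: pull_simps Pi_iff) (intro pull_cong; simp add: Pi_iff)+
    show "(Id C X \<otimes> Mu C X) \<cdot> Assoc C X X X \<cdot> (Delta C X \<otimes> Id C X) = Delta C X \<cdot> Mu C X"
      "(Mu C X \<otimes> Id C X) \<cdot> inv_arrow C ((X \<odot> X) \<odot> X) (X \<odot> (X \<odot> X)) (Assoc C X X X)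
            \<cdot> (Id C X \<otimes> Delta C X) = Delta C X \<cdot> Mu C X" "Mu C X \<cdot> Delta C X = Id C X"
      using fin by (rule frobenius special_law)+
  next
    fix X Y assume "X \<in> Obj C" "Y \<in> Obj C"
    then have fin: "finite X" "finite Y" by (simp_all add: Obj_eq)
    show "Mu C (X \<odot> Y) = (Mu C X \<otimes> Mu C Y) \<cdot> middle_swap C X Y X Y"
      "Eta C (X \<odot> Y) = (Eta C X \<otimes> Eta C Y)
            \<cdot> inv_arrow C (UnitO C \<odot> UnitO C) (UnitO C) (LUnit C (UnitO C))"
      using fin
      by (simp_all only: TensO_eq UnitO_eq middle_swap_eq inv_lunit_empty)
        (simp_all add: push_simps Pi_iff, (intro push_cong; simp add: Pi_iff)+)
    show "Delta C (X \<odot> Y) = middle_swap C X X Y Y \<cdot> (Delta C X \<otimes> Delta C Y)"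
      "Eps C (X \<odot> Y) = LUnit C (UnitO C) \<cdot> (Eps C X \<otimes> Eps C Y)"
      using fin
      by (simp_all only: TensO_eq UnitO_eq middle_swap_pull)
        (simp_all add: pull_simps Pi_iff, (intro pull_cong; simp add: Pi_iff)+)
  next
    show "Mu C (UnitO C) = LUnit C (UnitO C)" "Eta C (UnitO C) = Id C (UnitO C)"
      by (simp_all add: UnitO_eq push_simps)
    show "Eps C (UnitO C) = Id C (UnitO C)"
      by (simp add: UnitO_eq pull_simps)
    have "Delta C {} = push {} ({} \<uplus> {}) id"
      by (simp add: pull_simps) (intro push_eq_pull[symmetric]; simp add: Pi_iff)
    then show "Delta C (UnitO C) = inv_arrow C (UnitO C \<odot> UnitO C) (UnitO C) (LUnit C (UnitO C))"
      using inv_lunit_empty by (simp add: TensO_eq UnitO_eq)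
  qed
qed

end

section \<open>Composites of open circuits\<close>

definition edge_hom ::
  "('a elt \<Rightarrow> 'a elt) \<Rightarrow> ('a elt \<Rightarrow> 'a elt) \<Rightarrow> ('a, 'f) circuit \<Rightarrow> ('a, 'f) circuit \<Rightarrow> bool" where
  "edge_hom f g c d \<longleftrightarrow>
     (\<forall>e\<in>edges c. src d (g e) = f (src c e) \<and> tgt d (g e) = f (tgt c e) \<and> res d (g e) = res c e)"

text \<open>
  \<open>e\<close> is a composite of \<open>c\<close> followed by \<open>d\<close>, with node maps \<open>j\<close>, \<open>k\<close> and edge bijection \<open>l\<close>.  Working
  with any pushout, rather than the one that \<open>comp_circuit\<close> chooses, makes composition a relation that
  is insensitive to isomorphism and can be verified in each case with the most convenient apex.
\<close>

definition composite_via where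
  "composite_via j k l c d e \<longleftrightarrow>
     pushout (outputs c) (outp c) (inp d) (nodes c) (nodes d) j k (nodes e) \<and>
     bij_betw l (edges c \<uplus> edges d) (edges e) \<and>
     edge_hom j (l \<circ> InL) c e \<and> edge_hom k (l \<circ> InR) d e \<and>
     inputs e = inputs c \<and> outputs e = outputs d \<and>
     (\<forall>x\<in>inputs c. inp e x = j (inp c x)) \<and> (\<forall>z\<in>outputs d. outp e z = k (outp d z))"

definition composite :: "('a, 'f) circuit \<Rightarrow> ('a, 'f) circuit \<Rightarrow> ('a, 'f) circuit \<Rightarrow> bool" where
  "composite c d e \<longleftrightarrow> (\<exists>j k l. composite_via j k l c d e)"

lemma compositeI:
  assumes "pushout (outputs c) (outp c) (inp d) (nodes c) (nodes d) j k (nodes e)"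
    "bij_betw l (edges c \<uplus> edges d) (edges e)"
    "edge_hom j (l \<circ> InL) c e" "edge_hom k (l \<circ> InR) d e"
    "\<forall>x\<in>inputs c. inp e x = j (inp c x)" "\<forall>z\<in>outputs d. outp e z = k (outp d z)"
    "inputs e = inputs c" "outputs e = outputs d"
  shows "composite c d e"
  using assms unfolding composite_def composite_via_def by blast

lemma compositeE:
  assumes "composite c d e"
  obtains j k l where "composite_via j k l c d e"
  using assms unfolding composite_def by blast

lemma composite_viaD:
  assumes "composite_via j k l c d e"
  shows "pushout (outputs c) (outp c) (inp d) (nodes c) (nodes d) j k (nodes e)"
    "bij_betw l (edges c \<uplus> edges d) (edges e)"
    "edge_hom j (l \<circ> InL) c e" "edge_hom k (l \<circ> InR) d e"
    "\<forall>x\<in>inputs c. inp e x = j (inp c x)" "\<forall>z\<in>outputs d. outp e z = k (outp d z)"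
    "inputs e = inputs c" "outputs e = outputs d"
  using assms by (simp_all add: composite_via_def)

lemma open_circuitD:
  assumes "open_circuit P X Y c"
  shows "finite X" "finite Y" "finite (nodes c)" "finite (edges c)" "inputs c = X" "outputs c = Y"
    "\<forall>e\<in>edges c. src c e \<in> nodes c" "\<forall>e\<in>edges c. tgt c e \<in> nodes c" "\<forall>e\<in>edges c. res c e \<in> P"
    "\<forall>x\<in>X. inp c x \<in> nodes c" "\<forall>y\<in>Y. outp c y \<in> nodes c"
  using assms by (auto simp: open_circuit_def)

lemma open_composite:
  assumes c: "open_circuit P X Y c" and d: "open_circuit P Y Z d" and e: "composite c d e"
  shows "open_circuit P X Z e"
proof -
  obtain j k l where viae: "composite_via j k l c d e" using e by (rule compositeE)
  note po = composite_viaD(1)[OF viae] and l = composite_viaD(2)[OF viae] and h = composite_viaD(3-)[OF viae]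
  note c = open_circuitD[OF c] and d = open_circuitD[OF d]
  have E: "edges e = l ` (edges c \<uplus> edges d)" using l by (simp add: bij_betw_def)
  have "finite (edges e)" unfolding E using c d by simp
  then show ?thesis
    using c d h pushout_finite[OF po] pushout_maps(1,2)[OF po]
    by (auto simp: open_circuit_def E edge_hom_def)
qed

lemma circuit_relI:
  assumes "open_circuit P X Y c" "open_circuit P X Y d"
    "bij_betw f (nodes c) (nodes d)" "bij_betw g (edges c) (edges d)" "edge_hom f g c d"
    "\<forall>x\<in>X. inp d x = f (inp c x)" "\<forall>y\<in>Y. outp d y = f (outp c y)"
  shows "(c, d) \<in> circuit_rel P"
  using assms unfolding circuit_rel_def edge_hom_def by blast

lemma circuit_relE:
  assumes "(c, d) \<in> circuit_rel P" "open_circuit P X Y c"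
  obtains f g where "open_circuit P X Y d"
    "bij_betw f (nodes c) (nodes d)" "bij_betw g (edges c) (edges d)" "edge_hom f g c d"
    "\<forall>x\<in>X. inp d x = f (inp c x)" "\<forall>y\<in>Y. outp d y = f (outp c y)"
proof -
  obtain X' Y' f g where *: "open_circuit P X' Y' c" "open_circuit P X' Y' d"
    "bij_betw f (nodes c) (nodes d)" "bij_betw g (edges c) (edges d)" "edge_hom f g c d"
    "\<forall>x\<in>X'. inp d x = f (inp c x)" "\<forall>y\<in>Y'. outp d y = f (outp c y)"
    using assms(1) unfolding circuit_rel_def edge_hom_def by blast
  have "X' = X" "Y' = Y" using *(1) assms(2) by (auto simp: open_circuit_def)
  with * show ?thesis by (intro that) auto
qed

lemma circuit_rel_refl: "open_circuit P X Y c \<Longrightarrow> (c, c) \<in> circuit_rel P"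
  by (rule circuit_relI[where f = id and g = id]) (auto simp: edge_hom_def)

lemma circuit_rel_open: "(c, d) \<in> circuit_rel P \<Longrightarrow> \<exists>X Y. open_circuit P X Y c \<and> open_circuit P X Y d"
  unfolding circuit_rel_def by blast

lemma circuit_rel_sym:
  assumes "(c, d) \<in> circuit_rel P"
  shows "(d, c) \<in> circuit_rel P"
proof -
  obtain X Y where c: "open_circuit P X Y c" using circuit_rel_open[OF assms] by blast
  obtain f g where d: "open_circuit P X Y d"
    and fg: "bij_betw f (nodes c) (nodes d)" "bij_betw g (edges c) (edges d)" "edge_hom f g c d"
    "\<forall>x\<in>X. inp d x = f (inp c x)" "\<forall>y\<in>Y. outp d y = f (outp c y)"
    using circuit_relE[OF assms c] by metis
  define f' where "f' = inv_into (nodes c) f"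
  define g' where "g' = inv_into (edges c) g"
  have f': "f' (f n) = n" if "n \<in> nodes c" for n
    using fg(1) that by (simp add: f'_def bij_betw_def)
  have g': "g (g' e) = e" "g' e \<in> edges c" if "e \<in> edges d" for e
    using fg(2) that by (auto simp: g'_def bij_betw_def f_inv_into_f inv_into_into)
  show ?thesis
  proof (rule circuit_relI[OF d c])
    show "bij_betw f' (nodes d) (nodes c)" "bij_betw g' (edges d) (edges c)"
      unfolding f'_def g'_def by (rule bij_betw_inv_into, fact)+
    have "src c (g' e) = f' (src d e) \<and> tgt c (g' e) = f' (tgt d e) \<and> res c (g' e) = res d e"
      if "e \<in> edges d" for e
    proof -
      have "src d (g (g' e)) = f (src c (g' e)) \<and> tgt d (g (g' e)) = f (tgt c (g' e))
          \<and> res d (g (g' e)) = res c (g' e)"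
        using fg(3) g'(2)[OF that] unfolding edge_hom_def by blast
      then show ?thesis using g'[OF that] f' open_circuitD(7,8)[OF c] by simp
    qed
    then show "edge_hom f' g' d c" by (simp add: edge_hom_def)
  qed (use fg f' open_circuitD[OF c] in simp_all)
qed

lemma circuit_rel_trans:
  assumes "(c, d) \<in> circuit_rel P" "(d, e) \<in> circuit_rel P"
  shows "(c, e) \<in> circuit_rel P"
proof -
  obtain X Y where c: "open_circuit P X Y c" using circuit_rel_open[OF assms(1)] by blast
  obtain f g where d: "open_circuit P X Y d"
    and fg: "bij_betw f (nodes c) (nodes d)" "bij_betw g (edges c) (edges d)" "edge_hom f g c d"
    "\<forall>x\<in>X. inp d x = f (inp c x)" "\<forall>y\<in>Y. outp d y = f (outp c y)"
    using circuit_relE[OF assms(1) c] by metis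
  obtain f' g' where e: "open_circuit P X Y e"
    and fg': "bij_betw f' (nodes d) (nodes e)" "bij_betw g' (edges d) (edges e)" "edge_hom f' g' d e"
    "\<forall>x\<in>X. inp e x = f' (inp d x)" "\<forall>y\<in>Y. outp e y = f' (outp d y)"
    using circuit_relE[OF assms(2) d] by metis
  have "g x \<in> edges d" if "x \<in> edges c" for x using fg(2) that by (auto simp: bij_betw_def)
  then have "edge_hom (f' \<circ> f) (g' \<circ> g) c e"
    using fg(3) fg'(3) by (simp add: edge_hom_def)
  then show ?thesis
    using fg fg' bij_betw_trans by (intro circuit_relI[OF c e, of "f' \<circ> f" "g' \<circ> g"]) auto
qed

lemma circuit_class_eq: "(c, d) \<in> circuit_rel P \<Longrightarrow> circuit_class P c = circuit_class P d"
  using circuit_rel_sym circuit_rel_trans by (auto, blast+)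

text \<open>The comparison of the two pushouts is a bijection of nodes that commutes with everything.\<close>

lemma composite_unique:
  assumes c: "open_circuit P X Y c" and d: "open_circuit P Y Z d"
    and e: "composite c d e" "composite c d e'"
  shows "(e, e') \<in> circuit_rel P"
proof -
  obtain j k l where via: "composite_via j k l c d e" using e(1) by (rule compositeE)
  note po = composite_viaD(1)[OF via] and l = composite_viaD(2)[OF via] and h = composite_viaD(3-)[OF via]
  obtain j' k' l' where via': "composite_via j' k' l' c d e'" using e(2) by (rule compositeE)
  note po' = composite_viaD(1)[OF via'] and l' = composite_viaD(2)[OF via'] and h' = composite_viaD(3-)[OF via']
  obtain r where r: "bij_betw r (nodes e) (nodes e')"
    "\<And>n. n \<in> nodes c \<Longrightarrow> r (j n) = j' n" "\<And>m. m \<in> nodes d \<Longrightarrow> r (k m) = k' m"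
    using pushout_unique[OF po po'] by metis
  let ?g = "l' \<circ> inv_into (edges c \<uplus> edges d) l"
  have inv: "inv_into (edges c \<uplus> edges d) l (l z) = z" if "z \<in> edges c \<uplus> edges d" for z
    using l that by (simp add: bij_betw_def)
  have E: "edges e = l ` (edges c \<uplus> edges d)" using l by (simp add: bij_betw_def)
  show ?thesis
  proof (rule circuit_relI)
    show "open_circuit P X Z e" "open_circuit P X Z e'" using open_composite[OF c d] e by auto
    show "bij_betw ?g (edges e) (edges e')"
      using bij_betw_inv_into[OF l] l' by (rule bij_betw_trans)
    show "edge_hom r ?g e e'"
      using h h' r open_circuitD(7,8)[OF c] open_circuitD(7,8)[OF d]
      by (auto simp: edge_hom_def E inv)
  qed (use r h h' open_circuitD[OF c] open_circuitD[OF d] in auto)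
qed

lemma composite_cong:
  assumes c: "open_circuit P X Y c" and d: "open_circuit P Y Z d" and e: "composite c d e"
    and cc': "(c, c') \<in> circuit_rel P" and dd': "(d, d') \<in> circuit_rel P"
  shows "composite c' d' e"
proof -
  obtain j k l where viae: "composite_via j k l c d e" using e by (rule compositeE)
  note po = composite_viaD(1)[OF viae] and l = composite_viaD(2)[OF viae] and h = composite_viaD(3-)[OF viae]
  have c': "open_circuit P X Y c'" and d': "open_circuit P Y Z d'"
    using circuit_relE[OF cc' c] circuit_relE[OF dd' d] by metis+
  obtain f g where f: "bij_betw f (nodes c') (nodes c)" "bij_betw g (edges c') (edges c)"
    "edge_hom f g c' c" "\<forall>x\<in>X. inp c x = f (inp c' x)" "\<forall>y\<in>Y. outp c y = f (outp c' y)"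
    using circuit_relE[OF circuit_rel_sym[OF cc'] c'] by metis
  obtain f' g' where f': "bij_betw f' (nodes d') (nodes d)" "bij_betw g' (edges d') (edges d)"
    "edge_hom f' g' d' d" "\<forall>x\<in>Y. inp d x = f' (inp d' x)" "\<forall>y\<in>Z. outp d y = f' (outp d' y)"
    using circuit_relE[OF circuit_rel_sym[OF dd'] d'] by metis
  note io = open_circuitD[OF c] open_circuitD[OF d] open_circuitD[OF c'] open_circuitD[OF d']
  have "pushout (outputs c') (outp c') (inp d') (nodes c') (nodes d') (j \<circ> f) (k \<circ> f') (nodes e)"
    using pushout_transport[OF po f(1) f'(1), of "outp c'" "inp d'"] io f f' by auto
  moreover have "bij_betw (l \<circ> dmap g g') (edges c' \<uplus> edges d') (edges e)"
    using bij_betw_dmap[OF f(2) f'(2)] l by (rule bij_betw_trans)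
  moreover have "g x \<in> edges c" if "x \<in> edges c'" for x using f(2) that by (auto simp: bij_betw_def)
  then have "edge_hom (j \<circ> f) ((l \<circ> dmap g g') \<circ> InL) c' e"
    using h(1) f(3) by (simp add: edge_hom_def)
  moreover have "g' x \<in> edges d" if "x \<in> edges d'" for x using f'(2) that by (auto simp: bij_betw_def)
  then have "edge_hom (k \<circ> f') ((l \<circ> dmap g g') \<circ> InR) d' e"
    using h(2) f'(3) by (simp add: edge_hom_def)
  moreover have "\<forall>x\<in>inputs c'. inp e x = (j \<circ> f) (inp c' x)" "\<forall>z\<in>outputs d'. outp e z = (k \<circ> f') (outp d' z)"
    using h io f f' by auto
  ultimately show ?thesis using h io by (intro compositeI) auto
qed

lemma composite_comp_circuit:
  assumes c: "open_circuit P X Y c" and d: "open_circuit P Y Z d"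
  shows "composite c d (comp_circuit d c)"
proof -
  define q where "q = pushout_map (outputs c) (outp c) (inp d)"
  have po: "pushout (outputs c) (outp c) (inp d) (nodes c) (nodes d) (q \<circ> InL) (q \<circ> InR)
      (q ` (nodes c \<uplus> nodes d))"
    unfolding q_def
    by (rule pushout_pushout_map) (use open_circuitD[OF c] open_circuitD[OF d] in auto)
  show ?thesis
    by (rule compositeI[where j = "q \<circ> InL" and k = "q \<circ> InR" and l = id])
      (use po in \<open>simp_all add: comp_circuit_def Let_def q_def[symmetric] edge_hom_def\<close>)
qed

text \<open>The node sets are handled by \<open>pushout_paste\<close>; the edges are reassociated.\<close>

lemma composite_assoc:
  assumes c: "open_circuit P W X c" and d: "open_circuit P X Y d" and h: "open_circuit P Y Z h"
    and e: "composite c d e" and e': "composite d h e'" and u: "composite e h u"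
  shows "composite c e' u"
proof -
  obtain j1 k1 l1 where viae: "composite_via j1 k1 l1 c d e" using e by (rule compositeE)
  note po1 = composite_viaD(1)[OF viae] and l1 = composite_viaD(2)[OF viae] and h1 = composite_viaD(3-)[OF viae]
  obtain j2 k2 l2 where viae': "composite_via j2 k2 l2 d h e'" using e' by (rule compositeE)
  note po2 = composite_viaD(1)[OF viae'] and l2 = composite_viaD(2)[OF viae'] and h2 = composite_viaD(3-)[OF viae']
  obtain j3 k3 l3 where viau: "composite_via j3 k3 l3 e h u" using u by (rule compositeE)
  note po3 = composite_viaD(1)[OF viau] and l3 = composite_viaD(2)[OF viau] and h3 = composite_viaD(3-)[OF viau]
  note io = open_circuitD(5,6)[OF c] open_circuitD(5,6)[OF d] open_circuitD(5,6)[OF h]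
  obtain r where r: "\<forall>m\<in>nodes d. r (j2 m) = j3 (k1 m)" "\<forall>m\<in>nodes h. r (k2 m) = k3 m"
    and po: "pushout (outputs c) (outp c) (inp e') (nodes c) (nodes e') (j3 \<circ> j1) r (nodes u)"
    using pushout_paste[OF po1 po2 po3[unfolded h1(6)] h1(4), of "inp e'"] h2(3) io by metis
  let ?i = "inv_into (edges d \<uplus> edges h) l2"
  let ?l = "l3 \<circ> (dmap l1 id \<circ> (unassoc_map \<circ> dmap id ?i))"
  have E': "edges e' = l2 ` (edges d \<uplus> edges h)" using l2 by (simp add: bij_betw_def)
  have E: "l1 z \<in> edges e" if "z \<in> edges c \<uplus> edges d" for z using that l1 by (auto simp: bij_betw_def)
  have inv: "?i (l2 z) = z" if "z \<in> edges d \<uplus> edges h" for z using l2 that by (simp add: bij_betw_def)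
  have un: "bij_betw unassoc_map (edges c \<uplus> (edges d \<uplus> edges h)) ((edges c \<uplus> edges d) \<uplus> edges h)"
    by (rule bij_betw_byWitness[where f' = assoc_map]) auto
  have "bij_betw ?l (edges c \<uplus> edges e') (edges u)"
    by (intro bij_betw_trans[OF _ l3] bij_betw_trans[OF _ bij_betw_dmap[OF l1 bij_betw_id]]
        bij_betw_trans[OF _ un] bij_betw_dmap bij_betw_id bij_betw_inv_into l2)
  moreover have "edge_hom (j3 \<circ> j1) (?l \<circ> InL) c u"
    using h1(1) h3(1) E by (simp add: edge_hom_def)
  moreover have "edge_hom r (?l \<circ> InR) e' u"
    using h1(2) h2(1,2) h3(1,2) E r open_circuitD(7,8)[OF d] open_circuitD(7,8)[OF h]
    by (simp add: edge_hom_def E' inv)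
  moreover have "\<forall>x\<in>inputs c. inp u x = (j3 \<circ> j1) (inp c x)" "\<forall>z\<in>outputs e'. outp u z = r (outp e' z)"
    using h1 h2 h3 r io open_circuitD(11)[OF h] by auto
  ultimately show ?thesis using po h1 h2 h3 by (intro compositeI) auto
qed

section \<open>The hypergraph category of circuits\<close>

lemma open_tens:
  assumes c: "open_circuit P X Y c" and d: "open_circuit P X' Y' d"
  shows "open_circuit P (X \<uplus> X') (Y \<uplus> Y') (tens_circuit c d)"
  using open_circuitD[OF c] open_circuitD[OF d]
  by (simp add: open_circuit_def tens_circuit_def Pi_iff)

lemma tens_cong:
  assumes "(c, c') \<in> circuit_rel P" "(d, d') \<in> circuit_rel P"
  shows "(tens_circuit c d, tens_circuit c' d') \<in> circuit_rel P"
proof -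
  obtain X Y X' Y' where c: "open_circuit P X Y c" and d: "open_circuit P X' Y' d"
    using circuit_rel_open assms by meson
  obtain f g where f: "open_circuit P X Y c'"
    "bij_betw f (nodes c) (nodes c')" "bij_betw g (edges c) (edges c')" "edge_hom f g c c'"
    "\<forall>x\<in>X. inp c' x = f (inp c x)" "\<forall>y\<in>Y. outp c' y = f (outp c y)"
    using circuit_relE[OF assms(1) c] by metis
  obtain f' g' where f': "open_circuit P X' Y' d'"
    "bij_betw f' (nodes d) (nodes d')" "bij_betw g' (edges d) (edges d')" "edge_hom f' g' d d'"
    "\<forall>x\<in>X'. inp d' x = f' (inp d x)" "\<forall>y\<in>Y'. outp d' y = f' (outp d y)"
    using circuit_relE[OF assms(2) d] by metis
  show ?thesis
  proof (rule circuit_relI[OF open_tens[OF c d] open_tens[OF f(1) f'(1)]])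
    show "bij_betw (dmap f f') (nodes (tens_circuit c d)) (nodes (tens_circuit c' d'))"
      "bij_betw (dmap g g') (edges (tens_circuit c d)) (edges (tens_circuit c' d'))"
      using f f' by (simp_all add: tens_circuit_def bij_betw_dmap)
  qed (use f f' in \<open>simp_all add: tens_circuit_def edge_hom_def\<close>)
qed

lemma composite_tens:
  assumes e: "composite c d e" and e': "composite c' d' e'"
  shows "composite (tens_circuit c c') (tens_circuit d d') (tens_circuit e e')"
proof -
  obtain j k l where viae: "composite_via j k l c d e" using e by (rule compositeE)
  note po = composite_viaD(1)[OF viae] and l = composite_viaD(2)[OF viae] and h = composite_viaD(3-)[OF viae]
  obtain j' k' l' where via': "composite_via j' k' l' c' d' e'" using e' by (rule compositeE)
  note po' = composite_viaD(1)[OF via'] and l' = composite_viaD(2)[OF via'] and h' = composite_viaD(3-)[OF via']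
  have mid: "bij_betw mid_map ((A \<uplus> B) \<uplus> (A' \<uplus> B')) ((A \<uplus> A') \<uplus> (B \<uplus> B'))" for A B A' B' :: "'a elt set"
    by (rule bij_betw_byWitness[where f' = mid_map]) auto
  have "bij_betw (dmap l l' \<circ> mid_map) ((edges c \<uplus> edges c') \<uplus> (edges d \<uplus> edges d')) (edges e \<uplus> edges e')"
    using mid bij_betw_dmap[OF l l'] by (rule bij_betw_trans)
  then show ?thesis
    by (intro compositeI[where j = "dmap j j'" and k = "dmap k k'" and l = "dmap l l' \<circ> mid_map"])
      (use pushout_dsum[OF po po'] h h' in \<open>simp_all add: tens_circuit_def edge_hom_def\<close>)
qed

lemma open_cospan:
  "\<lbrakk>finite X; finite N; finite Y; i \<in> X \<rightarrow> N; j \<in> Y \<rightarrow> N\<rbrakk> \<Longrightarrow> open_circuit P X Y (cospan X N Y i j)"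
  by (simp add: open_circuit_def cospan_def)

lemma composite_cospan:
  assumes "pushout Y j k N M p q Q"
  shows "composite (cospan X N Y i j) (cospan Y M Z k l) (cospan X Q Z (p \<circ> i) (q \<circ> l))"
  by (rule compositeI[where j = p and k = q and l = id])
    (use assms in \<open>simp_all add: cospan_def edge_hom_def bij_betw_def\<close>)

lemma tens_cospan:
  assumes "finite X" "finite N" "finite Y" "i \<in> X \<rightarrow> N" "j \<in> Y \<rightarrow> N"
    "finite X'" "finite N'" "finite Y'" "i' \<in> X' \<rightarrow> N'" "j' \<in> Y' \<rightarrow> N'"
  shows "(tens_circuit (cospan X N Y i j) (cospan X' N' Y' i' j'),
      cospan (X \<uplus> X') (N \<uplus> N') (Y \<uplus> Y') (dmap i i') (dmap j j')) \<in> circuit_rel P"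
proof (rule circuit_relI[where f = id and g = id])
  show "open_circuit P (X \<uplus> X') (Y \<uplus> Y') (tens_circuit (cospan X N Y i j) (cospan X' N' Y' i' j'))"
    using assms by (intro open_tens open_cospan)
  show "open_circuit P (X \<uplus> X') (Y \<uplus> Y') (cospan (X \<uplus> X') (N \<uplus> N') (Y \<uplus> Y') (dmap i i') (dmap j j'))"
    using assms by (intro open_cospan) (auto simp: Pi_iff)
qed (simp_all add: tens_circuit_def cospan_def edge_hom_def bij_betw_def)

text \<open>Composing with the image of a function on the input side merely relabels the inputs.\<close>

lemma composite_precompose:
  assumes c: "open_circuit P X Y c" and s: "s \<in> X' \<rightarrow> X"
  shows "composite (cospan X' X X s id) c (c\<lparr>inputs := X', inp := inp c \<circ> s\<rparr>)"
proof -
  have l: "bij_betw fold_map ({} \<uplus> edges c) (edges c)"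
    by (intro bij_betw_byWitness[where f' = InR]) auto
  have "pushout X id (inp c) X (nodes c) (inp c) id (nodes c)"
    by (rule pushoutI) (use open_circuitD[OF c] in \<open>auto simp: Pi_iff\<close>)
  then show ?thesis
    by (intro compositeI[where j = "inp c" and k = id and l = fold_map])
      (use open_circuitD[OF c] l in \<open>simp_all add: cospan_def edge_hom_def\<close>)
qed

text \<open>On the output side the relabelling has to be inverted, so a bijection is needed.\<close>

lemma composite_postcompose:
  assumes c: "open_circuit P X Y c" and t: "t \<in> Y \<rightarrow> Y'" "t' \<in> Y' \<rightarrow> Y"
    "\<forall>y\<in>Y. t' (t y) = y" "\<forall>y\<in>Y'. t (t' y) = y"
  shows "composite c (cospan Y Y' Y' t id) (c\<lparr>outputs := Y', outp := outp c \<circ> t'\<rparr>)"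
proof -
  have l: "bij_betw fold_map (edges c \<uplus> {}) (edges c)"
    by (intro bij_betw_byWitness[where f' = InL]) auto
  have "pushout Y (outp c) t (nodes c) Y' id (outp c \<circ> t') (nodes c)"
  proof (rule pushoutI)
    fix p p' :: "_ \<Rightarrow> bool" assume "\<forall>y\<in>Y. p (outp c y) = p' (t y)"
    then show "\<exists>r. (\<forall>n\<in>nodes c. p n = r (id n)) \<and> (\<forall>m\<in>Y'. p' m = r ((outp c \<circ> t') m))"
      using t by (intro exI[of _ p]) (simp add: Pi_iff)
  qed (use open_circuitD[OF c] t in \<open>auto simp: Pi_iff\<close>)
  then show ?thesis
    by (intro compositeI[where j = id and k = "outp c \<circ> t'" and l = fold_map])
      (use open_circuitD[OF c] l in \<open>simp_all add: cospan_def edge_hom_def\<close>)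
qed

lemma Hom_Circ: "A \<in> Hom (Circ P) X Y \<longleftrightarrow> (\<exists>c. open_circuit P X Y c \<and> A = circuit_class P c)"
  by (auto simp: Circ_def quotient_def)

lemma Circ_comp:
  assumes c: "open_circuit P X Y c" and d: "open_circuit P Y Z d" and e: "composite c d e"
  shows "circuit_class P d \<cdot>\<^bsub>Circ P\<^esub> circuit_class P c = circuit_class P e"
proof -
  have "circuit_class P (comp_circuit d' c') = circuit_class P e"
    if "(c, c') \<in> circuit_rel P" "(d, d') \<in> circuit_rel P" for c' d'
  proof -
    have c': "open_circuit P X Y c'" and d': "open_circuit P Y Z d'"
      using circuit_relE[OF that(1) c] circuit_relE[OF that(2) d] by metis+
    have "composite c' d' e" by (rule composite_cong[OF c d e that])
    with composite_comp_circuit[OF c' d'] show ?thesis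
      by (intro circuit_class_eq composite_unique[OF c' d'])
  qed
  then have "(\<Union>d'\<in>circuit_class P d. \<Union>c'\<in>circuit_class P c. circuit_class P (comp_circuit d' c'))
      = (\<Union>d'\<in>circuit_class P d. \<Union>c'\<in>circuit_class P c. circuit_class P e)"
    by (simp add: Image_singleton_iff)
  also have "\<dots> = circuit_class P e"
    using circuit_rel_refl[OF c] circuit_rel_refl[OF d] by blast
  finally show ?thesis by (simp add: Circ_def)
qed

lemma Circ_tens:
  assumes c: "open_circuit P X Y c" and d: "open_circuit P X' Y' d"
  shows "circuit_class P c \<otimes>\<^bsub>Circ P\<^esub> circuit_class P d = circuit_class P (tens_circuit c d)"
proof -
  have "circuit_class P (tens_circuit c' d') = circuit_class P (tens_circuit c d)"
    if "(c, c') \<in> circuit_rel P" "(d, d') \<in> circuit_rel P" for c' d'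
    using circuit_class_eq[OF tens_cong[OF that]] by simp
  then have "(\<Union>c'\<in>circuit_class P c. \<Union>d'\<in>circuit_class P d. circuit_class P (tens_circuit c' d'))
      = (\<Union>c'\<in>circuit_class P c. \<Union>d'\<in>circuit_class P d. circuit_class P (tens_circuit c d))"
    by (simp add: Image_singleton_iff)
  also have "\<dots> = circuit_class P (tens_circuit c d)"
    using circuit_rel_refl[OF c] circuit_rel_refl[OF d] by blast
  finally show ?thesis by (simp add: Circ_def)
qed

lemma cat_Circ: "cat (Circ P)"
proof
  fix X :: "'a elt set" assume "X \<in> Obj (Circ P)"
  then have "open_circuit P X X (cospan X X X id id)"
    by (intro open_cospan) (auto simp: Circ_def)
  then have "circuit_class P (cospan X X X id id) \<in> Hom (Circ P) X X"
    by (auto simp: Hom_Circ)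
  then show "cat_data.Id (Circ P) X \<in> Hom (Circ P) X X"
    by (simp add: Circ_def)
next
  fix X Y Z :: "'a elt set" and f g
  assume "f \<in> Hom (Circ P) X Y" "g \<in> Hom (Circ P) Y Z"
  then obtain c d where c: "open_circuit P X Y c" "f = circuit_class P c"
    and d: "open_circuit P Y Z d" "g = circuit_class P d" by (auto simp: Hom_Circ)
  have "composite c d (comp_circuit d c)" using c d by (intro composite_comp_circuit)
  with c d open_composite[OF c(1) d(1)] show "g \<cdot>\<^bsub>Circ P\<^esub> f \<in> Hom (Circ P) X Z"
    by (auto simp: Hom_Circ Circ_comp)
next
  fix X Y :: "'a elt set" and f
  assume "X \<in> Obj (Circ P)" "Y \<in> Obj (Circ P)" "f \<in> Hom (Circ P) X Y"
  then obtain c where c: "open_circuit P X Y c" "f = circuit_class P c" 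
    and fin: "finite X" "finite Y" using open_circuitD(1,2) by (metis Hom_Circ)
  have o: "open_circuit P X X (cospan X X X id id)" "open_circuit P Y Y (cospan Y Y Y id id)"
    using fin by (auto intro!: open_cospan)
  have I: "cat_data.Id (Circ P) X = circuit_class P (cospan X X X id id)" for X :: "'a elt set"
    by (simp add: Circ_def)
  have "c\<lparr>inputs := X, inp := inp c \<circ> id\<rparr> = c" "c\<lparr>outputs := Y, outp := outp c \<circ> id\<rparr> = c"
    using open_circuitD[OF c(1)] by simp_all
  then have "composite (cospan X X X id id) c c" "composite c (cospan Y Y Y id id) c"
    using composite_precompose[OF c(1), of id X] composite_postcompose[OF c(1), of id Y id] by simp_all
  then show "f \<cdot>\<^bsub>Circ P\<^esub> cat_data.Id (Circ P) X = f" "cat_data.Id (Circ P) Y \<cdot>\<^bsub>Circ P\<^esub> f = f"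
    unfolding I c(2) using Circ_comp[OF o(1) c(1)] Circ_comp[OF c(1) o(2)] by simp_all
next
  fix W X Y Z :: "'a elt set" and f g h
  assume "f \<in> Hom (Circ P) W X" "g \<in> Hom (Circ P) X Y" "h \<in> Hom (Circ P) Y Z"
  then obtain c d e where c: "open_circuit P W X c" "f = circuit_class P c"
    and d: "open_circuit P X Y d" "g = circuit_class P d"
    and e: "open_circuit P Y Z e" "h = circuit_class P e" by (auto simp: Hom_Circ)
  let ?cd = "comp_circuit d c" and ?de = "comp_circuit e d"
  let ?u = "comp_circuit e ?cd"
  have cd: "composite c d ?cd" and de: "composite d e ?de"
    by (rule composite_comp_circuit; fact)+
  have ocd: "open_circuit P W Y ?cd" "open_circuit P X Z ?de"
    using open_composite[OF c(1) d(1) cd] open_composite[OF d(1) e(1) de] by auto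
  have u: "composite ?cd e ?u" using ocd e by (intro composite_comp_circuit)
  have "composite c ?de ?u" using composite_assoc[OF c(1) d(1) e(1) cd de u] .
  then show "h \<cdot>\<^bsub>Circ P\<^esub> g \<cdot>\<^bsub>Circ P\<^esub> f = h \<cdot>\<^bsub>Circ P\<^esub> (g \<cdot>\<^bsub>Circ P\<^esub> f)"
    using c d e ocd by (simp add: Circ_comp[OF _ _ cd] Circ_comp[OF _ _ de] Circ_comp[OF _ _ u] Circ_comp)
qed

text \<open>
  Naturality of the coherence arrows: both composites are relabellings of one circuit up to a bijection of
  nodes and edges.
\<close>

lemma Circ_natural_square:
  assumes a: "open_circuit P X Y a" and b: "open_circuit P X' Y' b"
    and s: "s \<in> X \<rightarrow> X'" and t: "t \<in> Y \<rightarrow> Y'" "t' \<in> Y' \<rightarrow> Y"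
    "\<forall>y\<in>Y. t' (t y) = y" "\<forall>y\<in>Y'. t (t' y) = y"
    and f: "bij_betw f (nodes a) (nodes b)" "bij_betw g (edges a) (edges b)" "edge_hom f g a b"
    "\<forall>x\<in>X. inp b (s x) = f (inp a x)" "\<forall>y\<in>Y. outp b (t y) = f (outp a y)"
  shows "circuit_class P (cospan Y Y' Y' t id) \<cdot>\<^bsub>Circ P\<^esub> circuit_class P a
    = circuit_class P b \<cdot>\<^bsub>Circ P\<^esub> circuit_class P (cospan X X' X' s id)"
proof -
  let ?a = "a\<lparr>outputs := Y', outp := outp a \<circ> t'\<rparr>" and ?b = "b\<lparr>inputs := X, inp := inp b \<circ> s\<rparr>"
  have o: "open_circuit P Y Y' (cospan Y Y' Y' t id)" "open_circuit P X X' (cospan X X' X' s id)"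
    using open_circuitD(1,2)[OF a] open_circuitD(1,2)[OF b] s t by (auto intro!: open_cospan)
  have ca: "composite a (cospan Y Y' Y' t id) ?a" by (rule composite_postcompose[OF a t])
  have cb: "composite (cospan X X' X' s id) b ?b" by (rule composite_precompose[OF b s])
  have "(?a, ?b) \<in> circuit_rel P"
  proof (rule circuit_relI)
    show "open_circuit P X Y' ?a" "open_circuit P X Y' ?b"
      using open_composite[OF a o(1) ca] open_composite[OF o(2) b cb] by auto
    have "outp b y = f (outp a (t' y))" if "y \<in> Y'" for y
    proof -
      have "t' y \<in> Y" "t (t' y) = y" using t that by auto
      then show ?thesis using f(5) by metis
    qed
    then show "\<forall>y\<in>Y'. outp ?b y = f (outp ?a y)" by simp
  qed (use f in \<open>simp_all add: edge_hom_def\<close>)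
  then show ?thesis
    unfolding Circ_comp[OF a o(1) ca] Circ_comp[OF o(2) b cb] by (rule circuit_class_eq)
qed

lemma cospan_cat_Circ: "cospan_cat (Circ P) (\<lambda>X N Y i j. circuit_class P (cospan X N Y i j))"
proof -
  interpret cat "Circ P" by (rule cat_Circ)
  show ?thesis
  proof unfold_locales
    fix X N Y M Z Q :: "'a elt set" and i j k l p q
    assume *: "finite X" "finite N" "finite Y" "finite M" "finite Z" "i \<in> X \<rightarrow> N" "l \<in> Z \<rightarrow> M"
      "pushout Y j k N M p q Q"
    have "open_circuit P X Y (cospan X N Y i j)" "open_circuit P Y Z (cospan Y M Z k l)"
      using * pushout_maps(4,5)[OF *(8)] by (auto intro!: open_cospan)
    from Circ_comp[OF this composite_cospan[OF *(8)]]
    show "circuit_class P (cospan Y M Z k l) \<cdot>\<^bsub>Circ P\<^esub> circuit_class P (cospan X N Y i j)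
        = circuit_class P (cospan X Q Z (p \<circ> i) (q \<circ> l))" .
  next
    fix X N Y X' N' Y' :: "'a elt set" and i j i' j'
    assume *: "finite X" "finite N" "finite Y" "finite X'" "finite N'" "finite Y'"
        "i \<in> X \<rightarrow> N" "j \<in> Y \<rightarrow> N" "i' \<in> X' \<rightarrow> N'" "j' \<in> Y' \<rightarrow> N'"
    have "open_circuit P X Y (cospan X N Y i j)" "open_circuit P X' Y' (cospan X' N' Y' i' j')"
      using * by (auto intro!: open_cospan)
    from Circ_tens[OF this]
    show "circuit_class P (cospan X N Y i j) \<otimes>\<^bsub>Circ P\<^esub> circuit_class P (cospan X' N' Y' i' j')
        = circuit_class P (cospan (X \<uplus> X') (N \<uplus> N') (Y \<uplus> Y') (dmap i i') (dmap j j'))"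
      using circuit_class_eq[OF tens_cospan] * by simp
  next
    fix X Y X' Y' :: "'a elt set" and f f'
    assume "f \<in> Hom (Circ P) X Y" "f' \<in> Hom (Circ P) X' Y'"
    then show "f \<otimes>\<^bsub>Circ P\<^esub> f' \<in> Hom (Circ P) (X \<uplus> X') (Y \<uplus> Y')"
      by (auto simp: Hom_Circ Circ_tens intro: open_tens)
  next
    fix X Y Z X' Y' Z' :: "'a elt set" and f g f' g'
    assume "f \<in> Hom (Circ P) X Y" "g \<in> Hom (Circ P) Y Z" "f' \<in> Hom (Circ P) X' Y'" "g' \<in> Hom (Circ P) Y' Z'"
    then obtain c d c' d' where c: "open_circuit P X Y c" "f = circuit_class P c"
      and d: "open_circuit P Y Z d" "g = circuit_class P d"
      and c': "open_circuit P X' Y' c'" "f' = circuit_class P c'"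
      and d': "open_circuit P Y' Z' d'" "g' = circuit_class P d'" by (auto simp: Hom_Circ)
    note e = composite_comp_circuit[OF c(1) d(1)] and e' = composite_comp_circuit[OF c'(1) d'(1)]
    show "(g \<cdot>\<^bsub>Circ P\<^esub> f) \<otimes>\<^bsub>Circ P\<^esub> (g' \<cdot>\<^bsub>Circ P\<^esub> f')
        = (g \<otimes>\<^bsub>Circ P\<^esub> g') \<cdot>\<^bsub>Circ P\<^esub> (f \<otimes>\<^bsub>Circ P\<^esub> f')"
      unfolding c(2) d(2) c'(2) d'(2) Circ_comp[OF c(1) d(1) e] Circ_comp[OF c'(1) d'(1) e']
        Circ_tens[OF c(1) c'(1)] Circ_tens[OF d(1) d'(1)]
        Circ_tens[OF open_composite[OF c(1) d(1) e] open_composite[OF c'(1) d'(1) e']]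
      by (rule Circ_comp[OF open_tens[OF c(1) c'(1)] open_tens[OF d(1) d'(1)] composite_tens[OF e e'], symmetric])
  next
    fix X Y Z X' Y' Z' :: "'a elt set" and f g h
    assume fin: "finite X'" "finite Y'" "finite Z'"
      and "f \<in> Hom (Circ P) X X'" "g \<in> Hom (Circ P) Y Y'" "h \<in> Hom (Circ P) Z Z'"
    then obtain a b c where a: "open_circuit P X X' a" "f = circuit_class P a"
      and b: "open_circuit P Y Y' b" "g = circuit_class P b"
      and c: "open_circuit P Z Z' c" "h = circuit_class P c" by (auto simp: Hom_Circ)
    have assoc: "bij_betw assoc_map ((A \<uplus> B) \<uplus> C) (A \<uplus> (B \<uplus> C))" for A B C :: "'a elt set"
      by (rule bij_betw_byWitness[where f' = unassoc_map]) auto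
    have "Assoc (Circ P) X Y Z = circuit_class P (cospan ((X \<uplus> Y) \<uplus> Z) (X \<uplus> Y \<uplus> Z) (X \<uplus> Y \<uplus> Z) assoc_map id)"
      for X Y Z :: "'a elt set"
      by (simp add: Circ_def)
    then show "Assoc (Circ P) X' Y' Z' \<cdot>\<^bsub>Circ P\<^esub> ((f \<otimes>\<^bsub>Circ P\<^esub> g) \<otimes>\<^bsub>Circ P\<^esub> h)
        = (f \<otimes>\<^bsub>Circ P\<^esub> (g \<otimes>\<^bsub>Circ P\<^esub> h)) \<cdot>\<^bsub>Circ P\<^esub> Assoc (Circ P) X Y Z"
      unfolding a(2) b(2) c(2) Circ_tens[OF a(1) b(1)] Circ_tens[OF b(1) c(1)]
        Circ_tens[OF open_tens[OF a(1) b(1)] c(1)] Circ_tens[OF a(1) open_tens[OF b(1) c(1)]]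
      by (simp only:) (rule Circ_natural_square[where f = assoc_map and g = assoc_map and t' = unassoc_map,
            OF open_tens[OF open_tens[OF a(1) b(1)] c(1)] open_tens[OF a(1) open_tens[OF b(1) c(1)]]],
          use open_circuitD[OF a(1)] open_circuitD[OF b(1)] open_circuitD[OF c(1)] assoc in
          \<open>auto simp: Pi_iff tens_circuit_def edge_hom_def\<close>)
  next
    fix X Y :: "'a elt set" and f
    assume fin: "finite X" "finite Y" and "f \<in> Hom (Circ P) X Y"
    then obtain a where a: "open_circuit P X Y a" "f = circuit_class P a" by (auto simp: Hom_Circ)
    let ?I = "cospan {} {} {} id id :: ('a, 'b) circuit"
    have I: "open_circuit P {} {} ?I" by (intro open_cospan) auto
    have l: "bij_betw fold_map ({} \<uplus> E) E" "bij_betw fold_map (E \<uplus> {}) E" for E :: "'a elt set"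
      by (rule bij_betw_byWitness[where f' = InR], auto)
         (rule bij_betw_byWitness[where f' = InL], auto)
    have eqs: "LUnit (Circ P) X = circuit_class P (cospan ({} \<uplus> X) X X fold_map id)" 
      "RUnit (Circ P) X = circuit_class P (cospan (X \<uplus> {}) X X fold_map id)"
      "cat_data.Id (Circ P) {} = circuit_class P ?I" for X :: "'a elt set"
      by (simp_all add: Circ_def)
    show "LUnit (Circ P) Y \<cdot>\<^bsub>Circ P\<^esub> (cat_data.Id (Circ P) {} \<otimes>\<^bsub>Circ P\<^esub> f) = f \<cdot>\<^bsub>Circ P\<^esub> LUnit (Circ P) X"
      unfolding a(2) eqs Circ_tens[OF I a(1)]
      by (rule Circ_natural_square[where f = fold_map and g = fold_map and t' = InR, OF open_tens[OF I a(1)] a(1)])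
        (use open_circuitD[OF a(1)] l in \<open>auto simp: Pi_iff tens_circuit_def edge_hom_def cospan_def\<close>)
    show "RUnit (Circ P) Y \<cdot>\<^bsub>Circ P\<^esub> (f \<otimes>\<^bsub>Circ P\<^esub> cat_data.Id (Circ P) {}) = f \<cdot>\<^bsub>Circ P\<^esub> RUnit (Circ P) X"
      unfolding a(2) eqs Circ_tens[OF a(1) I]
      by (rule Circ_natural_square[where f = fold_map and g = fold_map and t' = InL, OF open_tens[OF a(1) I] a(1)])
        (use open_circuitD[OF a(1)] l in \<open>auto simp: Pi_iff tens_circuit_def edge_hom_def cospan_def\<close>)
  next
    fix X Y X' Y' :: "'a elt set" and f g
    assume fin: "finite X'" "finite Y'" and "f \<in> Hom (Circ P) X X'" "g \<in> Hom (Circ P) Y Y'"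
    then obtain a b where a: "open_circuit P X X' a" "f = circuit_class P a"
      and b: "open_circuit P Y Y' b" "g = circuit_class P b" by (auto simp: Hom_Circ)
    have swap: "bij_betw swap_map (A \<uplus> B) (B \<uplus> A)" for A B :: "'a elt set"
      by (rule bij_betw_byWitness[where f' = swap_map]) auto
    have S: "Symm (Circ P) X Y = circuit_class P (cospan (X \<uplus> Y) (Y \<uplus> X) (Y \<uplus> X) swap_map id)" for X Y :: "'a elt set"
      by (simp add: Circ_def)
    show "Symm (Circ P) X' Y' \<cdot>\<^bsub>Circ P\<^esub> (f \<otimes>\<^bsub>Circ P\<^esub> g) = (g \<otimes>\<^bsub>Circ P\<^esub> f) \<cdot>\<^bsub>Circ P\<^esub> Symm (Circ P) X Y"
      unfolding a(2) b(2) S Circ_tens[OF a(1) b(1)] Circ_tens[OF b(1) a(1)]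
      by (rule Circ_natural_square[where f = swap_map and g = swap_map and t' = swap_map,
            OF open_tens[OF a(1) b(1)] open_tens[OF b(1) a(1)]])
        (use open_circuitD[OF a(1)] open_circuitD[OF b(1)] swap in
          \<open>auto simp: Pi_iff tens_circuit_def edge_hom_def\<close>)
  next
    fix X N Y :: "'a elt set" and i j
    assume "finite X" "finite N" "finite Y" "i \<in> X \<rightarrow> N" "j \<in> Y \<rightarrow> N"
    then show "circuit_class P (cospan X N Y i j) \<in> Hom (Circ P) X Y"
      by (auto simp: Hom_Circ intro: open_cospan)
  qed (simp_all add: Circ_def)
qed

section \<open>Lagrangian relations\<close>

text \<open>
  A set \<open>W\<close> of linear equations \<open>(\<Sum>i\<in>I. a i * x i) = c\<close> that is closed under linear combinations is solvable
  if it does not contain \<open>0 = c\<close> with \<open>c \<noteq> 0\<close>.  Elimination, one unknown at a time: solve the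
  equations that do not involve \<open>x k\<close>, and use any other equation to determine \<open>x k\<close>.
  The set \<open>W\<close> may be infinite, as only the unknowns are counted.
\<close>

lemma linear_system_solvable:
  fixes W :: "(('i \<Rightarrow> 'f::field) \<times> 'f) set"
  assumes "finite I"
    and "\<And>a c a' c' t. (a, c) \<in> W \<Longrightarrow> (a', c') \<in> W \<Longrightarrow> (\<lambda>i. a i + t * a' i, c + t * c') \<in> W"
    and "\<And>a c. (a, c) \<in> W \<Longrightarrow> \<forall>i\<in>I. a i = 0 \<Longrightarrow> c = 0"
  shows "\<exists>x. \<forall>(a, c)\<in>W. (\<Sum>i\<in>I. a i * x i) = c"
  using assms
proof (induction I arbitrary: W rule: finite_induct)
  case empty
  then show ?case by fastforce
next
  case (insert k I)
  let ?W = "{(a, c). (a, c) \<in> W \<and> a k = 0}"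
  have "\<exists>x. \<forall>(a, c)\<in>?W. (\<Sum>i\<in>I. a i * x i) = c"
    by (rule insert.IH) (use insert.prems in auto)
  then obtain x where "\<forall>(a, c)\<in>?W. (\<Sum>i\<in>I. a i * x i) = c" ..
  then have x: "(\<Sum>i\<in>I. a i * x i) = c" if "(a, c) \<in> W" "a k = 0" for a c
    using that by auto
  show ?case
  proof (cases "\<exists>b d. (b, d) \<in> W \<and> b k \<noteq> 0")
    case False
    then show ?thesis
      using x insert.hyps by (intro exI[of _ x]) auto
  next
    case True
    then obtain b d where b: "(b, d) \<in> W" "b k \<noteq> 0" by blast
    (* the value of the unknown k that makes the equation (b, d) hold *)
    define s where "s = (d - (\<Sum>i\<in>I. b i * x i)) / b k"
    have "(\<Sum>i\<in>insert k I. a i * (x(k := s)) i) = c" if ac: "(a, c) \<in> W" for a c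
    proof -
      define t where "t = - (a k / b k)"
      have "(\<Sum>i\<in>I. (a i + t * b i) * x i) = c + t * d"
        using x[OF insert.prems(1)[OF ac b(1), of t]] b(2) by (simp add: t_def)
      then have 1: "(\<Sum>i\<in>I. a i * x i) + t * (\<Sum>i\<in>I. b i * x i) = c + t * d"
        by (simp add: distrib_right sum.distrib sum_distrib_left mult.assoc)
      have "a k * s = t * (\<Sum>i\<in>I. b i * x i) - t * d"
        by (simp add: s_def t_def right_diff_distrib diff_divide_distrib)
      then have "a k * s + (\<Sum>i\<in>I. a i * x i) =
          ((\<Sum>i\<in>I. a i * x i) + t * (\<Sum>i\<in>I. b i * x i)) - t * d"
        by (simp add: algebra_simps)
      also have "\<dots> = c" unfolding 1 by simp
      moreover have "(\<Sum>i\<in>I. a i * (x(k := s)) i) = (\<Sum>i\<in>I. a i * x i)"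
        using insert.hyps by (intro sum.cong) auto
      ultimately show ?thesis
        using insert.hyps by simp
    qed
    then show ?thesis by blast
  qed
qed

lemma symp_form_simps:
  "symp_form X u (v + w) = symp_form X u v + symp_form X u w"
  "symp_form X (v + w) u = symp_form X v u + symp_form X w u"
  "symp_form X u 0 = 0" "symp_form X 0 u = 0"
  by (simp_all add: symp_form_def algebra_simps sum.distrib)

lemma symp_form_antisym: "symp_form X v u = - symp_form X u v"
  by (simp add: symp_form_def mult.commute)

lemma symp_form_self: "symp_form X u u = 0"
  by (simp add: symp_form_def)

definition pscale :: "'f::field \<Rightarrow> ('a, 'f) pc \<Rightarrow> ('a, 'f) pc" where
  "pscale c u = (\<lambda>x. c * fst u x, \<lambda>x. c * snd u x)"

lemma pc_scale_Pair: "pc_scale c (u, v) = (pscale c u, pscale c v)"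
  by (simp add: pc_scale_def pscale_def split_beta)

lemma symp_form_pscale:
  "symp_form X u (pscale c v) = c * symp_form X u v"
  "symp_form X (pscale c v) u = c * symp_form X v u"
  by (simp_all add: symp_form_def pscale_def algebra_simps sum_distrib_left)

lemma pcs_zero [simp]: "0 \<in> pcs X"
  by (simp add: pcs_def vecs_def zero_prod_def)

lemma pcs_add [simp]: "u \<in> pcs X \<Longrightarrow> v \<in> pcs X \<Longrightarrow> u + v \<in> pcs X"
  by (auto simp: pcs_def vecs_def)

lemma pcs_pscale [simp]: "u \<in> pcs X \<Longrightarrow> pscale c u \<in> pcs X"
  by (auto simp: pcs_def vecs_def pscale_def)

lemma pscale_0: "pscale 0 u = 0" and pscale_1: "pscale 1 u = u"
  by (simp_all add: pscale_def prod_eq_iff fun_eq_iff)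

lemma pscale_minus_1: "pscale (-1) u = - u"
  by (simp add: pscale_def prod_eq_iff fun_eq_iff)

definition linear_rel :: "'a elt set \<Rightarrow> 'a elt set \<Rightarrow> ('a, 'f::field) pc rel \<Rightarrow> bool" where
  "linear_rel X Y L \<longleftrightarrow> L \<subseteq> pcs X \<times> pcs Y \<and> pc.subspace L"

lemma linear_relI:
  assumes "\<And>u v. (u, v) \<in> L \<Longrightarrow> u \<in> pcs X \<and> v \<in> pcs Y" "(0, 0) \<in> L"
    and "\<And>u v u' v'. (u, v) \<in> L \<Longrightarrow> (u', v') \<in> L \<Longrightarrow> (u + u', v + v') \<in> L"
    and "\<And>c u v. (u, v) \<in> L \<Longrightarrow> (pscale c u, pscale c v) \<in> L"
  shows "linear_rel X Y L"
proof -
  have "w + w' \<in> L" if "w \<in> L" "w' \<in> L" for w w'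
    using assms(3)[of "fst w" "snd w" "fst w'" "snd w'"] that by (simp add: plus_prod_def)
  moreover have "pc_scale c w \<in> L" if "w \<in> L" for c w
    using assms(4)[of "fst w" "snd w" c] that pc_scale_Pair[of c "fst w" "snd w"] by simp
  ultimately show ?thesis
    using assms(1,2) unfolding linear_rel_def pc.subspace_def zero_prod_def[where ?'a = "('a, 'b) pc"]
    by auto
qed

lemma linear_relD:
  assumes "linear_rel X Y L"
  shows "(u, v) \<in> L \<Longrightarrow> u \<in> pcs X" "(u, v) \<in> L \<Longrightarrow> v \<in> pcs Y" "(0, 0) \<in> L"
    and "(u, v) \<in> L \<Longrightarrow> (u', v') \<in> L \<Longrightarrow> (u + u', v + v') \<in> L"
    and "(u, v) \<in> L \<Longrightarrow> (pscale c u, pscale c v) \<in> L"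
proof -
  have "L \<subseteq> pcs X \<times> pcs Y" and sub: "pc.subspace L" using assms by (auto simp: linear_rel_def)
  then show "(u, v) \<in> L \<Longrightarrow> u \<in> pcs X" "(u, v) \<in> L \<Longrightarrow> v \<in> pcs Y" by auto
  show "(0, 0) \<in> L" using pc.subspace_0[OF sub] by (simp add: zero_prod_def)
  show "(u, v) \<in> L \<Longrightarrow> (u', v') \<in> L \<Longrightarrow> (u + u', v + v') \<in> L"
    using pc.subspace_add[OF sub, of "(u, v)" "(u', v')"] by simp
  show "(u, v) \<in> L \<Longrightarrow> (pscale c u, pscale c v) \<in> L"
    using pc.subspace_scale[OF sub, of "(u, v)" c] by (simp add: pc_scale_Pair)
qed

lemma isotropicI:
  assumes "linear_rel X Y L"
    and "\<And>u v u' v'. (u, v) \<in> L \<Longrightarrow> (u', v') \<in> L \<Longrightarrow> symp_form X u u' = symp_form Y v v'"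
  shows "isotropic X Y L"
  unfolding isotropic_def
proof (intro conjI ballI)
  show "L \<subseteq> pcs X \<times> pcs Y" "pc.subspace L" using assms(1) by (auto simp: linear_rel_def)
  fix w w' assume "w \<in> L" "w' \<in> L"
  then show "rel_form X Y w w' = 0"
    using assms(2)[of "fst w" "snd w" "fst w'" "snd w'"] by (simp add: rel_form_def)
qed

lemma isotropicD:
  assumes "isotropic X Y L"
  shows "linear_rel X Y L"
    and "(u, v) \<in> L \<Longrightarrow> (u', v') \<in> L \<Longrightarrow> symp_form X u u' = symp_form Y v v'"
proof -
  show "linear_rel X Y L" using assms by (simp add: isotropic_def linear_rel_def)
  assume "(u, v) \<in> L" "(u', v') \<in> L"
  then have "rel_form X Y (u, v) (u', v') = 0" using assms unfolding isotropic_def by blast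
  then show "symp_form X u u' = symp_form Y v v'" by (simp add: rel_form_def)
qed

text \<open>
  A subspace is Lagrangian iff it equals its own orthogonal complement.  An isotropic extension of \<open>L\<close>
  consists of vectors orthogonal to \<open>L\<close>.
\<close>

lemma lagrangianI:
  assumes lin: "linear_rel X Y L"
    and iso: "\<And>u v u' v'. (u, v) \<in> L \<Longrightarrow> (u', v') \<in> L \<Longrightarrow> symp_form X u u' = symp_form Y v v'"
    and max: "\<And>u v. u \<in> pcs X \<Longrightarrow> v \<in> pcs Y \<Longrightarrow> (\<And>u' v'. (u', v') \<in> L \<Longrightarrow> symp_form X u u' = symp_form Y v v')
      \<Longrightarrow> (u, v) \<in> L"
  shows "lagrangian X Y L"
proof -
  have "L' \<subseteq> L" if L': "isotropic X Y L'" "L \<subseteq> L'" for L'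
  proof (rule subrelI)
    fix u v assume uv: "(u, v) \<in> L'"
    show "(u, v) \<in> L"
    proof (rule max)
      show "u \<in> pcs X" "v \<in> pcs Y" using linear_relD[OF isotropicD(1)[OF L'(1)]] uv by blast+
      show "symp_form X u u' = symp_form Y v v'" if "(u', v') \<in> L" for u' v'
        using isotropicD(2)[OF L'(1)] uv that L'(2) by blast
    qed
  qed
  with isotropicI[OF lin iso] show ?thesis unfolding lagrangian_def by blast
qed

text \<open>
  Conversely, as the form is alternating, an isotropic \<open>L\<close> stays isotropic when a vector orthogonal to it
  is adjoined.
\<close>

lemma lagrangianD:
  assumes lag: "lagrangian X Y L"
  shows "linear_rel X Y L"
    and "(u, v) \<in> L \<Longrightarrow> (u', v') \<in> L \<Longrightarrow> symp_form X u u' = symp_form Y v v'"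
    and "u \<in> pcs X \<Longrightarrow> v \<in> pcs Y \<Longrightarrow> (\<And>u' v'. (u', v') \<in> L \<Longrightarrow> symp_form X u u' = symp_form Y v v')
      \<Longrightarrow> (u, v) \<in> L"
proof -
  have iso: "isotropic X Y L" using lag by (simp add: lagrangian_def)
  note lin = isotropicD(1)[OF iso] and orth = isotropicD(2)[OF iso]
  show "linear_rel X Y L" by (fact lin)
  show "(u, v) \<in> L \<Longrightarrow> (u', v') \<in> L \<Longrightarrow> symp_form X u u' = symp_form Y v v'" by (fact orth)
  assume uv: "u \<in> pcs X" "v \<in> pcs Y"
    and perp: "\<And>u' v'. (u', v') \<in> L \<Longrightarrow> symp_form X u u' = symp_form Y v v'"
  (* the extension of L by the vector (u, v) *)
  let ?L = "{(u' + pscale c u, v' + pscale c v) | u' v' c. (u', v') \<in> L}"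
  have perp': "symp_form X u' u = symp_form Y v' v" if "(u', v') \<in> L" for u' v'
    using perp[OF that] symp_form_antisym[of X u u'] symp_form_antisym[of Y v v'] by simp
  have "isotropic X Y ?L"
  proof (rule isotropicI[OF linear_relI])
    fix a b assume "(a, b) \<in> ?L"
    then show "a \<in> pcs X \<and> b \<in> pcs Y" using linear_relD(1,2)[OF lin] uv by auto
  next
    have "(0 + pscale 0 u, 0 + pscale 0 v) \<in> ?L" using linear_relD(3)[OF lin] by blast
    then show "(0, 0) \<in> ?L" by (simp only: pscale_0 add_0_left)
  next
    fix a b a' b' assume "(a, b) \<in> ?L" "(a', b') \<in> ?L"
    then obtain p q c p' q' c' where *: "(p, q) \<in> L" "(p', q') \<in> L"
      "a = p + pscale c u" "b = q + pscale c v" "a' = p' + pscale c' u" "b' = q' + pscale c' v" by blast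
    have "(p + p', q + q') \<in> L" using linear_relD(4)[OF lin] * by blast
    moreover have "a + a' = (p + p') + pscale (c + c') u" "b + b' = (q + q') + pscale (c + c') v"
      by (simp_all add: * pscale_def prod_eq_iff fun_eq_iff algebra_simps)
    ultimately show "(a + a', b + b') \<in> ?L" by blast
    show "symp_form X a a' = symp_form Y b b'"
      using perp perp' orth * by (simp add: symp_form_simps symp_form_pscale symp_form_self)
  next
    fix t a b assume "(a, b) \<in> ?L"
    then obtain p q c where *: "(p, q) \<in> L" "a = p + pscale c u" "b = q + pscale c v" by blast
    have "(pscale t p, pscale t q) \<in> L" using linear_relD(5)[OF lin] * by blast
    moreover have "pscale t a = pscale t p + pscale (t * c) u" "pscale t b = pscale t q + pscale (t * c) v"
      by (simp_all add: * pscale_def prod_eq_iff fun_eq_iff algebra_simps)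
    ultimately show "(pscale t a, pscale t b) \<in> ?L" by blast
  qed
  moreover have "L \<subseteq> ?L"
  proof (rule subrelI)
    fix a b assume "(a, b) \<in> L"
    then have "(a + pscale 0 u, b + pscale 0 v) \<in> ?L" by blast
    then show "(a, b) \<in> ?L" by (simp only: pscale_0 add_0_right)
  qed
  ultimately have "?L = L" using lag unfolding lagrangian_def by blast
  moreover have "(0 + pscale 1 u, 0 + pscale 1 v) \<in> ?L" using linear_relD(3)[OF lin] by blast
  ultimately show "(u, v) \<in> L" by (simp only: pscale_1 add_0_left)
qed

lemma linear_rel_comp:
  assumes R: "linear_rel X Y R" and S: "linear_rel Y Z S"
  shows "linear_rel X Z (R O S)"
proof (rule linear_relI)
  show "(0, 0) \<in> R O S" using linear_relD(3)[OF R] linear_relD(3)[OF S] by blast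
next
  fix u w assume "(u, w) \<in> R O S"
  then show "u \<in> pcs X \<and> w \<in> pcs Z" using linear_relD(1)[OF R] linear_relD(2)[OF S] by blast
next
  fix u w u' w' assume "(u, w) \<in> R O S" "(u', w') \<in> R O S"
  then obtain v v' where "(u, v) \<in> R" "(v, w) \<in> S" "(u', v') \<in> R" "(v', w') \<in> S" by blast
  then show "(u + u', w + w') \<in> R O S"
    using linear_relD(4)[OF R] linear_relD(4)[OF S] by blast
next
  fix c u w assume "(u, w) \<in> R O S"
  then show "(pscale c u, pscale c w) \<in> R O S"
    using linear_relD(5)[OF R] linear_relD(5)[OF S] by blast
qed

lemma vsum_simps [simp]:
  "vsum f g (InL x) = f x" "vsum f g (InR y) = g y" "vsum f g (Atom a) = 0" "vsum f g (Coll s) = 0"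
  by (simp_all add: vsum_def)

text \<open>
  If \<open>(u, w)\<close> is orthogonal to the composite, an intermediate \<open>v\<close> has to be found such that \<open>(u, v)\<close> is
  orthogonal to \<open>R\<close> and \<open>(v, w)\<close> to \<open>S\<close>.  These are linear conditions on \<open>v\<close>.  A combination of them
  in which \<open>v\<close> cancels comes from elements of \<open>R\<close> and \<open>S\<close> with the same middle component, that is from an
  element of the composite, so the conditions are consistent.
\<close>

lemma lagrangian_comp:
  fixes R :: "('a, 'f::field) pc rel"
  assumes Y: "finite Y" and R: "lagrangian X Y R" and S: "lagrangian Y Z S"
  shows "lagrangian X Z (R O S)"
proof (rule lagrangianI)
  show "linear_rel X Z (R O S)"
    by (rule linear_rel_comp[OF lagrangianD(1)[OF R] lagrangianD(1)[OF S]])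
next
  fix u w u' w' assume "(u, w) \<in> R O S" "(u', w') \<in> R O S"
  then obtain v v' where v: "(u, v) \<in> R" "(v, w) \<in> S" "(u', v') \<in> R" "(v', w') \<in> S" by blast
  show "symp_form X u u' = symp_form Z w w'"
    using lagrangianD(2)[OF R v(1,3)] lagrangianD(2)[OF S v(2,4)] by simp
next
  fix u :: "('a, 'f) pc" and w :: "('a, 'f) pc"
  assume uw: "u \<in> pcs X" "w \<in> pcs Z"
    and perp: "\<And>u' w'. (u', w') \<in> R O S \<Longrightarrow> symp_form X u u' = symp_form Z w w'"
  (* symp_form Y v v' is linear in v, with the coefficients code v' on the two copies of Y that index
     the potentials and the currents of v *)
  define code :: "('a, 'f) pc \<Rightarrow> 'a elt \<Rightarrow> 'f" where "code v = vsum (snd v) (- fst v)" for v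
  let ?W = "{(code (v' - v''), symp_form X u u' - symp_form Z w w'') | u' v' v'' w''.
      (u', v') \<in> R \<and> (v'', w'') \<in> S}"
  have linR: "linear_rel X Y R" and linS: "linear_rel Y Z S" using R S by (auto dest: lagrangianD)
  have "\<exists>x. \<forall>(a, c)\<in>?W. (\<Sum>i\<in>Y \<uplus> Y. a i * x i) = c"
  proof (rule linear_system_solvable)
    fix a c a' c' t assume "(a, c) \<in> ?W" "(a', c') \<in> ?W"
    then obtain u1 v1 v2 w2 u1' v1' v2' w2' where
      1: "a = code (v1 - v2)" "c = symp_form X u u1 - symp_form Z w w2" "(u1, v1) \<in> R" "(v2, w2) \<in> S"
      and 2: "a' = code (v1' - v2')" "c' = symp_form X u u1' - symp_form Z w w2'" "(u1', v1') \<in> R" "(v2', w2') \<in> S"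
      by blast
    have "(u1 + pscale t u1', v1 + pscale t v1') \<in> R" "(v2 + pscale t v2', w2 + pscale t w2') \<in> S"
      using linear_relD(4)[OF linR 1(3) linear_relD(5)[OF linR 2(3)]]
        linear_relD(4)[OF linS 1(4) linear_relD(5)[OF linS 2(4)]] by auto
    then have "(code ((v1 + pscale t v1') - (v2 + pscale t v2')),
        symp_form X u (u1 + pscale t u1') - symp_form Z w (w2 + pscale t w2')) \<in> ?W" by blast
    moreover have "a i + t * a' i = code ((v1 + pscale t v1') - (v2 + pscale t v2')) i" for i
      by (cases i) (simp_all add: 1 2 code_def pscale_def algebra_simps)
    then have "(\<lambda>i. a i + t * a' i) = code ((v1 + pscale t v1') - (v2 + pscale t v2'))" by (rule ext)
    moreover have "c + t * c' = symp_form X u (u1 + pscale t u1') - symp_form Z w (w2 + pscale t w2')"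
      by (simp add: 1 2 symp_form_simps symp_form_pscale algebra_simps)
    ultimately show "(\<lambda>i. a i + t * a' i, c + t * c') \<in> ?W" by (simp only:)
  next
    fix a c assume "(a, c) \<in> ?W" and 0: "\<forall>i\<in>Y \<uplus> Y. a i = 0"
    then obtain u' v' v'' w'' where *: "a = code (v' - v'')" "c = symp_form X u u' - symp_form Z w w''"
      "(u', v') \<in> R" "(v'', w'') \<in> S" by blast
    have "v' \<in> pcs Y" "v'' \<in> pcs Y" using linear_relD(2)[OF linR *(3)] linear_relD(1)[OF linS *(4)] by auto
    moreover have "\<forall>y\<in>Y. fst v' y = fst v'' y \<and> snd v' y = snd v'' y"
      using 0 by (simp add: *(1) code_def)
    ultimately have "fst v' y = fst v'' y \<and> snd v' y = snd v'' y" for y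
      by (cases "y \<in> Y") (simp_all add: pcs_def vecs_def mem_Times_iff)
    then have "v' = v''" by (simp add: prod_eq_iff fun_eq_iff)
    with * have "(u', w'') \<in> R O S" by blast
    then show "c = 0" using perp *(2) by (metis diff_self)
  qed (use Y in simp)
  then obtain x where xW: "\<forall>(a, c)\<in>?W. (\<Sum>i\<in>Y \<uplus> Y. a i * x i) = c" ..
  have x: "(\<Sum>i\<in>Y \<uplus> Y. code (v' - v'') i * x i) = symp_form X u u' - symp_form Z w w''"
    if "(u', v') \<in> R" "(v'', w'') \<in> S" for u' v' v'' w''
  proof -
    have "(code (v' - v''), symp_form X u u' - symp_form Z w w'') \<in> ?W" using that by blast
    from bspec[OF xW this] show ?thesis by simp
  qed
  define v where "v = ((\<lambda>y. if y \<in> Y then x (InL y) else 0), (\<lambda>y. if y \<in> Y then x (InR y) else 0))"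
  have code: "(\<Sum>i\<in>Y \<uplus> Y. code v' i * x i) = symp_form Y v v'" for v'
    using Y by (simp add: sum_dsum code_def symp_form_def v_def sum_negf mult.commute)
  have v: "v \<in> pcs Y" by (simp add: v_def pcs_def vecs_def)
  have "(u, v) \<in> R"
  proof (rule lagrangianD(3)[OF R uw(1) v])
    fix u' v' assume "(u', v') \<in> R"
    moreover have "(0, 0) \<in> S" by (rule linear_relD(3)[OF linS])
    ultimately show "symp_form X u u' = symp_form Y v v'"
      using x[of u' v' 0 0] code by (simp add: symp_form_simps)
  qed
  moreover have "(v, w) \<in> S"
  proof (rule lagrangianD(3)[OF S v uw(2)])
    fix v' w' assume "(v', w') \<in> S"
    moreover have "(0, 0) \<in> R" by (rule linear_relD(3)[OF linR])
    ultimately have "symp_form Y v (0 - v') = - symp_form Z w w'"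
      using x[of 0 0 v' w'] code by (simp add: symp_form_simps)
    moreover have "symp_form Y v (0 - v') = - symp_form Y v v'"
      using symp_form_pscale(1)[of Y v "-1" v'] by (simp add: pscale_minus_1)
    ultimately show "symp_form Y v v' = symp_form Z w w'" by simp
  qed
  ultimately show "(u, w) \<in> R O S" by blast
qed

lemma pcsum_inject [simp]: "pcsum u v = pcsum u' v' \<longleftrightarrow> u = u' \<and> v = v'"
proof
  assume "pcsum u v = pcsum u' v'"
  then have eq: "\<And>z. vsum (fst u) (fst v) z = vsum (fst u') (fst v') z"
    "\<And>z. vsum (snd u) (snd v) z = vsum (snd u') (snd v') z" by (simp_all add: pcsum_def fun_eq_iff)
  show "u = u' \<and> v = v'"
    using eq[of "InL _"] eq[of "InR _"] by (simp add: prod_eq_iff fun_eq_iff)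
qed simp

lemma pcsum_add: "pcsum u v + pcsum u' v' = pcsum (u + u') (v + v')"
proof -
  have "vsum a b + vsum c d = vsum (a + c) (b + d)" for a b c d :: "'a elt \<Rightarrow> 'b"
  proof
    fix z show "(vsum a b + vsum c d) z = vsum (a + c) (b + d) z" by (cases z) simp_all
  qed
  then show ?thesis by (simp add: pcsum_def)
qed

lemma pcsum_pscale: "pscale c (pcsum u v) = pcsum (pscale c u) (pscale c v)"
proof -
  have "(\<lambda>z. c * vsum a b z) = vsum (\<lambda>x. c * a x) (\<lambda>x. c * b x)" for a b :: "'a elt \<Rightarrow> 'b"
  proof
    fix z show "c * vsum a b z = vsum (\<lambda>x. c * a x) (\<lambda>x. c * b x) z" by (cases z) simp_all
  qed
  then show ?thesis by (simp add: pcsum_def pscale_def)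
qed

lemma pcsum_zero: "pcsum 0 0 = 0"
proof -
  have "vsum 0 0 = (0 :: 'a elt \<Rightarrow> 'b)"
  proof
    fix z show "vsum 0 0 z = (0 :: 'a elt \<Rightarrow> 'b) z" by (cases z) simp_all
  qed
  then show ?thesis by (simp add: pcsum_def prod_eq_iff)
qed

lemma not_in_dsum [simp]: "Atom a \<notin> X \<uplus> Y" "Coll s \<notin> X \<uplus> Y"
  by (auto simp: dsum_def)

lemma vsum_vecs [simp]: "vsum f g \<in> vecs (X \<uplus> Y) \<longleftrightarrow> f \<in> vecs X \<and> g \<in> vecs Y"
proof
  assume h: "vsum f g \<in> vecs (X \<uplus> Y)"
  have "z \<notin> X \<uplus> Y \<Longrightarrow> vsum f g z = 0" for z using h by (simp add: vecs_def)
  from this[of "InL _"] this[of "InR _"] show "f \<in> vecs X \<and> g \<in> vecs Y" by (simp add: vecs_def)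
next
  assume h: "f \<in> vecs X \<and> g \<in> vecs Y"
  have "z \<notin> X \<uplus> Y \<longrightarrow> vsum f g z = 0" for z using h by (cases z) (simp_all add: vecs_def)
  then show "vsum f g \<in> vecs (X \<uplus> Y)" by (simp add: vecs_def)
qed

lemma pcsum_pcs [simp]: "pcsum u v \<in> pcs (X \<uplus> Y) \<longleftrightarrow> u \<in> pcs X \<and> v \<in> pcs Y"
  by (auto simp: pcsum_def pcs_def mem_Times_iff)

lemma vecs_dsumE:
  assumes "f \<in> vecs (X \<uplus> Y)"
  obtains g h where "g \<in> vecs X" "h \<in> vecs Y" "f = vsum g h"
proof -
  have "f z = vsum (f \<circ> InL) (f \<circ> InR) z" for z
    using assms by (cases z) (simp_all add: vecs_def)
  then have "f = vsum (f \<circ> InL) (f \<circ> InR)" by blast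
  with assms show ?thesis by (metis vsum_vecs that)
qed

lemma pcs_dsumE:
  assumes "w \<in> pcs (X \<uplus> Y)"
  obtains u v where "u \<in> pcs X" "v \<in> pcs Y" "w = pcsum u v"
proof -
  obtain a b where a: "fst w = vsum a b" "a \<in> vecs X" "b \<in> vecs Y"
    using assms by (auto simp: pcs_def mem_Times_iff elim: vecs_dsumE)
  obtain a' b' where b: "snd w = vsum a' b'" "a' \<in> vecs X" "b' \<in> vecs Y"
    using assms by (auto simp: pcs_def mem_Times_iff elim: vecs_dsumE)
  show ?thesis using a b by (intro that[of "(a, a')" "(b, b')"]) (auto simp: pcs_def pcsum_def prod_eq_iff)
qed

lemma symp_form_pcsum:
  "finite X \<Longrightarrow> finite Y \<Longrightarrow>
    symp_form (X \<uplus> Y) (pcsum u v) (pcsum u' v') = symp_form X u u' + symp_form Y v v'"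
  by (simp add: symp_form_def pcsum_def sum_dsum)

lemma tens_rel_iff [simp]: "(pcsum u u', pcsum v v') \<in> tens_rel R S \<longleftrightarrow> (u, v) \<in> R \<and> (u', v') \<in> S"
  unfolding tens_rel_def mem_Collect_eq prod.inject pcsum_inject by blast

lemma tens_relE:
  assumes "(a, b) \<in> tens_rel R S"
  obtains u u' v v' where "a = pcsum u u'" "b = pcsum v v'" "(u, v) \<in> R" "(u', v') \<in> S"
  using assms unfolding tens_rel_def by blast

text \<open>
  The form on a direct sum is the sum of the forms; testing against pairs with one zero component
  separates the two orthogonality conditions.
\<close>

lemma lagrangian_tens:
  fixes R :: "('a, 'f::field) pc rel"
  assumes fin: "finite X" "finite Y" "finite X'" "finite Y'"
    and R: "lagrangian X Y R" and S: "lagrangian X' Y' S"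
  shows "lagrangian (X \<uplus> X') (Y \<uplus> Y') (tens_rel R S)"
proof (rule lagrangianI[OF linear_relI])
  note linR = linear_relD[OF lagrangianD(1)[OF R]] and linS = linear_relD[OF lagrangianD(1)[OF S]]
  have "(pcsum 0 0, pcsum 0 0) \<in> tens_rel R S" unfolding tens_rel_iff using linR(3) linS(3) ..
  then show "(0, 0) \<in> tens_rel R S" by (simp add: pcsum_zero)
  fix a b assume "(a, b) \<in> tens_rel R S"
  then obtain u u' v v' where *: "a = pcsum u u'" "b = pcsum v v'" "(u, v) \<in> R" "(u', v') \<in> S"
    by (rule tens_relE)
  then show "a \<in> pcs (X \<uplus> X') \<and> b \<in> pcs (Y \<uplus> Y')" using linR(1,2) linS(1,2) by simp
  show "(pscale c a, pscale c b) \<in> tens_rel R S" for c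
    unfolding * pcsum_pscale tens_rel_iff using linR(5)[OF *(3)] linS(5)[OF *(4)] ..
  fix a' b' assume "(a', b') \<in> tens_rel R S"
  then obtain p p' q q' where **: "a' = pcsum p p'" "b' = pcsum q q'" "(p, q) \<in> R" "(p', q') \<in> S"
    by (rule tens_relE)
  show "(a + a', b + b') \<in> tens_rel R S"
    unfolding * ** pcsum_add tens_rel_iff using linR(4)[OF *(3) **(3)] linS(4)[OF *(4) **(4)] ..
  show "symp_form (X \<uplus> X') a a' = symp_form (Y \<uplus> Y') b b'"
    using lagrangianD(2)[OF R *(3) **(3)] lagrangianD(2)[OF S *(4) **(4)] fin
    by (simp add: * ** symp_form_pcsum)
next
  fix a b assume ab: "a \<in> pcs (X \<uplus> X')" "b \<in> pcs (Y \<uplus> Y')"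
    and perp: "\<And>a' b'. (a', b') \<in> tens_rel R S \<Longrightarrow> symp_form (X \<uplus> X') a a' = symp_form (Y \<uplus> Y') b b'"
  obtain u u' where a: "u \<in> pcs X" "u' \<in> pcs X'" "a = pcsum u u'" using ab by (auto elim: pcs_dsumE)
  obtain v v' where b: "v \<in> pcs Y" "v' \<in> pcs Y'" "b = pcsum v v'" using ab by (auto elim: pcs_dsumE)
  have 0: "(0, 0) \<in> R" "(0, 0) \<in> S" using linear_relD(3)[OF lagrangianD(1)[OF R]] linear_relD(3)[OF lagrangianD(1)[OF S]] .
  have perp': "symp_form X u p + symp_form X' u' p' = symp_form Y v q + symp_form Y' v' q'"
    if "(p, q) \<in> R" "(p', q') \<in> S" for p q p' q'
    using perp[of "pcsum p p'" "pcsum q q'"] that fin by (simp add: a b symp_form_pcsum)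
  have "(u, v) \<in> R"
    by (rule lagrangianD(3)[OF R a(1) b(1)]) (use perp'[OF _ 0(2)] in \<open>simp add: symp_form_simps\<close>)
  moreover have "(u', v') \<in> S"
    by (rule lagrangianD(3)[OF S a(2) b(2)]) (use perp'[OF 0(1)] in \<open>simp add: symp_form_simps\<close>)
  ultimately show "(a, b) \<in> tens_rel R S" by (simp add: a b)
qed

section \<open>The behavior of a circuit on all its nodes\<close>

text \<open>The polar form of the extended power functional.\<close>

definition energy :: "('a, 'f::field) circuit \<Rightarrow> ('a, 'f) vec \<Rightarrow> ('a, 'f) vec \<Rightarrow> 'f" where
  "energy c \<phi> \<chi> = (\<Sum>e\<in>edges c. 1 / res c e * (\<phi> (tgt c e) - \<phi> (src c e)) * (\<chi> (tgt c e) - \<chi> (src c e)))"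

text \<open>
  Kirchhoff's current law at all nodes at once: taking for \<open>\<chi>\<close> the indicator of a node \<open>n\<close> gives the law
  at \<open>n\<close>.  The weak form avoids sums over fibres of the leg maps and pulls back along gluings.
\<close>

definition balanced ::
  "('a, 'f::field) circuit \<Rightarrow> ('a, 'f) vec \<Rightarrow> ('a, 'f) vec \<Rightarrow> ('a, 'f) vec \<Rightarrow> bool" where
  "balanced c \<phi> \<iota> \<iota>' \<longleftrightarrow> (\<forall>\<chi>. energy c \<phi> \<chi> + (\<Sum>x\<in>inputs c. \<iota> x * \<chi> (inp c x))
     = (\<Sum>y\<in>outputs c. \<iota>' y * \<chi> (outp c y)))"

definition behavior :: "('a, 'f::field) circuit \<Rightarrow> ('a, 'f) pc rel" where
  "behavior c = {(u, v). u \<in> pcs (inputs c) \<and> v \<in> pcs (outputs c) \<and>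
     (\<exists>\<phi>. (\<forall>x\<in>inputs c. fst u x = \<phi> (inp c x)) \<and> (\<forall>y\<in>outputs c. fst v y = \<phi> (outp c y)) \<and>
        balanced c \<phi> (snd u) (snd v))}"

lemma behaviorI:
  assumes "u \<in> pcs (inputs c)" "v \<in> pcs (outputs c)"
    "\<forall>x\<in>inputs c. fst u x = \<phi> (inp c x)" "\<forall>y\<in>outputs c. fst v y = \<phi> (outp c y)"
    "balanced c \<phi> (snd u) (snd v)"
  shows "(u, v) \<in> behavior c"
  using assms unfolding behavior_def by blast

lemma behaviorE:
  assumes "(u, v) \<in> behavior c"
  obtains \<phi> where "u \<in> pcs (inputs c)" "v \<in> pcs (outputs c)"
    "\<forall>x\<in>inputs c. fst u x = \<phi> (inp c x)" "\<forall>y\<in>outputs c. fst v y = \<phi> (outp c y)"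
    "balanced c \<phi> (snd u) (snd v)"
  using assms unfolding behavior_def by blast

lemma open_behaviorE:
  assumes "(u, v) \<in> behavior c" "open_circuit P X Y c"
  obtains \<phi> where "u \<in> pcs X" "v \<in> pcs Y" "\<forall>x\<in>X. fst u x = \<phi> (inp c x)"
    "\<forall>y\<in>Y. fst v y = \<phi> (outp c y)" "balanced c \<phi> (snd u) (snd v)"
  using behaviorE[OF assms(1)] open_circuitD(5,6)[OF assms(2)] by metis

lemma energy_commute: "energy c \<phi> \<chi> = energy c \<chi> \<phi>"
  by (simp add: energy_def algebra_simps)

lemma energy_linear:
  "energy c (\<lambda>n. \<phi> n + t * \<phi>' n) \<chi> = energy c \<phi> \<chi> + t * energy c \<phi>' \<chi>"
  "energy c \<chi> (\<lambda>n. \<phi> n + t * \<phi>' n) = energy c \<chi> \<phi> + t * energy c \<chi> \<phi>'"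
  unfolding energy_def sum_distrib_left sum.distrib[symmetric]
  by (rule sum.cong; simp add: algebra_simps diff_divide_distrib add_divide_distrib)+

lemma energy_zero: "energy c (\<lambda>_. 0) \<chi> = 0" "energy c \<chi> (\<lambda>_. 0) = 0"
  by (simp_all add: energy_def)

lemma energy_cong:
  assumes "open_circuit P X Y c" "\<forall>n\<in>nodes c. \<phi> n = \<phi>' n" "\<forall>n\<in>nodes c. \<chi> n = \<chi>' n"
  shows "energy c \<phi> \<chi> = energy c \<phi>' \<chi>'"
  unfolding energy_def using assms open_circuitD(7,8)[OF assms(1)] by (intro sum.cong) auto

definition point :: "'a elt \<Rightarrow> ('a, 'f::field) vec" where
  "point n m = (if m = n then 1 else 0)"

lemma sum_point: "finite N \<Longrightarrow> (\<Sum>n\<in>N. \<phi> n * point n m) = (if m \<in> N then \<phi> m else 0)"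
  by (simp add: point_def if_distrib cong: if_cong)

lemma sum_point_mult: "finite X \<Longrightarrow> x \<in> X \<Longrightarrow> (\<Sum>z\<in>X. point x z * g z) = g x"
  by (subst sum.remove[of _ x]) (auto simp: point_def)

text \<open>\<open>energy c (point n) \<chi>\<close> is the current that \<open>\<chi>\<close> drives through node \<open>n\<close>.\<close>

lemma energy_point:
  fixes c :: "('a, 'f::field) circuit"
  assumes c: "open_circuit P X Y c"
  shows "(\<Sum>n\<in>nodes c. \<phi> n * energy c (point n) \<chi>) = energy c \<phi> \<chi>"
proof -
  note c = open_circuitD[OF c]
  let ?k = "\<lambda>e. 1 / res c e * (\<chi> (tgt c e) - \<chi> (src c e))"
  have "(\<Sum>n\<in>nodes c. \<phi> n * energy c (point n) \<chi>)
      = (\<Sum>n\<in>nodes c. \<Sum>e\<in>edges c. ?k e * (\<phi> n * point n (tgt c e) - \<phi> n * point n (src c e)))"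
    unfolding energy_def sum_distrib_left
    by (intro sum.cong refl) (simp add: algebra_simps diff_divide_distrib)
  also have "\<dots> = (\<Sum>e\<in>edges c. ?k e * (\<Sum>n\<in>nodes c. \<phi> n * point n (tgt c e) - \<phi> n * point n (src c e)))"
    by (subst sum.swap) (simp add: sum_distrib_left)
  also have "\<dots> = energy c \<phi> \<chi>"
    unfolding energy_def sum_subtractf sum_point[OF c(3)] using c
    by (intro sum.cong) (simp_all add: algebra_simps)
  finally show ?thesis .
qed

text \<open>
  Isotropy is the symmetry of the energy form.  For maximality, a boundary state \<open>(u, v)\<close> orthogonal to
  the behavior needs a potential \<open>\<phi>\<close> on the nodes with the given boundary values and balanced
  currents.  A combination of these equations with weights \<open>\<alpha>\<close> (inputs), \<open>\<beta>\<close> (outputs) and \<open>\<chi>\<close>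
  (balance) in which \<open>\<phi>\<close> cancels says exactly that \<open>\<chi>\<close> is a potential on the circuit with boundary
  currents \<open>\<alpha>\<close> and \<open>-\<beta>\<close>, and then orthogonality makes its right-hand side vanish.
\<close>

lemma lagrangian_behavior:
  fixes c :: "('a, 'f::field) circuit"
  assumes c: "open_circuit P X Y c"
  shows "lagrangian X Y (behavior c)"
proof (rule lagrangianI[OF linear_relI])
  note io = open_circuitD[OF c]
  have "(0, 0) \<in> behavior c"
    by (rule behaviorI[where \<phi> = "\<lambda>_. 0"]) (simp_all add: balanced_def energy_zero)
  then show "(0, 0) \<in> behavior c" .
  fix u v assume uv: "(u, v) \<in> behavior c"
  obtain \<phi> where b: "u \<in> pcs X" "v \<in> pcs Y"
    "\<forall>x\<in>X. fst u x = \<phi> (inp c x)" "\<forall>y\<in>Y. fst v y = \<phi> (outp c y)" "balanced c \<phi> (snd u) (snd v)"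
    by (rule open_behaviorE[OF uv c])
  then show "u \<in> pcs X \<and> v \<in> pcs Y" by blast
  show "(pscale t u, pscale t v) \<in> behavior c" for t
  proof (rule behaviorI)
    have "energy c (\<lambda>n. 0 + t * \<phi> n) \<chi> = t * energy c \<phi> \<chi>" for \<chi>
      unfolding energy_linear by (simp add: energy_zero)
    moreover have "t * energy c \<phi> \<chi> + (\<Sum>x\<in>X. t * snd u x * \<chi> (inp c x)) = (\<Sum>y\<in>Y. t * snd v y * \<chi> (outp c y))" for \<chi>
      using b(5) io by (simp add: balanced_def mult.assoc flip: sum_distrib_left distrib_left)
    ultimately show "balanced c (\<lambda>n. 0 + t * \<phi> n) (snd (pscale t u)) (snd (pscale t v))"
      using io by (simp add: balanced_def pscale_def)
  qed (use b io in \<open>auto simp: pscale_def[of _ u] pscale_def[of _ v] pcs_pscale[unfolded pscale_def]\<close>)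
  fix u' v' assume uv': "(u', v') \<in> behavior c"
  obtain \<phi>' where b': "u' \<in> pcs X" "v' \<in> pcs Y"
    "\<forall>x\<in>X. fst u' x = \<phi>' (inp c x)" "\<forall>y\<in>Y. fst v' y = \<phi>' (outp c y)" "balanced c \<phi>' (snd u') (snd v')"
    by (rule open_behaviorE[OF uv' c])
  show "(u + u', v + v') \<in> behavior c"
  proof (rule behaviorI)
    show "balanced c (\<lambda>n. \<phi> n + 1 * \<phi>' n) (snd (u + u')) (snd (v + v'))"
      unfolding balanced_def
    proof
      fix \<chi>
      have "energy c \<phi> \<chi> + (\<Sum>x\<in>X. snd u x * \<chi> (inp c x)) = (\<Sum>y\<in>Y. snd v y * \<chi> (outp c y))"
        "energy c \<phi>' \<chi> + (\<Sum>x\<in>X. snd u' x * \<chi> (inp c x)) = (\<Sum>y\<in>Y. snd v' y * \<chi> (outp c y))"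
        using b(5) b'(5) io by (simp_all add: balanced_def)
      from this[symmetric] show "energy c (\<lambda>n. \<phi> n + 1 * \<phi>' n) \<chi> + (\<Sum>x\<in>inputs c. snd (u + u') x * \<chi> (inp c x))
          = (\<Sum>y\<in>outputs c. snd (v + v') y * \<chi> (outp c y))"
        unfolding energy_linear by (simp add: io distrib_right sum.distrib)
    qed
  qed (use b b' io in auto)
  have "energy c \<phi> \<phi>' + (\<Sum>x\<in>X. snd u x * fst u' x) = (\<Sum>y\<in>Y. snd v y * fst v' y)"
    "energy c \<phi> \<phi>' + (\<Sum>x\<in>X. snd u' x * fst u x) = (\<Sum>y\<in>Y. snd v' y * fst v y)"
    using b b' io by (simp_all add: balanced_def energy_commute[of c \<phi> \<phi>'])
       (simp add: energy_commute[of c \<phi>' \<phi>])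
  from this[symmetric] show "symp_form X u u' = symp_form Y v v'"
    by (simp add: symp_form_def)
next
  note io = open_circuitD[OF c]
  fix u v assume uv: "u \<in> pcs X" "v \<in> pcs Y"
    and perp: "\<And>u' v'. (u', v') \<in> behavior c \<Longrightarrow> symp_form X u u' = symp_form Y v v'"
  define lhs where "lhs \<alpha> \<beta> \<chi> n = energy c (point n) \<chi> + (\<Sum>x\<in>X. \<alpha> x * point n (inp c x))
      + (\<Sum>y\<in>Y. \<beta> y * point n (outp c y))" for \<alpha> \<beta> \<chi> :: "'a elt \<Rightarrow> 'f" and n
  define rhs where "rhs \<alpha> \<beta> \<chi> = (\<Sum>x\<in>X. \<alpha> x * fst u x) + (\<Sum>y\<in>Y. \<beta> y * fst v y)
      + (\<Sum>y\<in>Y. snd v y * \<chi> (outp c y)) - (\<Sum>x\<in>X. snd u x * \<chi> (inp c x))" for \<alpha> \<beta> \<chi> :: "'a elt \<Rightarrow> 'f"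
  let ?W = "{(lhs \<alpha> \<beta> \<chi>, rhs \<alpha> \<beta> \<chi>) | \<alpha> \<beta> \<chi>. True}"
  have lhs: "(\<Sum>n\<in>nodes c. lhs \<alpha> \<beta> \<chi> n * \<phi> n) = energy c \<phi> \<chi> + (\<Sum>x\<in>X. \<alpha> x * \<phi> (inp c x))
      + (\<Sum>y\<in>Y. \<beta> y * \<phi> (outp c y))" for \<alpha> \<beta> \<chi> \<phi>
  proof -
    have swap: "(\<Sum>n\<in>nodes c. \<phi> n * (\<Sum>z\<in>Z. \<gamma> z * point n (h z))) = (\<Sum>z\<in>Z. \<gamma> z * \<phi> (h z))"
      if "\<forall>z\<in>Z. h z \<in> nodes c" for Z \<gamma> and h :: "'a elt \<Rightarrow> 'a elt"
    proof -
      have "(\<Sum>n\<in>nodes c. \<phi> n * (\<Sum>z\<in>Z. \<gamma> z * point n (h z)))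
          = (\<Sum>z\<in>Z. \<gamma> z * (\<Sum>n\<in>nodes c. \<phi> n * point n (h z)))"
        unfolding sum_distrib_left by (subst sum.swap) (simp add: mult.left_commute)
      then show ?thesis using that by (simp add: sum_point io)
    qed
    have "(\<Sum>n\<in>nodes c. lhs \<alpha> \<beta> \<chi> n * \<phi> n) = (\<Sum>n\<in>nodes c. \<phi> n * energy c (point n) \<chi>)
        + (\<Sum>n\<in>nodes c. \<phi> n * (\<Sum>x\<in>X. \<alpha> x * point n (inp c x)))
        + (\<Sum>n\<in>nodes c. \<phi> n * (\<Sum>y\<in>Y. \<beta> y * point n (outp c y)))"
      by (simp add: lhs_def distrib_left sum.distrib mult.commute)
    then show ?thesis using swap[of X] swap[of Y] io energy_point[OF c] by simp
  qed
  have "\<exists>\<phi>. \<forall>(a, k)\<in>?W. (\<Sum>n\<in>nodes c. a n * \<phi> n) = k"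
  proof (rule linear_system_solvable)
    fix a k a' k' and t :: 'f assume "(a, k) \<in> ?W" "(a', k') \<in> ?W"
    then obtain \<alpha> \<beta> \<chi> \<alpha>' \<beta>' \<chi>' where *: "a = lhs \<alpha> \<beta> \<chi>" "k = rhs \<alpha> \<beta> \<chi>" "a' = lhs \<alpha>' \<beta>' \<chi>'" "k' = rhs \<alpha>' \<beta>' \<chi>'"
      by blast
    let ?L = "\<lambda>f f' x. f x + t * f' x"
    have "a n + t * a' n = lhs (?L \<alpha> \<alpha>') (?L \<beta> \<beta>') (?L \<chi> \<chi>') n" for n
      by (simp add: * lhs_def energy_linear algebra_simps sum.distrib sum_distrib_left)
    then have "(\<lambda>i. a i + t * a' i) = lhs (?L \<alpha> \<alpha>') (?L \<beta> \<beta>') (?L \<chi> \<chi>')" by (rule ext)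
    moreover have "k + t * k' = rhs (?L \<alpha> \<alpha>') (?L \<beta> \<beta>') (?L \<chi> \<chi>')"
      by (simp add: * rhs_def algebra_simps sum.distrib sum_distrib_left)
    ultimately show "(\<lambda>i. a i + t * a' i, k + t * k') \<in> ?W" by blast
  next
    fix a k assume "(a, k) \<in> ?W" and 0: "\<forall>n\<in>nodes c. a n = 0"
    then obtain \<alpha> \<beta> \<chi> where *: "a = lhs \<alpha> \<beta> \<chi>" "k = rhs \<alpha> \<beta> \<chi>" by blast
    let ?u = "(\<lambda>x. if x \<in> X then \<chi> (inp c x) else 0, \<lambda>x. if x \<in> X then \<alpha> x else 0)"
    let ?v = "(\<lambda>y. if y \<in> Y then \<chi> (outp c y) else 0, \<lambda>y. if y \<in> Y then - \<beta> y else 0)"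
    have bal: "energy c \<chi> \<phi> + (\<Sum>x\<in>X. \<alpha> x * \<phi> (inp c x)) = - (\<Sum>y\<in>Y. \<beta> y * \<phi> (outp c y))" for \<phi>
      using lhs[of \<alpha> \<beta> \<chi> \<phi>] 0 by (simp add: * energy_commute[of c \<chi>] eq_neg_iff_add_eq_0)
    have "(?u, ?v) \<in> behavior c"
      by (rule behaviorI[where \<phi> = \<chi>])
        (use bal io in \<open>simp_all add: pcs_def vecs_def balanced_def sum_negf\<close>)
    from perp[OF this] have "(\<Sum>x\<in>X. \<alpha> x * fst u x) - (\<Sum>x\<in>X. snd u x * \<chi> (inp c x))
        = - (\<Sum>y\<in>Y. \<beta> y * fst v y) - (\<Sum>y\<in>Y. snd v y * \<chi> (outp c y))"
      by (simp add: symp_form_def sum_negf)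
    then show "k = 0" by (simp add: * rhs_def algebra_simps eq_neg_iff_add_eq_0)
  qed (use io in simp)
  then obtain \<phi> where \<phi>W: "\<forall>(a, k)\<in>?W. (\<Sum>n\<in>nodes c. a n * \<phi> n) = k" ..
  have \<phi>: "energy c \<phi> \<chi> + (\<Sum>x\<in>X. \<alpha> x * \<phi> (inp c x)) + (\<Sum>y\<in>Y. \<beta> y * \<phi> (outp c y)) = rhs \<alpha> \<beta> \<chi>" for \<alpha> \<beta> \<chi>
  proof -
    have "(lhs \<alpha> \<beta> \<chi>, rhs \<alpha> \<beta> \<chi>) \<in> ?W" by blast
    from bspec[OF \<phi>W this] show ?thesis by (simp add: lhs)
  qed
  show "(u, v) \<in> behavior c"
  proof (rule behaviorI)
    show "\<forall>x\<in>inputs c. fst u x = \<phi> (inp c x)"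
    proof
      fix x assume "x \<in> inputs c"
      then have "x \<in> X" using io by simp
      then show "fst u x = \<phi> (inp c x)"
        using \<phi>[of "\<lambda>_. 0" "point x" "\<lambda>_. 0"] io by (simp add: rhs_def energy_zero sum_point_mult)
    qed
    show "\<forall>y\<in>outputs c. fst v y = \<phi> (outp c y)"
    proof
      fix y assume "y \<in> outputs c"
      then have "y \<in> Y" using io by simp
      then show "fst v y = \<phi> (outp c y)"
        using \<phi>[of "\<lambda>_. 0" "\<lambda>_. 0" "point y"] io by (simp add: rhs_def energy_zero sum_point_mult)
    qed
    show "balanced c \<phi> (snd u) (snd v)"
      using \<phi>[of _ "\<lambda>_. 0" "\<lambda>_. 0"] io by (simp add: rhs_def balanced_def)
  qed (use uv io in simp_all)
qed

text \<open>
  A potential on the composite is a pair of potentials that agree on the shared boundary \<open>Y\<close>, and the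
  energies add.  Balance on the composite does not mention the currents through \<open>Y\<close>.  They are
  found as the solution \<open>\<iota>\<close> of the balance equations of the two parts, with independent test
  potentials \<open>\<chi>\<close> and \<open>\<chi>'\<close>.  If \<open>\<iota>\<close> cancels from such a combination, \<open>\<chi>\<close> and \<open>-\<chi>'\<close> glue to a test
  potential on the composite, whose balance shows that the equations are consistent.
\<close>

lemma behavior_composite:
  fixes c :: "('a, 'f::field) circuit"
  assumes c: "open_circuit P X Y c" and d: "open_circuit P Y Z d" and e: "composite c d e"
  shows "behavior e = behavior c O behavior d"
proof -
  obtain j k l where viae: "composite_via j k l c d e" using e by (rule compositeE)
  note po = composite_viaD(1)[OF viae] and l = composite_viaD(2)[OF viae] and h = composite_viaD(3-)[OF viae]
  note ic = open_circuitD[OF c] and id = open_circuitD[OF d]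
  have E: "energy e \<phi> \<chi> = energy c (\<phi> \<circ> j) (\<chi> \<circ> j) + energy d (\<phi> \<circ> k) (\<chi> \<circ> k)" for \<phi> \<chi> :: "('a, 'f) vec"
    unfolding energy_def sum.reindex_bij_betw[OF l, symmetric] sum_dsum[OF ic(4) id(4)]
    using h(1,2) by (simp add: edge_hom_def)
  show ?thesis
  proof (rule set_eqI, clarify)
    fix u w :: "('a, 'f) pc"
    show "(u, w) \<in> behavior e \<longleftrightarrow> (u, w) \<in> behavior c O behavior d"
    proof
      assume uw: "(u, w) \<in> behavior e"
      obtain \<phi> where b: "u \<in> pcs X" "w \<in> pcs Z" "\<forall>x\<in>X. fst u x = \<phi> (inp e x)"
        "\<forall>z\<in>Z. fst w z = \<phi> (outp e z)" "balanced e \<phi> (snd u) (snd w)"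
        by (rule open_behaviorE[OF uw open_composite[OF c d e]])
      have bal: "energy c (\<phi> \<circ> j) (\<chi> \<circ> j) + energy d (\<phi> \<circ> k) (\<chi> \<circ> k) + (\<Sum>x\<in>X. snd u x * \<chi> (j (inp c x)))
          = (\<Sum>z\<in>Z. snd w z * \<chi> (k (outp d z)))" for \<chi>
        using b(5)[unfolded balanced_def, rule_format, of \<chi>] h ic id by (simp add: E)
      (* the test potentials of the two parts require the current through Y to pair to F and G *)
      define F where "F \<chi> = energy c (\<phi> \<circ> j) \<chi> + (\<Sum>x\<in>X. snd u x * \<chi> (inp c x))" for \<chi>
      define G where "G \<chi> = (\<Sum>z\<in>Z. snd w z * \<chi> (outp d z)) - energy d (\<phi> \<circ> k) \<chi>" for \<chi>
      let ?W = "{(\<lambda>y. \<chi> (outp c y) + \<chi>' (inp d y), F \<chi> + G \<chi>') | \<chi> \<chi>'. True}"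
      have "\<exists>\<iota>. \<forall>(a, t)\<in>?W. (\<Sum>y\<in>Y. a y * \<iota> y) = t"
      proof (rule linear_system_solvable)
        fix a t a' t' s assume "(a, t) \<in> ?W" "(a', t') \<in> ?W"
        then obtain \<chi> \<chi>' \<psi> \<psi>' where *: "a = (\<lambda>y. \<chi> (outp c y) + \<chi>' (inp d y))" "t = F \<chi> + G \<chi>'"
          "a' = (\<lambda>y. \<psi> (outp c y) + \<psi>' (inp d y))" "t' = F \<psi> + G \<psi>'" by blast
        let ?\<chi> = "\<lambda>n. \<chi> n + s * \<psi> n" and ?\<chi>' = "\<lambda>n. \<chi>' n + s * \<psi>' n"
        have "(\<lambda>y. a y + s * a' y) = (\<lambda>y. ?\<chi> (outp c y) + ?\<chi>' (inp d y))"
          by (simp add: * fun_eq_iff algebra_simps)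
        moreover have "t + s * t' = F ?\<chi> + G ?\<chi>'"
          by (simp add: * F_def G_def energy_linear algebra_simps sum.distrib sum_distrib_left)
        ultimately show "(\<lambda>y. a y + s * a' y, t + s * t') \<in> ?W"
          by (intro CollectI exI[of _ ?\<chi>] exI[of _ ?\<chi>'] conjI) auto
      next
        fix a t assume "(a, t) \<in> ?W" and 0: "\<forall>y\<in>Y. a y = 0"
        then obtain \<chi> \<chi>' where *: "a = (\<lambda>y. \<chi> (outp c y) + \<chi>' (inp d y))" "t = F \<chi> + G \<chi>'" by blast
        have "\<chi> (outp c y) = - \<chi>' (inp d y)" if "y \<in> outputs c" for y
          using 0 that ic by (simp add: * eq_neg_iff_add_eq_0)
        then obtain r where r: "\<And>n. n \<in> nodes c \<Longrightarrow> r (j n) = \<chi> n" "\<And>m. m \<in> nodes d \<Longrightarrow> r (k m) = - \<chi>' m"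
          using pushout_universal[OF po, of \<chi> "\<lambda>m. - \<chi>' m"] by metis
        have "energy c (\<phi> \<circ> j) (r \<circ> j) = energy c (\<phi> \<circ> j) \<chi>"
          "energy d (\<phi> \<circ> k) (r \<circ> k) = energy d (\<phi> \<circ> k) (\<lambda>m. 0 + (-1) * \<chi>' m)"
          using r by (auto intro!: energy_cong[OF c] energy_cong[OF d])
        then show "t = 0"
          using bal[of r] r ic id unfolding energy_linear
          by (simp add: *(2) F_def G_def energy_zero sum_negf algebra_simps)
      qed (use ic in simp)
      then obtain \<iota> where \<iota>W: "\<forall>(a, t)\<in>?W. (\<Sum>y\<in>Y. a y * \<iota> y) = t" ..
      have \<iota>: "(\<Sum>y\<in>Y. (\<chi> (outp c y) + \<chi>' (inp d y)) * \<iota> y) = F \<chi> + G \<chi>'" for \<chi> \<chi>'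
      proof -
        have "(\<lambda>y. \<chi> (outp c y) + \<chi>' (inp d y), F \<chi> + G \<chi>') \<in> ?W" by blast
        from bspec[OF \<iota>W this] show ?thesis by simp
      qed
      let ?v = "(\<lambda>y. if y \<in> Y then \<phi> (j (outp c y)) else 0, \<lambda>y. if y \<in> Y then \<iota> y else 0)"
      have FG0: "F (\<lambda>_. 0) = 0" "G (\<lambda>_. 0) = 0" by (simp_all add: F_def G_def energy_zero)
      have v: "?v \<in> pcs Y" by (simp add: pcs_def vecs_def)
      have "(u, ?v) \<in> behavior c"
      proof (rule behaviorI)
        show "balanced c (\<phi> \<circ> j) (snd u) (snd ?v)"
          using \<iota>[of _ "\<lambda>_. 0"] ic by (simp add: balanced_def FG0 F_def mult.commute)
      qed (use b h ic v in simp_all)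
      moreover have "(?v, w) \<in> behavior d"
      proof (rule behaviorI)
        have "(\<Sum>y\<in>Y. \<iota> y * \<chi> (inp d y)) = G \<chi>" for \<chi>
          using \<iota>[of "\<lambda>_. 0" \<chi>] by (simp add: FG0 mult.commute)
        then show "balanced d (\<phi> \<circ> k) (snd ?v) (snd w)"
          using id by (simp add: balanced_def G_def)
      qed (use b h id ic v pushout_maps(3)[OF po] in simp_all)
      ultimately show "(u, w) \<in> behavior c O behavior d" by (rule relcompI)
    next
      assume "(u, w) \<in> behavior c O behavior d"
      then obtain v where v: "(u, v) \<in> behavior c" "(v, w) \<in> behavior d" by blast
      obtain \<phi> where b: "u \<in> pcs X" "v \<in> pcs Y" "\<forall>x\<in>X. fst u x = \<phi> (inp c x)"
        "\<forall>y\<in>Y. fst v y = \<phi> (outp c y)" "balanced c \<phi> (snd u) (snd v)"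
        by (rule open_behaviorE[OF v(1) c])
      obtain \<phi>' where b': "v \<in> pcs Y" "w \<in> pcs Z" "\<forall>x\<in>Y. fst v x = \<phi>' (inp d x)"
        "\<forall>z\<in>Z. fst w z = \<phi>' (outp d z)" "balanced d \<phi>' (snd v) (snd w)"
        by (rule open_behaviorE[OF v(2) d])
      have "\<phi> (outp c y) = \<phi>' (inp d y)" if "y \<in> outputs c" for y
        using b b' that ic by simp
      then obtain r where r: "\<And>n. n \<in> nodes c \<Longrightarrow> r (j n) = \<phi> n" "\<And>m. m \<in> nodes d \<Longrightarrow> r (k m) = \<phi>' m"
        using pushout_universal[OF po, of \<phi> \<phi>'] by metis
      show "(u, w) \<in> behavior e"
      proof (rule behaviorI)
        show "balanced e r (snd u) (snd w)"
          unfolding balanced_def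
        proof
          fix \<chi>
          have r': "energy c (r \<circ> j) (\<chi> \<circ> j) = energy c \<phi> (\<chi> \<circ> j)"
            "energy d (r \<circ> k) (\<chi> \<circ> k) = energy d \<phi>' (\<chi> \<circ> k)"
            using r by (auto intro!: energy_cong[OF c] energy_cong[OF d])
          have "(\<Sum>z\<in>Z. snd w z * \<chi> (k (outp d z)))
              = energy d \<phi>' (\<chi> \<circ> k) + (\<Sum>y\<in>Y. snd v y * \<chi> (k (inp d y)))"
            using b'(5)[unfolded balanced_def, rule_format, of "\<chi> \<circ> k"] id by simp
          also have "(\<Sum>y\<in>Y. snd v y * \<chi> (k (inp d y))) = (\<Sum>y\<in>Y. snd v y * \<chi> (j (outp c y)))"
            using pushout_maps(3)[OF po] ic by (intro sum.cong) auto
          also have "\<dots> = energy c \<phi> (\<chi> \<circ> j) + (\<Sum>x\<in>X. snd u x * \<chi> (j (inp c x)))"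
            using b(5)[unfolded balanced_def, rule_format, of "\<chi> \<circ> j"] ic by simp
          finally show "energy e r \<chi> + (\<Sum>x\<in>inputs e. snd u x * \<chi> (inp e x)) = (\<Sum>y\<in>outputs e. snd w y * \<chi> (outp e y))"
            using h ic id by (simp add: E r' algebra_simps) (simp add: o_def)
        qed
      qed (use b b' h ic id r in simp_all)
    qed
  qed
qed

lemma tens_circuit_ports:
  "inputs (tens_circuit c d) = inputs c \<uplus> inputs d" "outputs (tens_circuit c d) = outputs c \<uplus> outputs d"
  "inp (tens_circuit c d) = dmap (inp c) (inp d)" "outp (tens_circuit c d) = dmap (outp c) (outp d)"
  by (simp_all add: tens_circuit_def)

lemma fst_pcsum: "fst (pcsum u v) = vsum (fst u) (fst v)" and snd_pcsum: "snd (pcsum u v) = vsum (snd u) (snd v)"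
  by (simp_all add: pcsum_def)

text \<open>
  The test potentials on the two summands are independent, so a circuit and its neighbour in a disjoint union
  are balanced separately.
\<close>

lemma behavior_tens:
  fixes c :: "('a, 'f::field) circuit"
  assumes c: "open_circuit P X Y c" and d: "open_circuit P X' Y' d"
  shows "behavior (tens_circuit c d) = tens_rel (behavior c) (behavior d)"
proof -
  note ic = open_circuitD[OF c] and id = open_circuitD[OF d]
  let ?e = "tens_circuit c d"
  have E: "energy ?e \<phi> \<chi> = energy c (\<phi> \<circ> InL) (\<chi> \<circ> InL) + energy d (\<phi> \<circ> InR) (\<chi> \<circ> InR)"
    for \<phi> \<chi> :: "('a, 'f) vec"
    using ic id by (simp add: energy_def tens_circuit_def sum_dsum)
  have bal: "balanced ?e \<phi> (vsum \<iota> \<iota>') (vsum \<kappa> \<kappa>') \<longleftrightarrow>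
      balanced c (\<phi> \<circ> InL) \<iota> \<kappa> \<and> balanced d (\<phi> \<circ> InR) \<iota>' \<kappa>'" for \<phi> \<iota> \<iota>' \<kappa> \<kappa>'
  proof -
    let ?c = "\<lambda>\<chi>. energy c (\<phi> \<circ> InL) \<chi> + (\<Sum>x\<in>X. \<iota> x * \<chi> (inp c x)) - (\<Sum>y\<in>Y. \<kappa> y * \<chi> (outp c y))"
    let ?d = "\<lambda>\<chi>. energy d (\<phi> \<circ> InR) \<chi> + (\<Sum>x\<in>X'. \<iota>' x * \<chi> (inp d x)) - (\<Sum>y\<in>Y'. \<kappa>' y * \<chi> (outp d y))"
    have "balanced ?e \<phi> (vsum \<iota> \<iota>') (vsum \<kappa> \<kappa>') \<longleftrightarrow> (\<forall>\<chi>. ?c (\<chi> \<circ> InL) + ?d (\<chi> \<circ> InR) = 0)"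
    proof -
      have regroup: "a + a' + (b + b') = k + k' \<longleftrightarrow> (a + b - k) + (a' + b' - k') = 0" for a a' b b' k k' :: 'f
        by (subst eq_iff_diff_eq_0) (simp add: algebra_simps)
      show ?thesis
        unfolding balanced_def E regroup[symmetric] using ic id
        by (simp add: tens_circuit_def sum_dsum)
    qed
    also have "\<dots> \<longleftrightarrow> (\<forall>\<chi>. ?c \<chi> = 0) \<and> (\<forall>\<chi>. ?d \<chi> = 0)"
    proof
      assume h: "\<forall>\<chi>. ?c (\<chi> \<circ> InL) + ?d (\<chi> \<circ> InR) = 0"
      have "?c \<chi> = 0" for \<chi>
        using h[rule_format, of "copair \<chi> (\<lambda>_. 0)"] by (simp add: o_def energy_zero)
      moreover have "?d \<chi> = 0" for \<chi>
        using h[rule_format, of "copair (\<lambda>_. 0) \<chi>"] by (simp add: o_def energy_zero)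
      ultimately show "(\<forall>\<chi>. ?c \<chi> = 0) \<and> (\<forall>\<chi>. ?d \<chi> = 0)" by blast
    next
      assume h: "(\<forall>\<chi>. ?c \<chi> = 0) \<and> (\<forall>\<chi>. ?d \<chi> = 0)"
      show "\<forall>\<chi>. ?c (\<chi> \<circ> InL) + ?d (\<chi> \<circ> InR) = 0"
        using h[THEN conjunct1, rule_format] h[THEN conjunct2, rule_format] by (simp only: add_0_left) simp
    qed
    also have "\<dots> \<longleftrightarrow> balanced c (\<phi> \<circ> InL) \<iota> \<kappa> \<and> balanced d (\<phi> \<circ> InR) \<iota>' \<kappa>'"
      using ic id by (simp add: balanced_def)
    finally show ?thesis .
  qed
  show ?thesis
  proof (rule set_eqI, clarify)
    fix a b :: "('a, 'f) pc"
    show "(a, b) \<in> behavior ?e \<longleftrightarrow> (a, b) \<in> tens_rel (behavior c) (behavior d)"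
    proof
      assume mem: "(a, b) \<in> behavior ?e"
      obtain \<phi> where *: "a \<in> pcs (X \<uplus> X')" "b \<in> pcs (Y \<uplus> Y')"
        "\<forall>x\<in>X \<uplus> X'. fst a x = \<phi> (inp ?e x)" "\<forall>y\<in>Y \<uplus> Y'. fst b y = \<phi> (outp ?e y)"
        "balanced ?e \<phi> (snd a) (snd b)"
        by (rule open_behaviorE[OF mem open_tens[OF c d]])
      obtain u u' where a: "u \<in> pcs X" "u' \<in> pcs X'" "a = pcsum u u'" using *(1) by (rule pcs_dsumE)
      obtain v v' where b: "v \<in> pcs Y" "v' \<in> pcs Y'" "b = pcsum v v'" using *(2) by (rule pcs_dsumE)
      have bal': "balanced c (\<phi> \<circ> InL) (snd u) (snd v)" "balanced d (\<phi> \<circ> InR) (snd u') (snd v')"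
        using *(5) bal by (simp_all add: a b pcsum_def)
      have "(u, v) \<in> behavior c"
        by (rule behaviorI[where \<phi> = "\<phi> \<circ> InL"])
          (use a b * ic id bal' in \<open>simp_all add: pcsum_def tens_circuit_def\<close>)
      moreover have "(u', v') \<in> behavior d"
        by (rule behaviorI[where \<phi> = "\<phi> \<circ> InR"])
          (use a b * ic id bal' in \<open>simp_all add: pcsum_def tens_circuit_def\<close>)
      ultimately show "(a, b) \<in> tens_rel (behavior c) (behavior d)" by (simp add: a b)
    next
      assume "(a, b) \<in> tens_rel (behavior c) (behavior d)"
      then obtain u u' v v' where ab: "a = pcsum u u'" "b = pcsum v v'" "(u, v) \<in> behavior c" "(u', v') \<in> behavior d"
        by (rule tens_relE)
      obtain \<phi> where p: "u \<in> pcs X" "v \<in> pcs Y" "\<forall>x\<in>X. fst u x = \<phi> (inp c x)"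
        "\<forall>y\<in>Y. fst v y = \<phi> (outp c y)" "balanced c \<phi> (snd u) (snd v)"
        by (rule open_behaviorE[OF ab(3) c])
      obtain \<phi>' where p': "u' \<in> pcs X'" "v' \<in> pcs Y'" "\<forall>x\<in>X'. fst u' x = \<phi>' (inp d x)"
        "\<forall>y\<in>Y'. fst v' y = \<phi>' (outp d y)" "balanced d \<phi>' (snd u') (snd v')"
        by (rule open_behaviorE[OF ab(4) d])
      have "balanced ?e (copair \<phi> \<phi>') (vsum (snd u) (snd u')) (vsum (snd v) (snd v'))"
        unfolding bal using p(5) p'(5) by (simp add: o_def)
      then show "(a, b) \<in> behavior ?e"
        by (intro behaviorI[where \<phi> = "copair \<phi> \<phi>'"])
          (use p p' ic id in \<open>simp_all add: ab fst_pcsum snd_pcsum tens_circuit_ports\<close>)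
    qed
  qed
qed

section \<open>The hypergraph category of Lagrangian relations\<close>

lemma energy_cospan: "energy (cospan X N Y i j) \<phi> \<chi> = 0"
  by (simp add: energy_def cospan_def)

lemma behavior_cospanI:
  assumes "u \<in> pcs X" "v \<in> pcs Y" "\<forall>x\<in>X. fst u x = \<phi> (i x)" "\<forall>y\<in>Y. fst v y = \<phi> (j y)"
    "\<And>\<chi>. (\<Sum>x\<in>X. snd u x * \<chi> (i x)) = (\<Sum>y\<in>Y. snd v y * \<chi> (j y))"
  shows "(u, v) \<in> behavior (cospan X N Y i j)"
  by (rule behaviorI[where \<phi> = \<phi>])
    (use assms in \<open>simp_all add: balanced_def energy_cospan, simp_all add: cospan_def\<close>)

lemma behavior_cospanE:
  assumes "(u, v) \<in> behavior (cospan X N Y i j)"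
  obtains \<phi> where "u \<in> pcs X" "v \<in> pcs Y" "\<forall>x\<in>X. fst u x = \<phi> (i x)" "\<forall>y\<in>Y. fst v y = \<phi> (j y)"
    "\<And>\<chi>. (\<Sum>x\<in>X. snd u x * \<chi> (i x)) = (\<Sum>y\<in>Y. snd v y * \<chi> (j y))"
proof -
  obtain \<phi> where *: "u \<in> pcs X" "v \<in> pcs Y" "\<forall>x\<in>X. fst u x = \<phi> (i x)" "\<forall>y\<in>Y. fst v y = \<phi> (j y)"
    "balanced (cospan X N Y i j) \<phi> (snd u) (snd v)"
    using behaviorE[OF assms] by (simp add: cospan_def) metis
  from *(5) have "(\<Sum>x\<in>X. snd u x * \<chi> (i x)) = (\<Sum>y\<in>Y. snd v y * \<chi> (j y))" for \<chi>
    unfolding balanced_def energy_cospan by (simp add: cospan_def)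
  with * show ?thesis by (intro that)
qed

lemma behavior_cospan_converse: "(behavior (cospan X N Y i j))\<inverse> = behavior (cospan Y N X j i)"
proof -
  have "(v, u) \<in> behavior (cospan Y N X j i)" if mem: "(u, v) \<in> behavior (cospan X N Y i j)"
    for u v :: "('a, 'b) pc" and X N Y i j
    using mem
  proof (rule behavior_cospanE)
    fix \<phi> assume "u \<in> pcs X" "v \<in> pcs Y" "\<forall>x\<in>X. fst u x = \<phi> (i x)" "\<forall>y\<in>Y. fst v y = \<phi> (j y)"
      "\<And>\<chi>. (\<Sum>x\<in>X. snd u x * \<chi> (i x)) = (\<Sum>y\<in>Y. snd v y * \<chi> (j y))"
    then show "(v, u) \<in> behavior (cospan Y N X j i)" by (intro behavior_cospanI[where \<phi> = \<phi>]) simp_all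
  qed
  then show ?thesis by (intro set_eqI) (metis converse_iff surj_pair)
qed

lemma pcs_eqI:
  assumes "u \<in> pcs X" "v \<in> pcs X" "\<forall>x\<in>X. fst u x = fst v x" "\<forall>x\<in>X. snd u x = snd v x"
  shows "u = v"
proof -
  have "fst u x = fst v x \<and> snd u x = snd v x" for x
    using assms by (cases "x \<in> X") (simp_all add: pcs_def vecs_def mem_Times_iff)
  then show ?thesis by (simp add: prod_eq_iff fun_eq_iff)
qed

lemma sum_mult_point: "finite X \<Longrightarrow> x \<in> X \<Longrightarrow> (\<Sum>z\<in>X. g z * point x z) = g x"
  using sum_point_mult[of X x g] by (simp add: mult.commute)

lemma bij_rel_iff: "(a, b) \<in> bij_rel X Y f \<longleftrightarrow> b \<in> pcs Y \<and> a = (pull X f (fst b), pull X f (snd b))"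
  by (auto simp: bij_rel_def pcs_def)

text \<open>
  Without edges the energy is zero, so the law only says that currents are pushed forward along the two legs
  to the same vector.
\<close>

lemma behavior_bijection:
  assumes fin: "finite X" "finite Y" and f: "bij_betw f X Y"
  shows "behavior (cospan X Y Y f id) = bij_rel X Y f"
proof (rule set_eqI, clarify)
  fix p q r s :: "('a, 'b) vec"
  define u v where "u = (p, q)" and "v = (r, s)"
  have fY: "f x \<in> Y" if "x \<in> X" for x using f that by (auto simp: bij_betw_def)
  have inj: "f z = f x \<longleftrightarrow> z = x" if "x \<in> X" "z \<in> X" for x z
    using f that by (auto simp: bij_betw_def inj_on_def)
  have "(u, v) \<in> behavior (cospan X Y Y f id) \<longleftrightarrow> (u, v) \<in> bij_rel X Y f"
  proof
    assume "(u, v) \<in> behavior (cospan X Y Y f id)"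
    then obtain \<phi> where *: "u \<in> pcs X" "v \<in> pcs Y" "\<forall>x\<in>X. fst u x = \<phi> (f x)" "\<forall>y\<in>Y. fst v y = \<phi> (id y)"
      "\<And>\<chi>. (\<Sum>x\<in>X. snd u x * \<chi> (f x)) = (\<Sum>y\<in>Y. snd v y * \<chi> (id y))"
      by (rule behavior_cospanE) blast
    have cur: "snd u x = snd v (f x)" if "x \<in> X" for x
    proof -
      have "(\<Sum>z\<in>X. snd u z * point (f x) (f z)) = (\<Sum>z\<in>X. snd u z * point x z)"
        using inj that by (intro sum.cong) (simp_all add: point_def)
      then show ?thesis
        using *(5)[of "point (f x)"] fin fY[OF that] that by (simp add: sum_mult_point)
    qed
    have "u = (pull X f (fst v), pull X f (snd v))"
      by (rule pcs_eqI[OF *(1)]) (use * fY cur in \<open>simp_all add: pull_def pcs_def vecs_def\<close>)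
    with * show "(u, v) \<in> bij_rel X Y f" by (simp add: bij_rel_iff)
  next
    assume "(u, v) \<in> bij_rel X Y f"
    then have *: "v \<in> pcs Y" "u = (pull X f (fst v), pull X f (snd v))" by (simp_all add: bij_rel_iff)
    show "(u, v) \<in> behavior (cospan X Y Y f id)"
    proof (rule behavior_cospanI[where \<phi> = "fst v"])
      fix \<chi>
      have "(\<Sum>x\<in>X. snd u x * \<chi> (f x)) = (\<Sum>x\<in>X. snd v (f x) * \<chi> (f x))"
        by (rule sum.cong) (simp_all add: * pull_def)
      also have "\<dots> = (\<Sum>y\<in>Y. snd v y * \<chi> (id y))"
        using sum.reindex_bij_betw[OF f, of "\<lambda>y. snd v y * \<chi> y"] by simp
      finally show "(\<Sum>x\<in>X. snd u x * \<chi> (f x)) = (\<Sum>y\<in>Y. snd v y * \<chi> (id y))" .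
    qed (use * in \<open>simp_all add: pull_def pcs_def vecs_def\<close>)
  qed
  then show "((p, q), r, s) \<in> behavior (cospan X Y Y f id) \<longleftrightarrow> ((p, q), r, s) \<in> bij_rel X Y f"
    by (simp add: u_def v_def)
qed

lemma behavior_id: "finite X \<Longrightarrow> behavior (cospan X X X id id) = Id_on (pcs X)"
proof -
  assume "finite X"
  then have "behavior (cospan X X X id id) = bij_rel X X id" by (intro behavior_bijection) auto
  moreover have "pull X id w = w" if "w \<in> vecs X" for w :: "('a, 'b) vec"
    using that by (auto simp: pull_def vecs_def)
  ultimately show ?thesis by (auto simp: bij_rel_def pcs_def)
qed

lemma behavior_mu:
  assumes fin: "finite X"
  shows "behavior (cospan (X \<uplus> X) X X fold_map id) = lag_mu X"
proof (rule set_eqI, clarify)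
  fix p q r s :: "('a, 'b) vec"
  show "((p, q), r, s) \<in> behavior (cospan (X \<uplus> X) X X fold_map id) \<longleftrightarrow> ((p, q), r, s) \<in> lag_mu X"
  proof
    assume "((p, q), r, s) \<in> behavior (cospan (X \<uplus> X) X X fold_map id)"
    then obtain \<phi> where *: "(p, q) \<in> pcs (X \<uplus> X)" "(r, s) \<in> pcs X" "\<forall>x\<in>X \<uplus> X. p x = \<phi> (fold_map x)"
      "\<forall>y\<in>X. r y = \<phi> y" "\<And>\<chi>. (\<Sum>x\<in>X \<uplus> X. q x * \<chi> (fold_map x)) = (\<Sum>y\<in>X. s y * \<chi> y)"
      by (rule behavior_cospanE) (simp del: ball_dsum, blast)
    obtain p1 p2 where p: "p = vsum p1 p2" "p1 \<in> vecs X" "p2 \<in> vecs X"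
      using * by (auto simp: pcs_def elim: vecs_dsumE)
    obtain q1 q2 where q: "q = vsum q1 q2" "q1 \<in> vecs X" "q2 \<in> vecs X"
      using * by (auto simp: pcs_def elim: vecs_dsumE)
    have rs: "r \<in> vecs X" "s \<in> vecs X" using * by (simp_all add: pcs_def)
    have "p1 z = r z \<and> p2 z = r z" for z
      using * p rs by (cases "z \<in> X") (simp_all add: vecs_def)
    moreover have "s z = (q1 + q2) z" for z
    proof (cases "z \<in> X")
      case True
      then show ?thesis using *(5)[of "point z"] fin by (simp add: sum_dsum q sum_mult_point)
    next
      case False
      then show ?thesis using q rs by (simp add: vecs_def)
    qed
    ultimately have "p = vsum r r" "s = q1 + q2" unfolding p fun_eq_iff by presburger+
    then show "((p, q), r, s) \<in> lag_mu X" using q rs unfolding lag_mu_def by blast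
  next
    assume "((p, q), r, s) \<in> lag_mu X"
    then obtain q1 q2 where *: "p = vsum r r" "q = vsum q1 q2" "s = q1 + q2"
      "r \<in> vecs X" "q1 \<in> vecs X" "q2 \<in> vecs X" unfolding lag_mu_def by blast
    have "q1 + q2 \<in> vecs X" using * by (simp add: vecs_def)
    with * fin show "((p, q), r, s) \<in> behavior (cospan (X \<uplus> X) X X fold_map id)"
      by (intro behavior_cospanI[where \<phi> = r])
        (simp_all add: pcs_def sum_dsum distrib_right sum.distrib)
  qed
qed

lemma behavior_eta:
  assumes fin: "finite X"
  shows "behavior (cospan {} X X id id) = lag_eta X"
proof (rule set_eqI, clarify)
  fix p q r s :: "('a, 'b) vec"
  show "((p, q), r, s) \<in> behavior (cospan {} X X id id) \<longleftrightarrow> ((p, q), r, s) \<in> lag_eta X"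
  proof
    assume "((p, q), r, s) \<in> behavior (cospan {} X X id id)"
    then obtain \<phi> where *: "(p, q) \<in> pcs {}" "(r, s) \<in> pcs X"
      "\<And>\<chi>. 0 = (\<Sum>y\<in>X. s y * \<chi> y)"
      by (rule behavior_cospanE) simp
    have "s z = 0" for z
      using *(2) *(3)[of "point z"] fin by (cases "z \<in> X") (simp_all add: sum_mult_point pcs_def vecs_def)
    with * show "((p, q), r, s) \<in> lag_eta X"
      by (auto simp: lag_eta_def pcs_def vecs_def)
  next
    assume "((p, q), r, s) \<in> lag_eta X"
    then show "((p, q), r, s) \<in> behavior (cospan {} X X id id)"
      by (intro behavior_cospanI[where \<phi> = r]) (auto simp: lag_eta_def pcs_def vecs_def)
  qed
qed

lemma pull_assoc:
  assumes "p \<in> vecs X" "q \<in> vecs Y" "r \<in> vecs Z"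
  shows "pull ((X \<uplus> Y) \<uplus> Z) assoc_map (vsum p (vsum q r)) = vsum (vsum p q) r"
proof
  fix z show "pull ((X \<uplus> Y) \<uplus> Z) assoc_map (vsum p (vsum q r)) z = vsum (vsum p q) r z"
  proof (cases z)
    case (InL z')
    then show ?thesis using assms by (cases z') (simp_all add: pull_def vecs_def)
  qed (use assms in \<open>simp_all add: pull_def vecs_def\<close>)
qed

lemma pull_swap:
  assumes "p \<in> vecs X" "q \<in> vecs Y"
  shows "pull (X \<uplus> Y) swap_map (vsum q p) = vsum p q"
proof
  fix z show "pull (X \<uplus> Y) swap_map (vsum q p) z = vsum p q z"
    using assms by (cases z) (simp_all add: pull_def vecs_def)
qed

lemma pull_fold:
  assumes "p \<in> vecs X"
  shows "pull ({} \<uplus> X) fold_map p = vsum 0 p" "pull (X \<uplus> {}) fold_map p = vsum p 0"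
proof -
  show "pull ({} \<uplus> X) fold_map p = vsum 0 p"
  proof
    fix z show "pull ({} \<uplus> X) fold_map p z = vsum 0 p z"
      using assms by (cases z) (simp_all add: pull_def vecs_def)
  qed
  show "pull (X \<uplus> {}) fold_map p = vsum p 0"
  proof
    fix z show "pull (X \<uplus> {}) fold_map p z = vsum p 0 z"
      using assms by (cases z) (simp_all add: pull_def vecs_def)
  qed
qed

lemma bij_rel_parametrized:
  assumes "pcs Y = \<beta> ` A" "\<And>p. p \<in> A \<Longrightarrow> (pull X f (fst (\<beta> p)), pull X f (snd (\<beta> p))) = \<alpha> p"
  shows "bij_rel X Y f = {(\<alpha> p, \<beta> p) | p. p \<in> A}"
proof (rule set_eqI)
  fix ab :: "('a, 'b) pc \<times> ('a, 'b) pc"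
  obtain a b where ab: "ab = (a, b)" by (rule prod.exhaust)
  have "ab \<in> bij_rel X Y f \<longleftrightarrow> (\<exists>p\<in>A. b = \<beta> p \<and> a = (pull X f (fst b), pull X f (snd b)))"
    unfolding ab bij_rel_iff assms(1) by blast
  also have "\<dots> \<longleftrightarrow> (\<exists>p\<in>A. b = \<beta> p \<and> a = \<alpha> p)"
    using assms(2) by (intro bex_cong refl) auto
  finally show "ab \<in> bij_rel X Y f \<longleftrightarrow> ab \<in> {(\<alpha> p, \<beta> p) | p. p \<in> A}"
    unfolding ab by blast
qed

lemma pcs_dsum: "pcs (X \<uplus> Y) = (\<lambda>(u, v). pcsum u v) ` (pcs X \<times> pcs Y)"
proof (intro equalityI subsetI)
  fix w :: "('a, 'b) pc" assume "w \<in> pcs (X \<uplus> Y)"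
  then obtain u v where "u \<in> pcs X" "v \<in> pcs Y" "w = pcsum u v" by (rule pcs_dsumE)
  then show "w \<in> (\<lambda>(u, v). pcsum u v) ` (pcs X \<times> pcs Y)" by (intro image_eqI[of _ _ "(u, v)"]) simp_all
qed auto

abbreviation tuple_left where "tuple_left \<equiv> \<lambda>(u, v, w). pcsum (pcsum u v) w"
abbreviation tuple_right where "tuple_right \<equiv> \<lambda>(u, v, w). pcsum u (pcsum v w)"

lemma bij_rel_assoc:
  "bij_rel ((X \<uplus> Y) \<uplus> Z) (X \<uplus> (Y \<uplus> Z)) assoc_map =
     {(tuple_left p, tuple_right p) | p. p \<in> pcs X \<times> pcs Y \<times> pcs Z}"
proof (rule bij_rel_parametrized)
  show "pcs (X \<uplus> (Y \<uplus> Z)) = tuple_right ` (pcs X \<times> pcs Y \<times> pcs Z)"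
    unfolding pcs_dsum by force
next
  fix p :: "('a, 'b) pc \<times> ('a, 'b) pc \<times> ('a, 'b) pc"
  assume p: "p \<in> pcs X \<times> pcs Y \<times> pcs Z"
  obtain u v w where uvw: "p = (u, v, w)" by (rule prod_cases3)
  show "(pull ((X \<uplus> Y) \<uplus> Z) assoc_map (fst (tuple_right p)),
      pull ((X \<uplus> Y) \<uplus> Z) assoc_map (snd (tuple_right p))) = tuple_left p"
    using p by (simp add: uvw fst_pcsum snd_pcsum pull_assoc pcs_def mem_Times_iff) (simp add: pcsum_def)
qed

lemma bij_rel_swap:
  "bij_rel (X \<uplus> Y) (Y \<uplus> X) swap_map =
     {((\<lambda>(u, v). pcsum u v) p, (\<lambda>(u, v). pcsum v u) p) | p. p \<in> pcs X \<times> pcs Y}"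
proof (rule bij_rel_parametrized)
  show "pcs (Y \<uplus> X) = (\<lambda>(u, v). pcsum v u) ` (pcs X \<times> pcs Y)"
    unfolding pcs_dsum by force
next
  fix p :: "('a, 'b) pc \<times> ('a, 'b) pc"
  assume p: "p \<in> pcs X \<times> pcs Y"
  obtain u v where uv: "p = (u, v)" by (rule prod.exhaust)
  show "(pull (X \<uplus> Y) swap_map (fst ((\<lambda>(u, v). pcsum v u) p)),
      pull (X \<uplus> Y) swap_map (snd ((\<lambda>(u, v). pcsum v u) p))) = (\<lambda>(u, v). pcsum u v) p"
    using p by (simp add: uv fst_pcsum snd_pcsum pull_swap pcs_def mem_Times_iff) (simp add: pcsum_def)
qed

lemma bij_rel_fold:
  "bij_rel ({} \<uplus> X) X fold_map = {(pcsum 0 u, u) | u. u \<in> pcs X}"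
  "bij_rel (X \<uplus> {}) X fold_map = {(pcsum u 0, u) | u. u \<in> pcs X}"
  by (auto simp: bij_rel_def pcs_def pull_fold pcsum_def)

lemma pcs_empty: "pcs {} = {0}"
  by (auto simp: pcs_def vecs_def zero_prod_def zero_fun_def fun_eq_iff)

lemma tens_rel_comp: "tens_rel (R O S) (R' O S') = tens_rel R R' O tens_rel S S'"
proof (rule set_eqI)
  fix ab :: "('a, 'b) pc \<times> ('a, 'b) pc"
  obtain a b where ab: "ab = (a, b)" by (rule prod.exhaust)
  show "ab \<in> tens_rel (R O S) (R' O S') \<longleftrightarrow> ab \<in> tens_rel R R' O tens_rel S S'"
  proof
    assume "ab \<in> tens_rel (R O S) (R' O S')"
    then obtain u u' w w' where *: "a = pcsum u u'" "b = pcsum w w'" "(u, w) \<in> R O S" "(u', w') \<in> R' O S'"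
      unfolding ab by (rule tens_relE)
    then obtain v v' where "(u, v) \<in> R" "(v, w) \<in> S" "(u', v') \<in> R'" "(v', w') \<in> S'" by blast
    then have "(a, pcsum v v') \<in> tens_rel R R'" "(pcsum v v', b) \<in> tens_rel S S'" by (simp_all add: *)
    then show "ab \<in> tens_rel R R' O tens_rel S S'" unfolding ab by (rule relcompI)
  next
    assume "ab \<in> tens_rel R R' O tens_rel S S'"
    then obtain c where c: "(a, c) \<in> tens_rel R R'" "(c, b) \<in> tens_rel S S'" unfolding ab by blast
    obtain u u' v v' where 1: "a = pcsum u u'" "c = pcsum v v'" "(u, v) \<in> R" "(u', v') \<in> R'"
      using c(1) by (rule tens_relE)
    obtain v1 v1' w w' where 2: "c = pcsum v1 v1'" "b = pcsum w w'" "(v1, w) \<in> S" "(v1', w') \<in> S'"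
      using c(2) by (rule tens_relE)
    have "v1 = v" "v1' = v'" using 1(2) 2(1) by simp_all
    with 1 2 have "(u, w) \<in> R O S" "(u', w') \<in> R' O S'" by blast+
    then show "ab \<in> tens_rel (R O S) (R' O S')" by (simp add: ab 1(1) 2(2))
  qed
qed

text \<open>
  The common shape of the naturality squares: all four sides are described by parameters \<open>p\<close> and \<open>q\<close>,
  which the injective maps recover from the intermediate state.
\<close>

lemma natural_square:
  assumes inj: "inj \<beta>" "inj \<alpha>'" and G: "G \<subseteq> A \<times> B"
  shows "{(\<alpha> p, \<beta> q) | p q. (p, q) \<in> G} O {(\<beta> q, \<beta>' q) | q. q \<in> B}
    = {(\<alpha> p, \<alpha>' p) | p. p \<in> A} O {(\<alpha>' p, \<beta>' q) | p q. (p, q) \<in> G}"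
proof (intro equalityI subrelI)
  fix a c assume "(a, c) \<in> {(\<alpha> p, \<beta> q) | p q. (p, q) \<in> G} O {(\<beta> q, \<beta>' q) | q. q \<in> B}"
  then obtain p q where "(p, q) \<in> G" "a = \<alpha> p" "c = \<beta>' q" using injD[OF inj(1)] by blast
  then show "(a, c) \<in> {(\<alpha> p, \<alpha>' p) | p. p \<in> A} O {(\<alpha>' p, \<beta>' q) | p q. (p, q) \<in> G}" using G by blast
next
  fix a c assume "(a, c) \<in> {(\<alpha> p, \<alpha>' p) | p. p \<in> A} O {(\<alpha>' p, \<beta>' q) | p q. (p, q) \<in> G}"
  then obtain p q where "(p, q) \<in> G" "a = \<alpha> p" "c = \<beta>' q" using injD[OF inj(2)] by blast
  then show "(a, c) \<in> {(\<alpha> p, \<beta> q) | p q. (p, q) \<in> G} O {(\<beta> q, \<beta>' q) | q. q \<in> B}" using G by blast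
qed

lemma assoc_rel_natural:
  assumes "R \<subseteq> pcs X \<times> pcs X'" "S \<subseteq> pcs Y \<times> pcs Y'" "T \<subseteq> pcs Z \<times> pcs Z'"
  shows "tens_rel (tens_rel R S) T O bij_rel ((X' \<uplus> Y') \<uplus> Z') (X' \<uplus> (Y' \<uplus> Z')) assoc_map
    = bij_rel ((X \<uplus> Y) \<uplus> Z) (X \<uplus> (Y \<uplus> Z)) assoc_map O tens_rel R (tens_rel S T)"
proof -
  let ?G = "{((u, v, w), (u', v', w')) | u v w u' v' w'. (u, u') \<in> R \<and> (v, v') \<in> S \<and> (w, w') \<in> T}"
  have tens: "tens_rel (tens_rel R S) T = {(tuple_left p, tuple_left q) | p q. (p, q) \<in> ?G}"
    "tens_rel R (tens_rel S T) = {(tuple_right p, tuple_right q) | p q. (p, q) \<in> ?G}"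
    unfolding tens_rel_def by fastforce+
  have inj: "inj tuple_left" "inj tuple_right" by (auto simp: inj_on_def)
  have G: "?G \<subseteq> (pcs X \<times> pcs Y \<times> pcs Z) \<times> (pcs X' \<times> pcs Y' \<times> pcs Z')" using assms by blast
  show ?thesis unfolding bij_rel_assoc tens by (rule natural_square[OF inj G])
qed

lemma swap_rel_natural:
  assumes "R \<subseteq> pcs X \<times> pcs X'" "S \<subseteq> pcs Y \<times> pcs Y'"
  shows "tens_rel R S O bij_rel (X' \<uplus> Y') (Y' \<uplus> X') swap_map
    = bij_rel (X \<uplus> Y) (Y \<uplus> X) swap_map O tens_rel S R"
proof -
  let ?G = "{((u, v), (u', v')) | u v u' v'. (u, u') \<in> R \<and> (v, v') \<in> S}"
  have tens: "tens_rel R S = {((\<lambda>(u, v). pcsum u v) p, (\<lambda>(u, v). pcsum u v) q) | p q. (p, q) \<in> ?G}"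
    "tens_rel S R = {((\<lambda>(u, v). pcsum v u) p, (\<lambda>(u, v). pcsum v u) q) | p q. (p, q) \<in> ?G}"
    unfolding tens_rel_def by fastforce+
  have inj: "inj (\<lambda>(u, v). pcsum u v)" "inj (\<lambda>(u, v). pcsum v u)" by (auto simp: inj_on_def)
  have G: "?G \<subseteq> (pcs X \<times> pcs Y) \<times> (pcs X' \<times> pcs Y')" using assms by blast
  show ?thesis unfolding bij_rel_swap tens by (rule natural_square[OF inj G])
qed

lemma unit_rel_natural:
  assumes "R \<subseteq> pcs X \<times> pcs Y"
  shows "tens_rel (Id_on (pcs {})) R O bij_rel ({} \<uplus> Y) Y fold_map = bij_rel ({} \<uplus> X) X fold_map O R"
    and "tens_rel R (Id_on (pcs {})) O bij_rel (Y \<uplus> {}) Y fold_map = bij_rel (X \<uplus> {}) X fold_map O R"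
proof -
  have tens: "tens_rel (Id_on (pcs {})) R = {(pcsum 0 u, pcsum 0 v) | u v. (u, v) \<in> R}"
    "tens_rel R (Id_on (pcs {})) = {(pcsum u 0, pcsum v 0) | u v. (u, v) \<in> R}"
    unfolding tens_rel_def pcs_empty by blast+
  have R: "{(u, v) | u v. (u, v) \<in> R} = R" by (intro equalityI subrelI) blast+
  have inj: "inj (pcsum 0)" "inj (\<lambda>u. pcsum u 0)" "inj (\<lambda>u. u)" by (auto simp: inj_on_def)
  show "tens_rel (Id_on (pcs {})) R O bij_rel ({} \<uplus> Y) Y fold_map = bij_rel ({} \<uplus> X) X fold_map O R"
    "tens_rel R (Id_on (pcs {})) O bij_rel (Y \<uplus> {}) Y fold_map = bij_rel (X \<uplus> {}) X fold_map O R"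
    unfolding bij_rel_fold tens
    using natural_square[OF inj(1,3) assms, of "pcsum 0" "\<lambda>u. u"]
      natural_square[OF inj(2,3) assms, of "\<lambda>u. pcsum u 0" "\<lambda>u. u"] unfolding R .
qed

lemma lagrangian_subset: "lagrangian X Y R \<Longrightarrow> R \<subseteq> pcs X \<times> pcs Y"
  by (simp add: lagrangian_def isotropic_def)

lemma cat_LagRel: "cat (LagRel :: ('a elt set, ('a, 'f::field) pc rel) hyper_data)"
proof
  fix X :: "'a elt set" assume "X \<in> Obj (LagRel :: ('a elt set, ('a, 'f) pc rel) hyper_data)"
  then have fin: "finite X" by (simp add: LagRel_def)
  have "lagrangian X X (behavior (cospan X X X id id) :: ('a, 'f) pc rel)"
    using fin by (intro lagrangian_behavior[of UNIV] open_cospan) auto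
  then show "cat_data.Id LagRel X \<in> Hom (LagRel :: ('a elt set, ('a, 'f) pc rel) hyper_data) X X"
    using fin by (simp add: LagRel_def behavior_id)
next
  fix X Y Z :: "'a elt set" and R S :: "('a, 'f) pc rel"
  assume "Y \<in> Obj (LagRel :: ('a elt set, ('a, 'f) pc rel) hyper_data)"
    "R \<in> Hom LagRel X Y" "S \<in> Hom LagRel Y Z"
  then show "S \<cdot>\<^bsub>LagRel\<^esub> R \<in> Hom LagRel X Z"
    by (simp add: LagRel_def lagrangian_comp)
next
  fix X Y :: "'a elt set" and R :: "('a, 'f) pc rel"
  assume "R \<in> Hom LagRel X Y"
  then have "R \<subseteq> pcs X \<times> pcs Y" by (simp add: LagRel_def lagrangian_subset)
  then have "Id_on (pcs X) O R = R" "R O Id_on (pcs Y) = R" by blast+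
  then show "R \<cdot>\<^bsub>LagRel\<^esub> cat_data.Id LagRel X = R" "cat_data.Id LagRel Y \<cdot>\<^bsub>LagRel\<^esub> R = R"
    by (simp_all add: LagRel_def)
qed (simp add: LagRel_def O_assoc)

lemma cospan_cat_LagRel:
  "cospan_cat (LagRel :: ('a elt set, ('a, 'f::field) pc rel) hyper_data)
     (\<lambda>X N Y i j. behavior (cospan X N Y i j))"
proof -
  interpret cat "LagRel :: ('a elt set, ('a, 'f) pc rel) hyper_data" by (rule cat_LagRel)
  have bij: "bij_betw assoc_map ((A \<uplus> B) \<uplus> D) (A \<uplus> (B \<uplus> D))" "bij_betw swap_map (A \<uplus> B) (B \<uplus> A)"
    "bij_betw fold_map ({} \<uplus> A) A" "bij_betw fold_map (A \<uplus> {}) A" for A B D :: "'a elt set"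
    by (rule bij_betw_byWitness[where f' = unassoc_map], auto)
      (rule bij_betw_byWitness[where f' = swap_map], auto,
       rule bij_betw_byWitness[where f' = InR], auto,
       rule bij_betw_byWitness[where f' = InL], auto)
  show ?thesis
  proof unfold_locales
    fix X N Y :: "'a elt set" and i j
    assume "finite X" "finite N" "finite Y" "i \<in> X \<rightarrow> N" "j \<in> Y \<rightarrow> N"
    then show "behavior (cospan X N Y i j) \<in> Hom (LagRel :: ('a elt set, ('a, 'f) pc rel) hyper_data) X Y"
      using lagrangian_behavior[OF open_cospan[where P = UNIV]] by (simp add: LagRel_def)
  next
    fix X N Y M Z Q :: "'a elt set" and i j k l p q
    assume *: "finite X" "finite N" "finite Y" "finite M" "finite Z" "i \<in> X \<rightarrow> N" "l \<in> Z \<rightarrow> M"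
      "pushout Y j k N M p q Q"
    have "open_circuit UNIV X Y (cospan X N Y i j :: ('a, 'f) circuit)"
      "open_circuit UNIV Y Z (cospan Y M Z k l :: ('a, 'f) circuit)"
      using * pushout_maps(4,5)[OF *(8)] by (auto intro!: open_cospan)
    from behavior_composite[OF this composite_cospan[OF *(8)]]
    show "behavior (cospan Y M Z k l) \<cdot>\<^bsub>(LagRel :: ('a elt set, ('a, 'f) pc rel) hyper_data)\<^esub> behavior (cospan X N Y i j)
        = behavior (cospan X Q Z (p \<circ> i) (q \<circ> l))" by (simp add: LagRel_def)
  next
    fix X N Y X' N' Y' :: "'a elt set" and i j i' j'
    assume *: "finite X" "finite N" "finite Y" "finite X'" "finite N'" "finite Y'"
        "i \<in> X \<rightarrow> N" "j \<in> Y \<rightarrow> N" "i' \<in> X' \<rightarrow> N'" "j' \<in> Y' \<rightarrow> N'"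
    let ?c = "cospan X N Y i j :: ('a, 'f) circuit" and ?c' = "cospan X' N' Y' i' j' :: ('a, 'f) circuit"
    let ?d = "cospan (X \<uplus> X') (N \<uplus> N') (Y \<uplus> Y') (dmap i i') (dmap j j') :: ('a, 'f) circuit"
    have o: "open_circuit UNIV X Y ?c" "open_circuit UNIV X' Y' ?c'"
      using * by (auto intro!: open_cospan)
    have "energy (tens_circuit ?c ?c') = energy ?d"
      by (simp add: energy_def tens_circuit_def cospan_def fun_eq_iff)
    then have "behavior (tens_circuit ?c ?c') = behavior ?d"
      by (simp add: behavior_def balanced_def) (simp add: tens_circuit_def cospan_def)
    then show "behavior ?c \<otimes>\<^bsub>LagRel\<^esub> behavior ?c' = behavior ?d"
      using behavior_tens[OF o] by (simp add: LagRel_def)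
  next
    fix X Y X' Y' :: "'a elt set" and f f' :: "('a, 'f) pc rel"
    assume "finite X" "finite Y" "finite X'" "finite Y'" "f \<in> Hom LagRel X Y" "f' \<in> Hom LagRel X' Y'"
    then show "f \<otimes>\<^bsub>LagRel\<^esub> f' \<in> Hom LagRel (X \<uplus> X') (Y \<uplus> Y')"
      by (simp add: LagRel_def lagrangian_tens)
  next
    fix X Y Z X' Y' Z' :: "'a elt set" and f g h :: "('a, 'f) pc rel"
    assume "f \<in> Hom LagRel X X'" "g \<in> Hom LagRel Y Y'" "h \<in> Hom LagRel Z Z'"
    then have "f \<subseteq> pcs X \<times> pcs X'" "g \<subseteq> pcs Y \<times> pcs Y'" "h \<subseteq> pcs Z \<times> pcs Z'"
      by (simp_all add: LagRel_def lagrangian_subset)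
    then show "Assoc LagRel X' Y' Z' \<cdot>\<^bsub>LagRel\<^esub> ((f \<otimes>\<^bsub>LagRel\<^esub> g) \<otimes>\<^bsub>LagRel\<^esub> h)
        = (f \<otimes>\<^bsub>LagRel\<^esub> (g \<otimes>\<^bsub>LagRel\<^esub> h)) \<cdot>\<^bsub>LagRel\<^esub> Assoc LagRel X Y Z"
      by (simp add: LagRel_def assoc_rel_natural)
  next
    fix X Y :: "'a elt set" and f :: "('a, 'f) pc rel"
    assume "f \<in> Hom LagRel X Y"
    then have "f \<subseteq> pcs X \<times> pcs Y" by (simp add: LagRel_def lagrangian_subset)
    from unit_rel_natural[OF this]
    show "LUnit LagRel Y \<cdot>\<^bsub>LagRel\<^esub> (cat_data.Id LagRel {} \<otimes>\<^bsub>LagRel\<^esub> f) = f \<cdot>\<^bsub>LagRel\<^esub> LUnit LagRel X"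
      "RUnit LagRel Y \<cdot>\<^bsub>LagRel\<^esub> (f \<otimes>\<^bsub>LagRel\<^esub> cat_data.Id LagRel {}) = f \<cdot>\<^bsub>LagRel\<^esub> RUnit LagRel X"
      by (simp_all add: LagRel_def)
  next
    fix X Y X' Y' :: "'a elt set" and f g :: "('a, 'f) pc rel"
    assume "f \<in> Hom LagRel X X'" "g \<in> Hom LagRel Y Y'"
    then have "f \<subseteq> pcs X \<times> pcs X'" "g \<subseteq> pcs Y \<times> pcs Y'"
      by (simp_all add: LagRel_def lagrangian_subset)
    from swap_rel_natural[OF this]
    show "Symm LagRel X' Y' \<cdot>\<^bsub>LagRel\<^esub> (f \<otimes>\<^bsub>LagRel\<^esub> g) = (g \<otimes>\<^bsub>LagRel\<^esub> f) \<cdot>\<^bsub>LagRel\<^esub> Symm LagRel X Y"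
      by (simp add: LagRel_def)
  next
    fix X :: "'a elt set" assume "finite X"
    then show "Delta (LagRel :: ('a elt set, ('a, 'f) pc rel) hyper_data) X = behavior (cospan X X (X \<uplus> X) id fold_map)"
      "Eps (LagRel :: ('a elt set, ('a, 'f) pc rel) hyper_data) X = behavior (cospan X X {} id id)"
      using behavior_cospan_converse[of "X \<uplus> X" X X fold_map id] behavior_cospan_converse[of "{}" X X id id]
      by (simp_all add: LagRel_def behavior_mu behavior_eta)
  next
    fix X :: "'a elt set" assume "finite X"
    then show "cat_data.Id LagRel X = (behavior (cospan X X X id id) :: ('a, 'f) pc rel)"
      by (simp only: behavior_id) (simp add: LagRel_def)
  qed (simp_all add: LagRel_def tens_rel_comp behavior_mu behavior_eta behavior_bijection bij)
qed

section \<open>The principle of minimum power\<close>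

lemma positive_one: "positive_elements P \<Longrightarrow> 1 \<in> P"
  unfolding positive_elements_def using zero_neq_one by (metis one_power2)

lemma positive_of_nat: "positive_elements P \<Longrightarrow> of_nat (Suc n) \<in> P"
proof (induction n)
  case 0 then show ?case by (simp add: positive_one)
next
  case (Suc n)
  then have "of_nat (Suc n) + 1 \<in> P" using positive_one unfolding positive_elements_def by blast
  then show ?case by (simp add: add.commute)
qed

lemma positive_two:
  fixes P :: "'f::field set"
  assumes "positive_elements P"
  shows "(2 :: 'f) \<noteq> 0"
  using positive_of_nat[OF assms, of 1] assms by (auto simp: positive_elements_def)

text \<open>
  The sums \<open>1 + \<dots> + 1\<close> lie in \<open>P\<close>, so they do not vanish.  Polynomials are therefore determined by their
  values, which makes formal partial derivatives meaningful.
\<close>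

lemma positive_infinite:
  fixes P :: "'f::field set"
  assumes P: "positive_elements P"
  shows "infinite (UNIV :: 'f set)"
proof -
  have "(of_nat m :: 'f) \<noteq> of_nat n" if less: "m < n" for m n
  proof
    assume eq: "(of_nat m :: 'f) = of_nat n"
    obtain k where "n = Suc (m + k)" using less_imp_Suc_add[OF less] by blast
    then have "n = m + Suc k" by simp
    then have "(of_nat n :: 'f) = of_nat m + of_nat (Suc k)" by (simp only: of_nat_add)
    with eq have "(of_nat (Suc k) :: 'f) = 0" by (simp del: of_nat_Suc)
    then show False using positive_of_nat[OF P, of k] P by (simp add: positive_elements_def)
  qed
  then have "inj (of_nat :: nat \<Rightarrow> 'f)" by (metis injI linorder_neqE_nat)
  then show ?thesis using finite_imageD infinite_UNIV_nat by (metis finite_subset subset_UNIV)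
qed

lemma positive_sum_squares:
  assumes P: "positive_elements P" and "finite E" and "\<forall>e\<in>E. k e \<in> P"
  shows "if \<forall>e\<in>E. x e = 0 then (\<Sum>e\<in>E. k e * (x e)\<^sup>2) = 0 else (\<Sum>e\<in>E. k e * (x e)\<^sup>2) \<in> P"
  using assms(2,3)
proof (induction E rule: finite_induct)
  case (insert e E)
  have "k e * (x e)\<^sup>2 \<in> P" if "x e \<noteq> 0"
    using insert.prems P that unfolding positive_elements_def by blast
  moreover have "a + b \<in> P" if "a \<in> P" "b \<in> P" for a b
    using P that unfolding positive_elements_def by blast
  ultimately show ?case using insert by (cases "x e = 0") (auto split: if_splits)
qed simp

text \<open>
  The energy of \<open>\<phi>\<close> is a sum of squares with weights in \<open>P\<close>; it vanishes only if \<open>\<phi>\<close> is constant along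
  each edge, and then \<open>\<phi>\<close> pairs to zero with everything.
\<close>

lemma energy_definite:
  assumes P: "positive_elements P" and c: "open_circuit P X Y c" and 0: "energy c \<phi> \<phi> = 0"
  shows "energy c \<phi> \<chi> = 0" "energy c \<chi> \<phi> = 0"
proof -
  have k: "\<forall>e\<in>edges c. 1 / res c e \<in> P"
    using open_circuitD(9)[OF c] positive_one[OF P] P unfolding positive_elements_def by blast
  have "energy c \<phi> \<phi> = (\<Sum>e\<in>edges c. 1 / res c e * (\<phi> (tgt c e) - \<phi> (src c e))\<^sup>2)"
    by (simp add: energy_def power2_eq_square)
  then have "\<forall>e\<in>edges c. \<phi> (tgt c e) - \<phi> (src c e) = 0"
    using positive_sum_squares[OF P open_circuitD(4)[OF c] k, of "\<lambda>e. \<phi> (tgt c e) - \<phi> (src c e)"] 0 P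
    by (auto simp: positive_elements_def split: if_splits)
  then show "energy c \<phi> \<chi> = 0" "energy c \<chi> \<phi> = 0"
    by (simp_all add: energy_def)
qed

lemma energy_support:
  assumes c: "open_circuit P X Y c" and T: "T \<subseteq> nodes c" "\<forall>n\<in>nodes c. n \<notin> T \<longrightarrow> \<chi> n * energy c \<phi> (point n) = 0"
  shows "energy c \<phi> \<chi> = (\<Sum>n\<in>T. \<chi> n * energy c \<phi> (point n))"
proof -
  have "energy c \<phi> \<chi> = (\<Sum>n\<in>nodes c. \<chi> n * energy c \<phi> (point n))"
    using energy_point[OF c, of \<chi> \<phi>] by (simp add: energy_commute[of c \<phi>])
  also have "\<dots> = (\<Sum>n\<in>T. \<chi> n * energy c \<phi> (point n))"
    using open_circuitD(3)[OF c] T by (intro sum.mono_neutral_right) auto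
  finally show ?thesis .
qed

text \<open>
  Gram-Schmidt over the nodes of \<open>S\<close>.  For a new node \<open>m\<close>, let \<open>\<eta>\<close> be the indicator of \<open>m\<close> made
  orthogonal to the nodes already treated.  Adding a multiple of \<open>\<eta>\<close> to \<open>\<phi>\<close> corrects the current at \<open>m\<close>
  unless \<open>\<eta>\<close> has energy zero; but then \<open>\<eta>\<close> is in the kernel of the form and the current at \<open>m\<close> vanishes
  already.
\<close>

lemma harmonic_extension:
  fixes c :: "('a, 'f::field) circuit"
  assumes P: "positive_elements P" and c: "open_circuit P X Y c" and "finite S" "S \<subseteq> nodes c"
  shows "\<exists>\<phi>. (\<forall>n. n \<notin> S \<longrightarrow> \<phi> n = \<psi> n) \<and> (\<forall>n\<in>S. energy c \<phi> (point n) = 0)"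
  using assms(3,4)
proof (induction S arbitrary: \<psi> rule: finite_induct)
  case empty then show ?case by blast
next
  case (insert m S)
  have sub: "insert m S \<subseteq> nodes c" "S \<subseteq> nodes c" using insert.prems by auto
  obtain \<phi> where \<phi>: "\<forall>n. n \<notin> S \<longrightarrow> \<phi> n = \<psi> n" "\<forall>n\<in>S. energy c \<phi> (point n) = 0"
    using insert.IH[OF sub(2)] by blast
  obtain \<eta> :: "('a, 'f) vec" where \<eta>: "\<forall>n. n \<notin> S \<longrightarrow> \<eta> n = point m n" "\<forall>n\<in>S. energy c \<eta> (point n) = 0"
    using insert.IH[OF sub(2)] by blast
  have \<eta>m: "\<eta> m = 1" using \<eta>(1) insert.hyps by (simp add: point_def)
  have pair: "energy c \<phi>' \<eta> = energy c \<phi>' (point m)" if "\<forall>n\<in>S. energy c \<phi>' (point n) = 0" for \<phi>'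
  proof -
    have "energy c \<phi>' \<eta> = (\<Sum>n\<in>insert m S. \<eta> n * energy c \<phi>' (point n))"
      using \<eta>(1) by (intro energy_support[OF c sub(1)]) (auto simp: point_def)
    then show ?thesis using insert.hyps that \<eta>m by simp
  qed
  (* if the denominator is zero, so is the numerator, and every t would do *)
  define t where "t = - energy c \<phi> (point m) / energy c \<eta> (point m)"
  have "energy c \<phi> (point m) + t * energy c \<eta> (point m) = 0"
  proof (cases "energy c \<eta> (point m) = 0")
    case True
    then have "energy c \<phi> \<eta> = 0" using pair[OF \<eta>(2)] by (simp add: energy_definite(2)[OF P c, of \<eta>])
    then show ?thesis using pair[OF \<phi>(2)] True by simp
  qed (simp add: t_def)
  then have "energy c (\<lambda>n. \<phi> n + t * \<eta> n) (point n) = 0" if "n \<in> insert m S" for n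
    using \<phi>(2) \<eta>(2) that unfolding energy_linear by auto
  moreover have "\<phi> n + t * \<eta> n = \<psi> n" if "n \<notin> insert m S" for n
    using \<phi>(1) \<eta>(1) that by (simp add: point_def)
  ultimately show ?case by (intro exI[of _ "\<lambda>n. \<phi> n + t * \<eta> n"] conjI allI ballI impI)
qed

lemma ext_power_energy: "ext_power c \<phi> = 1 / 2 * energy c \<phi> \<phi>"
  by (simp add: ext_power_def energy_def power2_eq_square mult.assoc)

lemma ext_power_line:
  fixes P :: "'f::field set" and c :: "('a, 'f) circuit"
  assumes "positive_elements P"
  shows "ext_power c (\<lambda>n. \<phi> n + s * \<eta> n) = ext_power c \<phi> + energy c \<phi> \<eta> * s + ext_power c \<eta> * s\<^sup>2"
proof -
  have "energy c (\<lambda>n. \<phi> n + s * \<eta> n) (\<lambda>n. \<phi> n + s * \<eta> n)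
      = energy c \<phi> \<phi> + 2 * (energy c \<phi> \<eta> * s) + energy c \<eta> \<eta> * s\<^sup>2" for s :: 'f
    unfolding energy_linear energy_commute[of c \<eta> \<phi>] by (simp add: algebra_simps power2_eq_square)
  moreover have "1 / 2 * (2 * x) = x" for x :: 'f using positive_two[OF assms] by simp
  ultimately show ?thesis
    unfolding ext_power_energy by (simp only: distrib_left mult.assoc)
qed

lemma formal_partial_quadratic:
  fixes G :: "('a, 'f::field) vec \<Rightarrow> 'f"
  assumes inf: "infinite (UNIV :: 'f set)"
    and G: "\<And>t. G (\<phi>(n := t)) = a + b * (t - \<phi> n) + d * (t - \<phi> n)\<^sup>2"
  shows "formal_partial G n \<phi> = b"
proof -
  let ?x = "[:- \<phi> n, 1:]"
  let ?p = "[:a:] + smult b ?x + smult d (?x * ?x)"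
  have "(THE p. \<forall>t. poly p t = G (\<phi>(n := t))) = ?p"
  proof (rule the_equality)
    show p: "\<forall>t. poly ?p t = G (\<phi>(n := t))"
      by (simp add: G power2_eq_square algebra_simps)
    fix q assume q: "\<forall>t. poly q t = G (\<phi>(n := t))"
    have "{t. poly (q - ?p) t = 0} = UNIV" using p q by (simp only: poly_diff) simp
    then have "q - ?p = 0" using inf poly_roots_finite[of "q - ?p"] by fastforce
    then show "q = ?p" by simp
  qed
  then show ?thesis
    unfolding formal_partial_def by (simp add: pderiv_add pderiv_smult pderiv_mult pderiv_pCons)
qed

lemma formal_partial_ext_power:
  fixes c :: "('a, 'f::field) circuit" and P :: "'f set"
  assumes P: "positive_elements P"
  shows "formal_partial (ext_power c) n \<phi> = energy c \<phi> (point n)"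
proof (rule formal_partial_quadratic[OF positive_infinite[OF P]])
  fix t
  have "\<phi>(n := t) = (\<lambda>m. \<phi> m + (t - \<phi> n) * point n m)" by (auto simp: point_def fun_eq_iff)
  then show "ext_power c (\<phi>(n := t)) = ext_power c \<phi> + energy c \<phi> (point n) * (t - \<phi> n)
      + ext_power c (point n) * (t - \<phi> n)\<^sup>2"
    using ext_power_line[OF P] by simp
qed

lemma min_power_ext_iff:
  fixes P :: "'f::field set"
  assumes "positive_elements P"
  shows "min_power_ext c \<psi> (\<phi> :: ('a, 'f) vec) \<longleftrightarrow> \<phi> \<in> vecs (nodes c) \<and> (\<forall>n\<in>terminals c. \<phi> n = \<psi> n) \<and>
     (\<forall>n\<in>nodes c - terminals c. energy c \<phi> (point n) = 0)"
  unfolding min_power_ext_def formal_partial_ext_power[OF assms] ..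

lemma terminals_subset: "open_circuit P X Y c \<Longrightarrow> terminals c \<subseteq> nodes c"
  using open_circuitD[of P X Y c] by (auto simp: terminals_def)

lemma min_power_ext_exists:
  fixes P :: "'f::field set"
  assumes P: "positive_elements P" and c: "open_circuit P X Y c" and \<psi>: "\<psi> \<in> vecs (terminals c)"
  obtains \<phi> :: "('a, 'f) vec" where "min_power_ext c \<psi> \<phi>"
proof -
  have "finite (nodes c - terminals c)" using open_circuitD(3)[OF c] by simp
  then obtain \<phi> where "\<forall>n. n \<notin> nodes c - terminals c \<longrightarrow> \<phi> n = \<psi> n" "\<forall>n\<in>nodes c - terminals c. energy c \<phi> (point n) = 0"
    using harmonic_extension[OF P c, of "nodes c - terminals c" \<psi>] by blast
  moreover have "\<psi> n = 0" if "n \<notin> nodes c" for n using \<psi> terminals_subset[OF c] that by (auto simp: vecs_def)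
  ultimately have "min_power_ext c \<psi> \<phi>" unfolding min_power_ext_iff[OF P] by (auto simp: vecs_def)
  then show ?thesis by (rule that)
qed

text \<open>A minimizer pairs with \<open>\<chi>\<close> only through the terminals, since the current vanishes at interior nodes.\<close>

lemma min_power_energy:
  fixes P :: "'f::field set"
  assumes P: "positive_elements P" and c: "open_circuit P X Y c" and \<phi>: "min_power_ext c \<psi> \<phi>"
  shows "energy c \<phi> \<chi> = (\<Sum>n\<in>terminals c. \<chi> n * energy c \<phi> (point n))"
  using \<phi> unfolding min_power_ext_iff[OF P]
  by (intro energy_support[OF c terminals_subset[OF c]]) auto

text \<open>
  The difference of two minimizers vanishes on the terminals, so both minimizers are orthogonal to it; it has
  energy zero and does not change the power.
\<close>

lemma power_functional_eq:
  fixes P :: "'f::field set"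
  assumes P: "positive_elements P" and c: "open_circuit P X Y c" and \<phi>: "min_power_ext c \<psi> \<phi>"
  shows "power_functional c \<psi> = ext_power c \<phi>"
  unfolding power_functional_def
proof (rule the_equality)
  show "\<exists>\<phi>'. min_power_ext c \<psi> \<phi>' \<and> ext_power c \<phi> = ext_power c \<phi>'" using \<phi> by blast
next
  fix q assume "\<exists>\<phi>'. min_power_ext c \<psi> \<phi>' \<and> q = ext_power c \<phi>'"
  then obtain \<phi>' where \<phi>': "min_power_ext c \<psi> \<phi>'" "q = ext_power c \<phi>'" by blast
  (* the difference of the two minimizers, in the form in which energy_linear applies *)
  let ?w = "\<lambda>n. \<phi> n + (-1) * \<phi>' n"
  have w: "?w n = 0" if "n \<in> terminals c" for n
    using \<phi> \<phi>'(1) that unfolding min_power_ext_iff[OF P] by simp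
  have "energy c \<phi>'' ?w = 0" if "min_power_ext c \<psi> \<phi>''" for \<phi>''
    unfolding min_power_energy[OF P c that, of ?w] using w by (intro sum.neutral) auto
  then have 0: "energy c \<phi>' ?w = 0" "energy c \<phi> ?w = 0" using \<phi> \<phi>'(1) by blast+
  have "energy c ?w ?w = 0" unfolding energy_linear(1)[of c \<phi> "-1" \<phi>'] using 0 by simp
  then have "ext_power c ?w = 0" by (simp add: ext_power_energy)
  moreover have "(\<lambda>n. \<phi>' n + 1 * ?w n) = \<phi>" by auto
  ultimately have "ext_power c \<phi> = ext_power c \<phi>'"
    using ext_power_line[OF P, of c \<phi>' 1 ?w] 0(1) by (simp only: mult_zero_left add_0_right)
  then show "q = ext_power c \<phi>" using \<phi>' by simp
qed

text \<open>
  Moving \<open>\<psi>\<close> along the coordinate \<open>n\<close> moves the minimizer along a line in the direction of a minimizer \<open>\<eta>\<close>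
  for the indicator of \<open>n\<close>, along which the power is quadratic.  The linear coefficient
  \<open>energy c \<phi> \<eta>\<close> only sees \<open>\<eta>\<close> on the terminals.
\<close>

lemma formal_partial_power_functional:
  fixes P :: "'f::field set" and c :: "('a, 'f) circuit"
  assumes P: "positive_elements P" and c: "open_circuit P X Y c" and \<phi>: "min_power_ext c \<psi> \<phi>"
    and n: "n \<in> terminals c"
  shows "formal_partial (power_functional c) n \<psi> = energy c \<phi> (point n)"
proof -
  have "point n \<in> vecs (terminals c)" using n by (auto simp: vecs_def point_def)
  then obtain \<eta> :: "('a, 'f) vec" where \<eta>: "min_power_ext c (point n) \<eta>" using min_power_ext_exists[OF P c] by metis
  have "finite (terminals c)" using open_circuitD[OF c] by (simp add: terminals_def)
  then have 1: "energy c \<phi> \<eta> = energy c \<phi> (point n)"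
    unfolding min_power_energy[OF P c \<phi>, of \<eta>] using \<eta> n unfolding min_power_ext_iff[OF P]
    by (simp add: sum_point_mult)
  show ?thesis
  proof (rule formal_partial_quadratic[OF positive_infinite[OF P]])
    fix t
    have "min_power_ext c (\<psi>(n := t)) (\<lambda>m. \<phi> m + (t - \<psi> n) * \<eta> m)"
      using \<phi> \<eta> unfolding min_power_ext_iff[OF P] energy_linear by (auto simp: vecs_def point_def)
    from power_functional_eq[OF P c this]
    show "power_functional c (\<psi>(n := t)) = ext_power c \<phi> + energy c \<phi> (point n) * (t - \<psi> n)
        + ext_power c \<eta> * (t - \<psi> n)\<^sup>2"
      unfolding ext_power_line[OF P] 1 .
  qed
qed

lemma sum_fibre:
  assumes "finite X" "finite T" "f ` X \<subseteq> T"
  shows "(\<Sum>b\<in>T. \<chi> b * (\<Sum>x | x \<in> X \<and> f x = b. \<iota> x)) = (\<Sum>x\<in>X. \<iota> x * \<chi> (f x :: 'b) :: 'f::field)"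
proof -
  have "(\<Sum>b\<in>T. \<chi> b * (\<Sum>x | x \<in> X \<and> f x = b. \<iota> x)) = (\<Sum>b\<in>T. \<Sum>x | x \<in> X \<and> f x = b. \<iota> x * \<chi> (f x))"
    unfolding sum_distrib_left by (intro sum.cong refl) (auto simp: mult.commute)
  then show ?thesis using sum.group[OF assms, where h = "\<lambda>x. \<iota> x * \<chi> (f x)"] by simp
qed

lemma sum_fibre_point:
  "finite X \<Longrightarrow> (\<Sum>x | x \<in> X \<and> f x = b. \<iota> x) = (\<Sum>x\<in>X. \<iota> x * point b (f x))"
  by (subst sum.inter_filter) (auto intro!: sum.cong simp: point_def)

lemma blackboxI:
  assumes "\<psi> \<in> vecs (terminals c)" "\<iota>\<^sub>1 \<in> vecs (terminals c)" "\<iota>\<^sub>2 \<in> vecs (terminals c)"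
    "\<And>n. n \<in> terminals c \<Longrightarrow> \<iota>\<^sub>1 n + \<iota>\<^sub>2 n = formal_partial (power_functional c) n \<psi>"
    "u \<in> twisted_symplectify (inputs c) (terminals c) (inp c) (\<psi>, \<iota>\<^sub>1)"
    "v \<in> symplectify (outputs c) (terminals c) (outp c) (\<psi>, \<iota>\<^sub>2)"
  shows "(u, v) \<in> blackbox c"
proof -
  let ?g = "\<lambda>n. if n \<in> terminals c then formal_partial (power_functional c) n \<psi> else 0"
  have "(\<iota>\<^sub>1 + \<iota>\<^sub>2) n = ?g n" for n using assms(2,3) assms(4)[of n] by (cases "n \<in> terminals c") (simp_all add: vecs_def)
  then have "\<iota>\<^sub>1 + \<iota>\<^sub>2 = ?g" by (rule ext)
  moreover have "(\<psi>, ?g) \<in> graph_d (terminals c) (power_functional c)" using assms(1) unfolding graph_d_def by blast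
  moreover have "(u, v) \<in> (\<Union>(v\<^sub>1, v\<^sub>2)\<in>{((\<psi>, \<kappa>\<^sub>1), (\<psi>, \<kappa>\<^sub>2)) | \<kappa>\<^sub>1 \<kappa>\<^sub>2.
            \<kappa>\<^sub>1 \<in> vecs (terminals c) \<and> \<kappa>\<^sub>2 \<in> vecs (terminals c) \<and> \<kappa>\<^sub>1 + \<kappa>\<^sub>2 = \<iota>\<^sub>1 + \<iota>\<^sub>2}.
          twisted_symplectify (inputs c) (terminals c) (inp c) v\<^sub>1
            \<times> symplectify (outputs c) (terminals c) (outp c) v\<^sub>2)"
    using assms(2,3,5,6) by (intro UN_I[where a = "((\<psi>, \<iota>\<^sub>1), (\<psi>, \<iota>\<^sub>2))"]) (blast, simp)
  ultimately show ?thesis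
    unfolding blackbox_def by (intro UN_I[where a = "(\<psi>, ?g)"]) (simp_all only: prod.case)
qed

lemma blackboxE:
  assumes "(u, v) \<in> blackbox c"
  obtains \<psi> \<iota>\<^sub>1 \<iota>\<^sub>2 where "\<psi> \<in> vecs (terminals c)"
    "\<forall>n\<in>terminals c. \<iota>\<^sub>1 n + \<iota>\<^sub>2 n = formal_partial (power_functional c) n \<psi>"
    "u \<in> twisted_symplectify (inputs c) (terminals c) (inp c) (\<psi>, \<iota>\<^sub>1)"
    "v \<in> symplectify (outputs c) (terminals c) (outp c) (\<psi>, \<iota>\<^sub>2)"
proof -
  obtain \<psi> \<iota> \<iota>\<^sub>1 \<iota>\<^sub>2 where *: "(\<psi>, \<iota>) \<in> graph_d (terminals c) (power_functional c)" "\<iota>\<^sub>1 + \<iota>\<^sub>2 = \<iota>"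
    "u \<in> twisted_symplectify (inputs c) (terminals c) (inp c) (\<psi>, \<iota>\<^sub>1)"
    "v \<in> symplectify (outputs c) (terminals c) (outp c) (\<psi>, \<iota>\<^sub>2)"
    using assms unfolding blackbox_def by blast
  have "\<iota>\<^sub>1 n + \<iota>\<^sub>2 n = \<iota> n" for n using *(2) by auto
  with * show ?thesis by (intro that) (auto simp: graph_d_def)
qed

text \<open>
  The minimizer of a terminal potential is balanced by the differential of the power functional, split
  arbitrarily between inputs and outputs.  Conversely, restrict a balanced potential to the terminals;
  the fibre sums of the boundary currents are the two parts of the differential.
\<close>

theorem blackbox_eq_behavior:
  fixes P :: "'f::field set" and c :: "('a, 'f) circuit"
  assumes P: "positive_elements P" and c: "open_circuit P X Y c"
  shows "blackbox c = behavior c"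
proof (intro equalityI subrelI)
  note io = open_circuitD[OF c]
  let ?T = "terminals c"
  have T: "finite ?T" "inp c ` X \<subseteq> ?T" "outp c ` Y \<subseteq> ?T" using io by (auto simp: terminals_def)
  {
    fix u v assume "(u, v) \<in> blackbox c"
    then obtain \<psi> \<iota>\<^sub>1 \<iota>\<^sub>2 where b: "\<psi> \<in> vecs ?T"
      "\<forall>n\<in>?T. \<iota>\<^sub>1 n + \<iota>\<^sub>2 n = formal_partial (power_functional c) n \<psi>"
      "u \<in> twisted_symplectify (inputs c) ?T (inp c) (\<psi>, \<iota>\<^sub>1)" "v \<in> symplectify (outputs c) ?T (outp c) (\<psi>, \<iota>\<^sub>2)"
      by (rule blackboxE)
    obtain p q where u: "u = (p, - q)" "p \<in> vecs X" "q \<in> vecs X" "\<forall>x\<in>X. p x = \<psi> (inp c x)"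
      "\<forall>n\<in>?T. (\<Sum>x | x \<in> X \<and> inp c x = n. q x) = \<iota>\<^sub>1 n"
      using b(3) io by (auto simp: twisted_symplectify_def symplectify_def)
    obtain r s where v: "v = (r, s)" "r \<in> vecs Y" "s \<in> vecs Y" "\<forall>y\<in>Y. r y = \<psi> (outp c y)"
      "\<forall>n\<in>?T. (\<Sum>y | y \<in> Y \<and> outp c y = n. s y) = \<iota>\<^sub>2 n"
      using b(4) io by (auto simp: symplectify_def)
    obtain \<phi> where \<phi>: "min_power_ext c \<psi> \<phi>" using min_power_ext_exists[OF P c b(1)] by blast
    have \<phi>T: "\<phi> n = \<psi> n" if "n \<in> ?T" for n using \<phi> that by (simp add: min_power_ext_def)
    show "(u, v) \<in> behavior c"
    proof (rule behaviorI)
      show "balanced c \<phi> (snd u) (snd v)"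
        unfolding balanced_def
      proof
        fix \<chi>
        have "energy c \<phi> \<chi> = (\<Sum>n\<in>?T. \<chi> n * (\<iota>\<^sub>1 n + \<iota>\<^sub>2 n))"
          unfolding min_power_energy[OF P c \<phi>, of \<chi>]
          by (intro sum.cong) (simp_all add: b(2) formal_partial_power_functional[OF P c \<phi>])
        also have "\<dots> = (\<Sum>n\<in>?T. \<chi> n * (\<Sum>x | x \<in> X \<and> inp c x = n. q x))
            + (\<Sum>n\<in>?T. \<chi> n * (\<Sum>y | y \<in> Y \<and> outp c y = n. s y))"
          using u(5) v(5) by (simp add: distrib_left sum.distrib)
        also have "\<dots> = (\<Sum>x\<in>X. q x * \<chi> (inp c x)) + (\<Sum>y\<in>Y. s y * \<chi> (outp c y))"
          by (simp only: sum_fibre[OF io(1) T(1,2)] sum_fibre[OF io(2) T(1,3)])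
        finally show "energy c \<phi> \<chi> + (\<Sum>x\<in>inputs c. snd u x * \<chi> (inp c x)) = (\<Sum>y\<in>outputs c. snd v y * \<chi> (outp c y))"
          by (simp add: io u(1) v(1) sum_negf)
      qed
    qed (use u v io T \<phi>T in \<open>auto simp: pcs_def vecs_def\<close>)
  }
  {
    fix u v assume uv: "(u, v) \<in> behavior c"
    obtain \<phi> where b: "u \<in> pcs X" "v \<in> pcs Y" "\<forall>x\<in>X. fst u x = \<phi> (inp c x)"
      "\<forall>y\<in>Y. fst v y = \<phi> (outp c y)" "balanced c \<phi> (snd u) (snd v)"
      by (rule open_behaviorE[OF uv c])
    define \<psi> where "\<psi> n = (if n \<in> ?T then \<phi> n else 0)" for n
    define \<phi>' where "\<phi>' n = (if n \<in> nodes c then \<phi> n else 0)" for n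
    define \<iota>\<^sub>1 where "\<iota>\<^sub>1 n = (if n \<in> ?T then \<Sum>x | x \<in> X \<and> inp c x = n. - snd u x else 0)" for n
    define \<iota>\<^sub>2 where "\<iota>\<^sub>2 n = (if n \<in> ?T then \<Sum>y | y \<in> Y \<and> outp c y = n. snd v y else 0)" for n
    have "energy c \<phi>' (point n) = energy c \<phi> (point n)" for n
      by (rule energy_cong[OF c]) (simp_all add: \<phi>'_def)
    then have cur: "energy c \<phi>' (point n) = (\<Sum>y | y \<in> Y \<and> outp c y = n. snd v y) + (\<Sum>x | x \<in> X \<and> inp c x = n. - snd u x)" for n
      using b(5)[unfolded balanced_def, rule_format, of "point n"] io
      by (simp add: sum_fibre_point sum_negf algebra_simps)
    have \<phi>': "min_power_ext c \<psi> \<phi>'"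
      unfolding min_power_ext_iff[OF P]
    proof (intro conjI ballI)
      fix n assume n: "n \<in> nodes c - ?T"
      then have no: "{x. x \<in> X \<and> inp c x = n} = {}" "{y. y \<in> Y \<and> outp c y = n} = {}" using T by auto
      show "energy c \<phi>' (point n) = 0" unfolding cur no by simp
    qed (use terminals_subset[OF c] in \<open>auto simp: \<phi>'_def \<psi>_def vecs_def\<close>)
    show "(u, v) \<in> blackbox c"
    proof (rule blackboxI)
      show "\<psi> \<in> vecs ?T" "\<iota>\<^sub>1 \<in> vecs ?T" "\<iota>\<^sub>2 \<in> vecs ?T" by (simp_all add: vecs_def \<psi>_def \<iota>\<^sub>1_def \<iota>\<^sub>2_def)
      show "\<iota>\<^sub>1 n + \<iota>\<^sub>2 n = formal_partial (power_functional c) n \<psi>" if "n \<in> ?T" for n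
        unfolding formal_partial_power_functional[OF P c \<phi>' that] cur using that
        by (simp add: \<iota>\<^sub>1_def \<iota>\<^sub>2_def add.commute)
      have "(fst u, - snd u) \<in> symplectify (inputs c) ?T (inp c) (\<psi>, \<iota>\<^sub>1)"
        using b T io by (auto simp: symplectify_def pcs_def vecs_def \<psi>_def \<iota>\<^sub>1_def)
      then have "(fst u, - (- snd u)) \<in> twisted_symplectify (inputs c) ?T (inp c) (\<psi>, \<iota>\<^sub>1)"
        unfolding twisted_symplectify_def by blast
      then show "u \<in> twisted_symplectify (inputs c) ?T (inp c) (\<psi>, \<iota>\<^sub>1)" by simp
      have "(fst v, snd v) \<in> symplectify (outputs c) ?T (outp c) (\<psi>, \<iota>\<^sub>2)"
        using b T io by (auto simp: symplectify_def pcs_def vecs_def \<psi>_def \<iota>\<^sub>2_def)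
      then show "v \<in> symplectify (outputs c) ?T (outp c) (\<psi>, \<iota>\<^sub>2)" by simp
    qed
  }
qed

section \<open>The black box functor\<close>

text \<open>
  Composites are determined up to isomorphism, so a circuit isomorphic to \<open>d\<close> is also a composite of the identity
  with \<open>d\<close>, and \<open>behavior_composite\<close> applies.
\<close>

lemma behavior_circuit_rel:
  fixes c :: "('a, 'f::field) circuit"
  assumes cd: "(c, d) \<in> circuit_rel P"
  shows "behavior c = behavior d"
proof -
  obtain X Y where c: "open_circuit P X Y c" and d: "open_circuit P X Y d"
    using circuit_rel_open[OF cd] by blast
  let ?i = "cospan X X X id id :: ('a, 'f) circuit"
  have i: "open_circuit P X X ?i" using open_circuitD(1)[OF c] by (intro open_cospan) auto
  have "c\<lparr>inputs := X, inp := inp c \<circ> id\<rparr> = c" using open_circuitD(5)[OF c] by simp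
  then have ic: "composite ?i c c" using composite_precompose[OF c, of id X] by simp
  have id: "composite ?i d c" by (rule composite_cong[OF i c ic circuit_rel_refl[OF i] cd])
  have "d\<lparr>inputs := X, inp := inp d \<circ> id\<rparr> = d" using open_circuitD(5)[OF d] by simp
  then have id': "composite ?i d d" using composite_precompose[OF d, of id X] by simp
  show ?thesis using behavior_composite[OF i d id] behavior_composite[OF i d id'] by simp
qed

definition behavior_of_class :: "('a, 'f::field) circuit set \<Rightarrow> ('a, 'f) pc rel" where
  "behavior_of_class A = (\<Union>c\<in>A. behavior c)"

lemma behavior_of_class:
  assumes "open_circuit P X Y c"
  shows "behavior_of_class (circuit_class P c) = behavior c"
proof -
  have "(\<Union>d\<in>circuit_class P c. behavior d) = (\<Union>d\<in>circuit_class P c. behavior c)"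
    using behavior_circuit_rel by (intro SUP_cong) auto
  also have "\<dots> = behavior c" using circuit_rel_refl[OF assms] by blast
  finally show ?thesis by (simp add: behavior_of_class_def)
qed

lemma (in cat) inverse_arrows_id: "X \<in> Obj C \<Longrightarrow> inverse_arrows C X X (Id C X) (Id C X)"
  by (simp add: inverse_arrows_def id_hom id_comp)

text \<open>
  On classes of edgeless circuits the functor gives the arrows from which the structure of \<open>LagRel\<close> is built, so it
  preserves structure strictly and its coherence arrows are identities.
\<close>

theorem behavior_hypergraph_functor:
  "hypergraph_functor (Circ P :: ('a elt set, ('a, 'f::field) circuit set) hyper_data) LagRel
     (\<lambda>X. X) behavior_of_class (\<lambda>X Y. Id_on (pcs (X \<uplus> Y))) (Id_on (pcs {}))"
proof -
  let ?C = "Circ P :: ('a elt set, ('a, 'f) circuit set) hyper_data"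
  let ?D = "LagRel :: ('a elt set, ('a, 'f) pc rel) hyper_data"
  interpret CC: cospan_cat ?C "\<lambda>X N Y i j. circuit_class P (cospan X N Y i j)" by (rule cospan_cat_Circ)
  interpret DD: cospan_cat ?D "\<lambda>X N Y i j. behavior (cospan X N Y i j)" by (rule cospan_cat_LagRel)
  interpret C: hypergraph_cat ?C by (rule CC.hypergraph)
  interpret D: hypergraph_cat ?D by (rule DD.hypergraph)
  have ObjD: "Obj ?D = {X. finite X}" and ObjC: "Obj ?C = {X. finite X}"
    by (simp_all add: CC.Obj_eq DD.Obj_eq)
  have Ten: "TensO ?C = (\<uplus>)" "TensO ?D = (\<uplus>)" "UnitO ?C = {}" "UnitO ?D = {}"
    by (simp_all add: CC.TensO_eq DD.TensO_eq CC.UnitO_eq DD.UnitO_eq)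
  have Id: "Id_on (pcs X) = cat_data.Id ?D X" for X by (simp add: LagRel_def)
  have csp: "behavior_of_class (circuit_class P (cospan X N Y i j)) = (behavior (cospan X N Y i j) :: ('a, 'f) pc rel)"
    if "finite X" "finite N" "finite Y" "i \<in> X \<rightarrow> N" "j \<in> Y \<rightarrow> N" for X N Y i j
    by (rule behavior_of_class[OF open_cospan[OF that]])
  have preserves:
    "finite X \<Longrightarrow> behavior_of_class (cat_data.Id ?C X) = cat_data.Id ?D X"
    "finite X \<Longrightarrow> finite Y \<Longrightarrow> finite Z \<Longrightarrow> behavior_of_class (Assoc ?C X Y Z) = Assoc ?D X Y Z"
    "finite X \<Longrightarrow> behavior_of_class (LUnit ?C X) = LUnit ?D X"
    "finite X \<Longrightarrow> behavior_of_class (RUnit ?C X) = RUnit ?D X"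
    "finite X \<Longrightarrow> finite Y \<Longrightarrow> behavior_of_class (Symm ?C X Y) = Symm ?D X Y"
    "finite X \<Longrightarrow> behavior_of_class (Mu ?C X) = Mu ?D X"
    "finite X \<Longrightarrow> behavior_of_class (Eta ?C X) = Eta ?D X"
    "finite X \<Longrightarrow> behavior_of_class (Delta ?C X) = Delta ?D X"
    "finite X \<Longrightarrow> behavior_of_class (Eps ?C X) = Eps ?D X" for X Y Z
    by
      (simp_all add: CC.Id_eq DD.Id_eq CC.Assoc_eq DD.Assoc_eq CC.LUnit_eq DD.LUnit_eq CC.RUnit_eq DD.RUnit_eq
        CC.Symm_eq DD.Symm_eq CC.Mu_eq DD.Mu_eq CC.Eta_eq DD.Eta_eq CC.Delta_eq DD.Delta_eq
        CC.Eps_eq DD.Eps_eq csp Pi_iff)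
  have hom: "behavior_of_class f \<in> Hom ?D X Y" if "f \<in> Hom ?C X Y" for f X Y
  proof -
    obtain c where "open_circuit P X Y c" "f = circuit_class P c" using \<open>f \<in> Hom ?C X Y\<close> by (auto simp: Hom_Circ)
    then show ?thesis using lagrangian_behavior by (simp add: behavior_of_class LagRel_def)
  qed
  have tens: "behavior_of_class (f \<otimes>\<^bsub>?C\<^esub> g) = behavior_of_class f \<otimes>\<^bsub>?D\<^esub> behavior_of_class g"
    if "f \<in> Hom ?C X X'" "g \<in> Hom ?C Y Y'" for f g X Y X' Y'
  proof -
    obtain c d where c: "open_circuit P X X' c" "f = circuit_class P c"
      and d: "open_circuit P Y Y' d" "g = circuit_class P d"
      using \<open>f \<in> Hom ?C X X'\<close> \<open>g \<in> Hom ?C Y Y'\<close> by (auto simp: Hom_Circ)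
    show ?thesis
      unfolding c(2) d(2) Circ_tens[OF c(1) d(1)] behavior_of_class[OF c(1)] behavior_of_class[OF d(1)]
        behavior_of_class[OF open_tens[OF c(1) d(1)]]
      using behavior_tens[OF c(1) d(1)] by (simp add: LagRel_def)
  qed
  have comp: "behavior_of_class (g \<cdot>\<^bsub>?C\<^esub> f) = behavior_of_class g \<cdot>\<^bsub>?D\<^esub> behavior_of_class f"
    if "f \<in> Hom ?C X Y" "g \<in> Hom ?C Y Z" for f g X Y Z
  proof -
    obtain c d where c: "open_circuit P X Y c" "f = circuit_class P c"
      and d: "open_circuit P Y Z d" "g = circuit_class P d"
      using \<open>f \<in> Hom ?C X Y\<close> \<open>g \<in> Hom ?C Y Z\<close> by (auto simp: Hom_Circ)
    note e = composite_comp_circuit[OF c(1) d(1)]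
    show ?thesis
      unfolding c(2) d(2) Circ_comp[OF c(1) d(1) e] behavior_of_class[OF c(1)] behavior_of_class[OF d(1)]
        behavior_of_class[OF open_composite[OF c(1) d(1) e]]
      using behavior_composite[OF c(1) d(1) e] by (simp add: LagRel_def)
  qed
  note inv_id = DD.inv_arrow_eq[OF _ _ DD.inverse_arrows_id]
  show ?thesis
    unfolding Id
  proof (unfold_locales, unfold Ten)
    fix X Y :: "'a elt set" assume "X \<in> Obj ?C" "Y \<in> Obj ?C"
    then show "iso_arrow ?D (X \<uplus> Y) (X \<uplus> Y) (cat_data.Id ?D (X \<uplus> Y))"
      using DD.inverse_arrows_id[of "X \<uplus> Y"] by (auto simp: iso_arrow_def ObjC ObjD)
  next
    show "iso_arrow ?D {} {} (cat_data.Id ?D {})"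
      using DD.inverse_arrows_id[of "{}"] by (auto simp: iso_arrow_def ObjD)
  next
    fix X Y X' Y' :: "'a elt set" and f g
    assume fin: "X \<in> Obj ?C" "Y \<in> Obj ?C" "X' \<in> Obj ?C" "Y' \<in> Obj ?C"
      and fg: "f \<in> Hom ?C X X'" "g \<in> Hom ?C Y Y'"
    have fg': "behavior_of_class f \<otimes>\<^bsub>?D\<^esub> behavior_of_class g \<in> Hom ?D (X \<uplus> Y) (X' \<uplus> Y')"
      using fin fg hom by (intro DD.tens_hom') (auto simp: ObjC)
    show "cat_data.Id ?D (X' \<uplus> Y') \<cdot>\<^bsub>?D\<^esub> (behavior_of_class f \<otimes>\<^bsub>?D\<^esub> behavior_of_class g)
        = behavior_of_class (f \<otimes>\<^bsub>?C\<^esub> g) \<cdot>\<^bsub>?D\<^esub> cat_data.Id ?D (X \<uplus> Y)"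
      unfolding tens[OF fg] using DD.id_comp[OF _ _ fg'] DD.comp_id[OF _ _ fg'] fin by (simp add: ObjC ObjD)
  next
    fix X Y Z :: "'a elt set" assume fin: "X \<in> Obj ?C" "Y \<in> Obj ?C" "Z \<in> Obj ?C"
    have A: "Assoc ?D X Y Z \<in> Hom ?D ((X \<uplus> Y) \<uplus> Z) (X \<uplus> (Y \<uplus> Z))"
      using D.assoc_iso[of X Y Z] fin by (simp add: ObjC ObjD Ten iso_arrow_def inverse_arrows_def)
    show "behavior_of_class (Assoc ?C X Y Z) \<cdot>\<^bsub>?D\<^esub> cat_data.Id ?D ((X \<uplus> Y) \<uplus> Z)
          \<cdot>\<^bsub>?D\<^esub> (cat_data.Id ?D (X \<uplus> Y) \<otimes>\<^bsub>?D\<^esub> cat_data.Id ?D Z)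
        = cat_data.Id ?D (X \<uplus> (Y \<uplus> Z)) \<cdot>\<^bsub>?D\<^esub> (cat_data.Id ?D X \<otimes>\<^bsub>?D\<^esub> cat_data.Id ?D (Y \<uplus> Z))
          \<cdot>\<^bsub>?D\<^esub> Assoc ?D X Y Z"
      using DD.id_comp[OF _ _ A] DD.comp_id[OF _ _ A] fin
      by (simp add: preserves D.tens_id[unfolded Ten] DD.id_comp[OF _ _ DD.id_hom] ObjC ObjD)
  next
    fix X :: "'a elt set" assume fin: "X \<in> Obj ?C"
    have "LUnit ?D X \<in> Hom ?D ({} \<uplus> X) X" "RUnit ?D X \<in> Hom ?D (X \<uplus> {}) X"
      using D.lunit_iso[of X] D.runit_iso[of X] fin
      by (auto simp add: ObjC ObjD Ten iso_arrow_def inverse_arrows_def)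
    then show "behavior_of_class (LUnit ?C X) \<cdot>\<^bsub>?D\<^esub> cat_data.Id ?D ({} \<uplus> X)
        \<cdot>\<^bsub>?D\<^esub> (cat_data.Id ?D {} \<otimes>\<^bsub>?D\<^esub> cat_data.Id ?D X) = LUnit ?D X"
      "behavior_of_class (RUnit ?C X) \<cdot>\<^bsub>?D\<^esub> cat_data.Id ?D (X \<uplus> {})
        \<cdot>\<^bsub>?D\<^esub> (cat_data.Id ?D X \<otimes>\<^bsub>?D\<^esub> cat_data.Id ?D {}) = RUnit ?D X"
      using fin by (simp_all add: preserves D.tens_id[unfolded Ten] DD.comp_id ObjC ObjD)
  next
    fix X Y :: "'a elt set" assume fin: "X \<in> Obj ?C" "Y \<in> Obj ?C"
    then show "behavior_of_class (Symm ?C X Y) \<cdot>\<^bsub>?D\<^esub> cat_data.Id ?D (X \<uplus> Y)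
        = cat_data.Id ?D (Y \<uplus> X) \<cdot>\<^bsub>?D\<^esub> Symm ?D X Y"
      using DD.id_comp[OF _ _ D.symm_hom[of X Y, unfolded Ten]] DD.comp_id[OF _ _ D.symm_hom[of X Y, unfolded Ten]]
      by (simp add: preserves ObjC ObjD)
  next
    fix X :: "'a elt set" assume fin: "X \<in> Obj ?C"
    then show "Mu ?D X = behavior_of_class (Mu ?C X) \<cdot>\<^bsub>?D\<^esub> cat_data.Id ?D (X \<uplus> X)"
      "Eta ?D X = behavior_of_class (Eta ?C X) \<cdot>\<^bsub>?D\<^esub> cat_data.Id ?D {}"
      "Delta ?D X = inv_arrow ?D (X \<uplus> X) (X \<uplus> X) (cat_data.Id ?D (X \<uplus> X)) \<cdot>\<^bsub>?D\<^esub> behavior_of_class (Delta ?C X)"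
      "Eps ?D X = inv_arrow ?D {} {} (cat_data.Id ?D {}) \<cdot>\<^bsub>?D\<^esub> behavior_of_class (Eps ?C X)"
      using DD.comp_id[OF _ _ D.mu_hom[of X, unfolded Ten]] DD.comp_id[OF _ _ D.eta_hom[of X, unfolded Ten]]
        DD.id_comp[OF _ _ D.delta_hom[of X, unfolded Ten]] DD.id_comp[OF _ _ D.eps_hom[of X, unfolded Ten]]
      by (simp_all add: preserves inv_id ObjC ObjD)
  next
    fix X Y Z :: "'a elt set" and f g assume "f \<in> Hom ?C X Y" "g \<in> Hom ?C Y Z"
    then show "behavior_of_class (g \<cdot>\<^bsub>?C\<^esub> f) = behavior_of_class g \<cdot>\<^bsub>?D\<^esub> behavior_of_class f"
      by (rule comp)
  qed (simp_all add: ObjC ObjD preserves hom)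
qed

theorem theorem1p1:
  fixes P :: "'f::field set"
  assumes "positive_elements P"
  shows "\<exists>(Fo :: 'a elt set \<Rightarrow> 'a elt set) (Fm :: ('a, 'f) circuit set \<Rightarrow> ('a, 'f) pc rel) \<phi> \<phi>\<^sub>I.
     hypergraph_functor (Circ P) LagRel Fo Fm \<phi> \<phi>\<^sub>I \<and>
     (\<forall>X. finite X \<longrightarrow> Fo X = X) \<and>
     (\<forall>X Y c. open_circuit P X Y c \<longrightarrow> Fm (circuit_class P c) = blackbox c)"
proof (intro exI conjI allI impI)
  show "hypergraph_functor (Circ P) LagRel (\<lambda>X. X) (behavior_of_class :: ('a, 'f) circuit set \<Rightarrow> _)
      (\<lambda>X Y. Id_on (pcs (X \<uplus> Y))) (Id_on (pcs {}))"
    by (rule behavior_hypergraph_functor)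
  show "behavior_of_class (circuit_class P c) = blackbox c" if "open_circuit P X Y c"
    for X Y and c :: "('a, 'f) circuit"
    using behavior_of_class[OF that] blackbox_eq_behavior[OF assms that] by simp
qed simp

end
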